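(* Let $p\in[1,\infty)$, $\ell:=\frac{N}{2\beta}(p-1)$, $q\in(\ell,\infty]$ with $q\ge p$, and $u_0\in L^q(\mathbb{R}^N)$. If $u$ is an $L^q$-solution of $\partial_t^\alpha u+(-\Delta)^\beta u=|u|^{p-1}u$ with initial datum $u_0$ and existence time $T$, then $u\in C([0,T);L^q(\mathbb{R}^N))$.
   Context: Throughout, $N\ge1$ is an integer, $\alpha\in(0,1)$, $\beta\in(0,1]$, and $N>4\beta$. $\partial_t^\alpha$ is the Caputo derivative, $\partial_t^\alpha u(x,t)=\frac1{\Gamma(1-\alpha)}\partial_t\int_0^t\frac{u(x,s)-u(x,0)}{(t-s)^\alpha}ds$, and $(-\Delta)^\beta$ is the operator with Fourier symbol $|\xi|^{2\beta}$. $Z$ is the fundamental solution of $\partial_t^\alpha u+(-\Delta)^\beta u=0$ (initial datum a Dirac mass at $0$), and $Y(x,t)={}^{R}\partial_t^{1-\alpha}Z(x,t)=\frac{1}{\Gamma(\alpha)}\partial_t\int_0^t\frac{Z(x,s)}{(t-s)^{1-\alpha}}ds$. Equivalently, in terms of spatial Fourier transforms, $\hat Z(\xi,t)=E_{\alpha,1}(-|\xi|^{2\beta}t^\alpha)$ and $\hat Y(\xi,t)=t^{\alpha-1}E_{\alpha,\alpha}(-|\xi|^{2\beta}t^\alpha)$, with $E_{\alpha,\gamma}$ the Mittag-Leffler functions. For $q\in[1,\infty]$ and $u_0\in L^q(\mathbb{R}^N)$, an $L^q$-solution of $\partial_t^\alpha u+(-\Delta)^\beta u=|u|^{p-1}u$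 with initial datum $u_0$ and existence time $T\in(0,\infty]$ is a function $u\in L^\infty_{\rm loc}([0,T);L^q(\mathbb{R}^N))$ such that, for almost all $t\in(0,T)$, $$u(x,t)=\int_{\mathbb{R}^N} u_0(y)Z(x-y,t)\,dy+\int_0^t\int_{\mathbb{R}^N}|u(y,s)|^{p-1}u(y,s)Y(x-y,t-s)\,dy\,ds$$ as an identity in $L^q(\mathbb{R}^N)$, and $\operatorname{ess\,lim}_{t\to0^+}\|u(\cdot,t)-u_0\|_{L^q(\mathbb{R}^N)}=0$. Membership in $C([0,T);L^q(\mathbb{R}^N))$ is understood for the representative of $u$ given by the right-hand side of this formula for all $t\in(0,T)$, with value $u_0$ at $t=0$. *)

theory Defs
  imports "HOL-Analysis.Analysis" "HOL-Probability.Essential_Supremum"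
begin

text \<open>
  Elements of L^q(R^N) are represented by Borel functions, and equality in L^q(R^N) by equality
  almost everywhere. The exponent q lies in [1,\<infinity>].
\<close>

definition in_Lq :: "ereal \<Rightarrow> (real^'n \<Rightarrow> real) \<Rightarrow> bool" where
  "in_Lq q f \<longleftrightarrow> f \<in> borel_measurable lborel \<and>
     (if q = \<infinity> then esssup lborel (\<lambda>x. ereal \<bar>f x\<bar>) < \<infinity>
      else integrable lborel (\<lambda>x. \<bar>f x\<bar> powr real_of_ereal q))"

definition Lq_norm :: "ereal \<Rightarrow> (real^'n \<Rightarrow> real) \<Rightarrow> real" where
  "Lq_norm q f =
     (if q = \<infinity> then real_of_ereal (esssup lborel (\<lambda>x. ereal \<bar>f x\<bar>))
      else (LINT x|lborel. \<bar>f x\<bar> powr real_of_ereal q) powr (1 / real_of_ereal q))"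

text \<open>A map from [0,T) to L^q is a function of time t and position x, in this order.\<close>

definition continuous_Lq :: "ereal \<Rightarrow> ereal \<Rightarrow> (real \<Rightarrow> real^'n \<Rightarrow> real) \<Rightarrow> bool" where
  "continuous_Lq q T v \<longleftrightarrow>
     (\<forall>t. 0 \<le> t \<and> ereal t < T \<longrightarrow> in_Lq q (v t)) \<and>
     (\<forall>t0. 0 \<le> t0 \<and> ereal t0 < T \<longrightarrow>
        ((\<lambda>t. Lq_norm q (\<lambda>x. v t x - v t0 x)) \<longlongrightarrow> 0)
          (at t0 within {t. 0 \<le> t \<and> ereal t < T}))"

definition mittag_leffler :: "real \<Rightarrow> real \<Rightarrow> real \<Rightarrow> real" where
  "mittag_leffler \<alpha> \<gamma> z = (\<Sum>k. z ^ k / Gamma (\<alpha> * real k + \<gamma>))"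

definition fourier :: "(real^'n \<Rightarrow> real) \<Rightarrow> real^'n \<Rightarrow> complex" where
  "fourier f \<xi> = (LINT x|lborel. cis (- (\<xi> \<bullet> x)) * complex_of_real (f x))"

text \<open>
  The kernels Z and Y are given through their spatial Fourier transforms, which determine
  each Z t and Y t up to a null set. Nothing below depends on the choice of representatives.
  The transforms need not be integrable, so the kernels cannot be written as inverse Fourier
  integrals.
\<close>

definition has_spatial_fourier ::
    "(real \<Rightarrow> real^'n \<Rightarrow> real) \<Rightarrow> (real \<Rightarrow> real^'n \<Rightarrow> real) \<Rightarrow> bool" where
  "has_spatial_fourier K m \<longleftrightarrow>
     set_borel_measurable (lborel \<Otimes>\<^sub>M lborel) ({0<..} \<times> UNIV) (\<lambda>(t, x). K t x) \<and>
     (\<forall>t>0. integrable lborel (K t) \<and> (\<forall>\<xi>. fourier (K t) \<xi> = complex_of_real (m t \<xi>)))"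

definition is_kernel_Z :: "real \<Rightarrow> real \<Rightarrow> (real \<Rightarrow> real^'n \<Rightarrow> real) \<Rightarrow> bool" where
  "is_kernel_Z \<alpha> \<beta> Z \<longleftrightarrow> has_spatial_fourier Z
     (\<lambda>t \<xi>. mittag_leffler \<alpha> 1 (- (norm \<xi> powr (2 * \<beta>) * t powr \<alpha>)))"

definition is_kernel_Y :: "real \<Rightarrow> real \<Rightarrow> (real \<Rightarrow> real^'n \<Rightarrow> real) \<Rightarrow> bool" where
  "is_kernel_Y \<alpha> \<beta> Y \<longleftrightarrow> has_spatial_fourier Y
     (\<lambda>t \<xi>. t powr (\<alpha> - 1) * mittag_leffler \<alpha> \<alpha> (- (norm \<xi> powr (2 * \<beta>) * t powr \<alpha>)))"

text \<open>For p = 1 and r = 0 the convention 0 powr 0 = 0 is harmless because of the factor r.\<close>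

definition nonlinearity :: "real \<Rightarrow> real \<Rightarrow> real" where
  "nonlinearity p r = \<bar>r\<bar> powr (p - 1) * r"

definition mild_rhs ::
    "(real \<Rightarrow> real^'n \<Rightarrow> real) \<Rightarrow> (real \<Rightarrow> real^'n \<Rightarrow> real) \<Rightarrow> real \<Rightarrow>
     (real^'n \<Rightarrow> real) \<Rightarrow> (real \<Rightarrow> real^'n \<Rightarrow> real) \<Rightarrow> real \<Rightarrow> real^'n \<Rightarrow> real" where
  "mild_rhs Z Y p u0 u t x =
     (LINT y|lborel. u0 y * Z t (x - y)) +
     (LINT s:{0<..<t}|lborel. LINT y|lborel. nonlinearity p (u s y) * Y (t - s) (x - y))"

text \<open>
  The Bochner integral of a non-integrable function is 0, so absolute convergence of the
  integrals in the right-hand side has to be recorded separately.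
\<close>

definition mild_rhs_converges ::
    "(real \<Rightarrow> real^'n \<Rightarrow> real) \<Rightarrow> (real \<Rightarrow> real^'n \<Rightarrow> real) \<Rightarrow> real \<Rightarrow>
     (real^'n \<Rightarrow> real) \<Rightarrow> (real \<Rightarrow> real^'n \<Rightarrow> real) \<Rightarrow> real \<Rightarrow> bool" where
  "mild_rhs_converges Z Y p u0 u t \<longleftrightarrow>
     (AE x in lborel.
        integrable lborel (\<lambda>y. u0 y * Z t (x - y)) \<and>
        set_integrable (lborel \<Otimes>\<^sub>M lborel) ({0<..<t} \<times> UNIV)
          (\<lambda>(s, y). nonlinearity p (u s y) * Y (t - s) (x - y)))"

text \<open>
  The first two clauses say that u belongs to L^\<infinity>_loc([0,T); L^q), as a jointly measurable
  function on (0,T) x R^N; boundedness is required on (0,T') for every T' < T, that is, up to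
  time 0. The third is the integral equation in L^q, and the last is the essential limit at 0.
\<close>

definition Lq_solution ::
    "(real \<Rightarrow> real^'n \<Rightarrow> real) \<Rightarrow> (real \<Rightarrow> real^'n \<Rightarrow> real) \<Rightarrow> real \<Rightarrow> ereal \<Rightarrow> ereal \<Rightarrow>
     (real^'n \<Rightarrow> real) \<Rightarrow> (real \<Rightarrow> real^'n \<Rightarrow> real) \<Rightarrow> bool" where
  "Lq_solution Z Y p q T u0 u \<longleftrightarrow>
     set_borel_measurable (lborel \<Otimes>\<^sub>M lborel) ({t. 0 < t \<and> ereal t < T} \<times> UNIV)
       (\<lambda>(t, x). u t x) \<and>
     (\<forall>T'. 0 < T' \<and> ereal T' < T \<longrightarrow>
        (\<exists>C. AE t in lborel. 0 < t \<and> t < T' \<longrightarrow> in_Lq q (u t) \<and> Lq_norm q (u t) \<le> C)) \<and>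
     (AE t in lborel. 0 < t \<and> ereal t < T \<longrightarrow>
        mild_rhs_converges Z Y p u0 u t \<and> (AE x in lborel. u t x = mild_rhs Z Y p u0 u t x)) \<and>
     (\<forall>\<epsilon>>0. \<exists>\<delta>>0. AE t in lborel. 0 < t \<and> t < \<delta> \<and> ereal t < T \<longrightarrow>
        Lq_norm q (\<lambda>x. u t x - u0 x) < \<epsilon>)"

definition mild_representative ::
    "(real \<Rightarrow> real^'n \<Rightarrow> real) \<Rightarrow> (real \<Rightarrow> real^'n \<Rightarrow> real) \<Rightarrow> real \<Rightarrow>
     (real^'n \<Rightarrow> real) \<Rightarrow> (real \<Rightarrow> real^'n \<Rightarrow> real) \<Rightarrow> real \<Rightarrow> real^'n \<Rightarrow> real" where
  "mild_representative Z Y p u0 u t = (if t = 0 then u0 else mild_rhs Z Y p u0 u t)"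

end

theory Submission
  imports Defs "HOL-Probability.Probability" "HOL-Real_Asymp.Real_Asymp"
begin

text \<open>
The right-hand side of the integral equation is estimated with Young's inequality, so everything
rests on bounds for the kernels. Only their Fourier transforms are given, and the first task is to
turn these into pointwise information. Both kernels are mixtures of Gaussians with positive
weights. Indeed, if \<open>S\<close> is a positive random variable with Laplace transform \<open>exp (- l\<^sup>\<alpha>)\<close>, its
negative moments are \<open>E S\<^sup>-\<^sup>\<delta> = \<Gamma>(1 + \<delta>/\<alpha>) / \<Gamma>(1 + \<delta>)\<close>, and comparing power series gives
\<open>E exp (- x S\<^sup>-\<^sup>\<alpha>) = E\<^sub>\<alpha>\<^sub>,\<^sub>1(- x)\<close> and \<open>E (\<alpha> S\<^sup>-\<^sup>\<alpha> exp (- x S\<^sup>-\<^sup>\<alpha>)) = E\<^sub>\<alpha>\<^sub>,\<^sub>\<alpha>(- x)\<close>. With a further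
independent \<open>\<beta>\<close>-stable variable to produce \<open>x = y\<^sup>\<beta>\<close>, both functions of \<open>y = |\<xi>|\<^sup>2\<close> become
Laplace transforms of finite measures \<open>\<nu>\<close> on the half-line
(\<open>mixing_measure_Z\<close>, \<open>mixing_measure_Y\<close>). Since \<open>exp (- \<theta> |\<xi>|\<^sup>2)\<close> is the transform of the heat
kernel at time \<open>\<theta>\<close> and the Fourier transform is injective on \<open>L\<^sup>1\<close> (\<open>fourier_unique\<close>), the kernel
at time \<open>t\<close> is, up to a power of \<open>t\<close>, the integral of the heat kernel at time
\<open>t powr (\<alpha> / \<beta>) * \<theta>\<close> against \<open>\<nu>(d\<theta>)\<close> (\<open>kernel_eq_heat_mixture\<close>).

For such a mixture all norms are explicit. Put \<open>\<gamma> = N/2 (1 - 1/r)\<close>. The \<open>L\<^sup>r\<close> norm of the heat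
kernel at time \<open>\<theta>\<close> is at most \<open>\<theta> powr (- \<gamma>)\<close>, so by Minkowski's inequality the \<open>L\<^sup>r\<close> norm of \<open>Y t\<close> is
at most a constant times \<open>t powr (- d)\<close> with \<open>d = 1 - \<alpha> + \<alpha> \<gamma> / \<beta>\<close>, provided that \<open>\<nu>\<close> has a finite
moment of order \<open>- \<gamma>\<close>, which holds for \<open>\<gamma> < \<beta>\<close>. Young's inequality sends \<open>L\<close> with exponent \<open>q/p\<close>
to \<open>L\<^sup>q\<close> when \<open>1/r = 1 - (p - 1)/q\<close>; then \<open>\<gamma> = N (p - 1) / (2 q)\<close>, and \<open>\<gamma> < \<beta>\<close> is precisely the
hypothesis \<open>l < q\<close>. The same inequality makes \<open>d < 1\<close>, so the singularity of \<open>Y\<close> at time \<open>0\<close>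
is integrable.

Continuity for positive times comes from a Hoelder estimate in time: for \<open>s < t\<close> the difference of
the kernels at \<open>s\<close> and \<open>t\<close> is at most a constant times \<open>((t - s) / s) powr \<epsilon>\<close> times the sum of two
similar mixtures, with \<open>\<theta>\<close> doubled (\<open>heat_mixture_difference\<close>). Choosing \<open>\<epsilon>\<close> so small that
\<open>d + \<epsilon> < 1\<close>, the factor \<open>s powr (- \<epsilon>)\<close> remains integrable, and both the free part and the
Duhamel part of the solution are Hoelder continuous into \<open>L\<^sup>q\<close> (\<open>convolution_Lq_difference\<close>,
\<open>duhamel_difference\<close>).

At time \<open>0\<close> these bounds say nothing, and for \<open>q = \<infinity>\<close> the free part alone need not converge to the
initial datum. Instead, the essential limit that is part of the notion of solution becomes a
limit: every time near \<open>0\<close> is, by continuity on the positive times, a limit of times at which the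
representative agrees with the solution.
\<close>

section \<open>Stable laws on the half-line\<close>

definition laplace_law :: "real measure \<Rightarrow> (real \<Rightarrow> real) \<Rightarrow> bool" where
  "laplace_law M f \<longleftrightarrow> real_distribution M \<and> (AE x in M. 0 \<le> x) \<and>
     (\<forall>l>0. (\<integral>x. exp (- (l * x)) \<partial>M) = f l)"

lemma laplace_lawD:
  assumes "laplace_law M f"
  shows "real_distribution M" "AE x in M. 0 \<le> x" "\<And>l. 0 < l \<Longrightarrow> (\<integral>x. exp (- (l * x)) \<partial>M) = f l"
  using assms by (auto simp: laplace_law_def)

lemma laplace_law_integrable:
  assumes "laplace_law M f" "0 < l"
  shows "integrable M (\<lambda>x. exp (- (l * x)))"
proof -
  interpret real_distribution M using assms(1) by (rule laplace_lawD)
  show ?thesis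
    using laplace_lawD(2)[OF assms(1)] assms(2)
    by (intro integrable_const_bound[where B = 1]) (auto elim!: eventually_mono)
qed

lemma laplace_law_convolution:
  assumes M: "laplace_law M f" and N: "laplace_law N g"
  shows "laplace_law (M \<star> N) (\<lambda>l. f l * g l)"
proof -
  interpret M: real_distribution M using M by (rule laplace_lawD)
  interpret N: real_distribution N using N by (rule laplace_lawD)
  interpret P: pair_prob_space M N ..
  have m[measurable]: "(\<lambda>(x, y). x + y) \<in> M \<Otimes>\<^sub>M N \<rightarrow>\<^sub>M borel" by measurable
  have AE: "AE z in M \<Otimes>\<^sub>M N. 0 \<le> fst z + snd z"
  proof (rule P.AE_pair_measure)
    have "Measurable.pred (M \<Otimes>\<^sub>M N) (\<lambda>z. 0 \<le> fst z + snd z)" by measurable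
    then show "{z \<in> space (M \<Otimes>\<^sub>M N). 0 \<le> fst z + snd z} \<in> sets (M \<Otimes>\<^sub>M N)"
      by (rule predE)
    show "AE x in M. AE y in N. 0 \<le> fst (x, y) + snd (x, y)"
      using laplace_lawD(2)[OF M]
    proof eventually_elim
      case (elim x)
      show ?case using laplace_lawD(2)[OF N] by eventually_elim (use elim in simp)
    qed
  qed
  show ?thesis
    unfolding laplace_law_def
  proof (intro conjI allI impI)
    show "real_distribution (M \<star> N)"
      unfolding convolution_def by (rule P.real_distribution_distr) (rule m)
    show "AE x in M \<star> N. 0 \<le> x"
      unfolding convolution_def using AE by (subst AE_distr_iff) (auto simp: split_beta)
    fix l :: real assume l: "0 < l"
    have int: "integrable (M \<Otimes>\<^sub>M N) (\<lambda>z. exp (- (l * (fst z + snd z))))"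
      using AE l by (intro P.integrable_const_bound[where B = 1]) (auto elim!: eventually_mono)
    have "(\<integral>x. exp (- (l * x)) \<partial>(M \<star> N)) = (\<integral>z. exp (- (l * (fst z + snd z))) \<partial>(M \<Otimes>\<^sub>M N))"
      unfolding convolution_def by (subst integral_distr) (auto simp: split_beta)
    also have "\<dots> = (\<integral>x. \<integral>y. exp (- (l * (x + y))) \<partial>N \<partial>M)"
      using P.integral_fst'[OF int] by simp
    also have "\<dots> = (\<integral>x. exp (- (l * x)) * g l \<partial>M)"
    proof (rule Bochner_Integration.integral_cong[OF refl])
      fix x
      have "(\<integral>y. exp (- (l * (x + y))) \<partial>N) = (\<integral>y. exp (- (l * x)) * exp (- (l * y)) \<partial>N)"
        by (simp add: distrib_left flip: exp_add)
      then show "(\<integral>y. exp (- (l * (x + y))) \<partial>N) = exp (- (l * x)) * g l"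
        using laplace_lawD(3)[OF N l] by simp
    qed
    also have "\<dots> = f l * g l"
      using laplace_lawD(3)[OF M l] by simp
    finally show "(\<integral>x. exp (- (l * x)) \<partial>(M \<star> N)) = f l * g l" .
  qed
qed

lemma laplace_law_power:
  assumes M: "laplace_law M f"
  shows "\<exists>L. laplace_law L (\<lambda>l. f l ^ n)"
proof (induction n)
  case 0
  have "laplace_law (return borel 0) (\<lambda>l. f l ^ 0)"
    unfolding laplace_law_def real_distribution_def real_distribution_axioms_def
    by (auto simp: prob_space_return AE_return integral_return)
  then show ?case by blast
next
  case (Suc n)
  then show ?case using laplace_law_convolution[OF M] by auto
qed

lemma laplace_law_scale:
  assumes M: "laplace_law M f" and c: "0 < c"
  shows "laplace_law (distr M borel (\<lambda>x. c * x)) (\<lambda>l. f (c * l))"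
proof -
  interpret M: real_distribution M using M by (rule laplace_lawD)
  show ?thesis
    unfolding laplace_law_def
  proof (intro conjI allI impI)
    show "real_distribution (distr M borel (\<lambda>x. c * x))"
      by (rule M.real_distribution_distr) simp
    show "AE x in distr M borel (\<lambda>x. c * x). 0 \<le> x"
      using laplace_lawD(2)[OF M] c by (subst AE_distr_iff) (auto elim!: eventually_mono)
    fix l :: real assume l: "0 < l"
    show "(\<integral>x. exp (- (l * x)) \<partial>distr M borel (\<lambda>x. c * x)) = f (c * l)"
      using laplace_lawD(3)[OF M, of "c * l"] c l by (subst integral_distr) (auto simp: mult_ac)
  qed
qed

text \<open>
A continuity theorem for Laplace transforms. The uniform lower bound on the transforms controls
the tails through \<open>exp (- x / b) \<le> 1/2\<close> for \<open>x > b\<close>, hence gives tightness, and Helly's theorem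
yields a weak limit along a subsequence.
\<close>

lemma laplace_law_limit:
  assumes M: "\<And>n. laplace_law (M n) (f n)"
    and low: "\<And>n l. 0 < l \<Longrightarrow> 1 - l powr a \<le> f n l" and a: "0 < a"
    and lim: "\<And>l. 0 < l \<Longrightarrow> (\<lambda>n. f n l) \<longlonglongrightarrow> g l"
  shows "\<exists>L. laplace_law L g"
proof -
  have rd: "real_distribution (M n)" for n using M by (rule laplace_lawD)
  have tail: "measure (M n) {-1<..b} \<ge> 1 - 2 * b powr (- a)" if b: "0 < b" for n b
  proof -
    interpret real_distribution "M n" by (rule rd)
    \<comment> \<open>\<open>1/2\<close> may replace \<open>exp (- 1)\<close>, which keeps the constants rational\<close>
    have pt: "exp (- ((1 / b) * x)) \<le> 1 / 2 + 1 / 2 * indicator {-1<..b} x" if x: "0 \<le> x" for x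
    proof (cases "x \<le> b")
      case False
      have "1 / b * x \<ge> 1" using False b by (simp add: field_simps)
      then have "exp (- ((1 / b) * x)) \<le> exp (- 1)" by simp
      also have "\<dots> \<le> 1 / 2"
        using exp_ge_add_one_self[of 1] by (simp add: exp_minus field_simps)
      finally show ?thesis using False by simp
    qed (use x b in auto)
    have "1 - b powr (- a) = 1 - (1 / b) powr a"
      using b by (simp add: powr_minus powr_divide field_simps)
    also have "\<dots> \<le> f n (1 / b)" using low[of "1 / b" n] b by simp
    also have "\<dots> = (\<integral>x. exp (- ((1 / b) * x)) \<partial>M n)"
      using laplace_lawD(3)[OF M, of "1 / b" n] b by (simp del: times_divide_eq_left)
    also have "\<dots> \<le> (\<integral>x. 1 / 2 + 1 / 2 * indicator {-1<..b} x \<partial>M n)"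
    proof (rule integral_mono_AE)
      show "AE x in M n. exp (- ((1 / b) * x)) \<le> 1 / 2 + 1 / 2 * indicator {-1<..b} x"
        using laplace_lawD(2)[OF M[of n]] by eventually_elim (rule pt)
      show "integrable (M n) (\<lambda>x. exp (- (1 / b * x)))"
        using b by (intro laplace_law_integrable[OF M]) simp
      have "integrable (M n) (indicator {-1<..b} :: real \<Rightarrow> real)"
        by (intro integrable_real_indicator) (auto simp: emeasure_eq_measure)
      then show "integrable (M n) (\<lambda>x. 1 / 2 + 1 / 2 * indicator {-1<..b} x :: real)"
        by simp
    qed
    also have "\<dots> = 1 / 2 + 1 / 2 * measure (M n) {-1<..b}"
    proof -
      have "integrable (M n) (indicator {-1<..b} :: real \<Rightarrow> real)"
        by (intro integrable_real_indicator) (auto simp: emeasure_eq_measure)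
      then show ?thesis using prob_space by simp
    qed
    finally show ?thesis by simp
  qed
  have "tight M"
    unfolding tight_def
  proof (intro conjI allI impI)
    fix e :: real assume e: "0 < e"
    have "((\<lambda>b. 2 * b powr (- a)) \<longlongrightarrow> 0) at_top" using a by real_asymp
    then have "eventually (\<lambda>b. 2 * b powr (- a) < e) at_top"
      by (rule order_tendstoD) (rule e)
    then obtain b where b: "0 < b" "2 * b powr (- a) < e"
      using eventually_happens[OF eventually_conj[OF eventually_gt_at_top[of 0]]] by force
    have "\<forall>n. measure (M n) {-1<..b} > 1 - e"
      using tail[OF b(1)] b(2) by (smt (verit))
    with b(1) show "\<exists>a b. a < b \<and> (\<forall>n. measure (M n) {a<..b} > 1 - e)"
      by (intro exI[of _ "-1"] exI[of _ b]) auto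
  qed (rule rd)
  then obtain r L where r: "strict_mono (r :: nat \<Rightarrow> nat)" and L: "real_distribution L"
    and "weak_conv_m (M \<circ> id \<circ> r) L"
    using tight_imp_convergent_subsubsequence[of M id] by (auto simp: strict_mono_def)
  then have wc: "weak_conv_m (\<lambda>n. M (r n)) L" by (simp add: comp_def)
  interpret L: real_distribution L by (rule L)
  have conv: "(\<lambda>n. \<integral>x. h x \<partial>M (r n)) \<longlonglongrightarrow> (\<integral>x. h x \<partial>L)"
    if "\<And>x. isCont h x" "\<And>x. norm (h x) \<le> 1" for h :: "real \<Rightarrow> real"
    using weak_conv_imp_integral_bdd_continuous_conv[OF rd L wc, of h 1] that by simp
  \<comment> \<open>weak limits keep the support in the half-line\<close>
  have nonneg: "AE x in L. 0 \<le> x"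
  proof -
    \<comment> \<open>a bounded continuous function that vanishes exactly on the half-line\<close>
    define h where "h x = min 1 (max 0 (- x))" for x :: real
    have [measurable]: "h \<in> borel_measurable borel" unfolding h_def by measurable
    have "(\<integral>x. h x \<partial>M (r n)) = 0" for n
    proof -
      have "AE x in M (r n). h x = 0"
        using laplace_lawD(2)[OF M] by eventually_elim (auto simp: h_def)
      then show ?thesis by (rule integral_eq_zero_AE)
    qed
    moreover have "(\<lambda>n. \<integral>x. h x \<partial>M (r n)) \<longlonglongrightarrow> (\<integral>x. h x \<partial>L)"
      by (rule conv) (auto simp: h_def intro!: continuous_intros)
    ultimately have "(\<integral>x. h x \<partial>L) = 0" by (simp add: LIMSEQ_const_iff)
    moreover have "integrable L h"
      by (rule L.integrable_const_bound[where B = 1]) (auto simp: h_def)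
    moreover have "AE x in L. 0 \<le> h x" by (simp add: h_def)
    ultimately have "AE x in L. h x = 0"
      using integral_nonneg_eq_0_iff_AE[of L h] by blast
    then show ?thesis by eventually_elim (auto simp: h_def min_def max_def split: if_splits)
  qed
  have "laplace_law L g"
    unfolding laplace_law_def
  proof (intro conjI allI impI L nonneg)
    fix l :: real assume l: "0 < l"
    have "(\<lambda>n. \<integral>x. exp (- (l * max 0 x)) \<partial>M (r n)) \<longlonglongrightarrow> (\<integral>x. exp (- (l * max 0 x)) \<partial>L)"
      using l by (intro conv) (auto intro!: continuous_intros)
    moreover have "(\<integral>x. exp (- (l * max 0 x)) \<partial>M (r n)) = f (r n) l" for n
    proof -
      interpret Mr: real_distribution "M (r n)" by (rule rd)
      have "AE x in M (r n). exp (- (l * max 0 x)) = exp (- (l * x))"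
        using laplace_lawD(2)[OF M[of "r n"]] by eventually_elim (simp add: max_def)
      then have "(\<integral>x. exp (- (l * max 0 x)) \<partial>M (r n)) = (\<integral>x. exp (- (l * x)) \<partial>M (r n))"
        by (intro integral_cong_AE) auto
      then show ?thesis using laplace_lawD(3)[OF M l] by simp
    qed
    moreover have "AE x in L. exp (- (l * max 0 x)) = exp (- (l * x))"
      using nonneg by eventually_elim (simp add: max_def)
    then have "(\<integral>x. exp (- (l * max 0 x)) \<partial>L) = (\<integral>x. exp (- (l * x)) \<partial>L)"
      by (intro integral_cong_AE) auto
    ultimately have "(\<lambda>n. f (r n) l) \<longlonglongrightarrow> (\<integral>x. exp (- (l * x)) \<partial>L)" by simp
    moreover have "(\<lambda>n. f (r n) l) \<longlonglongrightarrow> g l"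
      using LIMSEQ_subseq_LIMSEQ[OF lim[OF l] r] by (simp add: comp_def)
    ultimately show "(\<integral>x. exp (- (l * x)) \<partial>L) = g l" by (rule LIMSEQ_unique)
  qed
  then show ?thesis ..
qed

text \<open>
For \<open>0 < a < 1\<close> all coefficients of \<open>1 - (1 - z)\<^sup>a\<close> are nonnegative and they sum to \<open>1\<close>, so this is
the generating function of a probability distribution on the positive integers, the Sibuya
distribution. The laws of its rescaled partial sums converge to the stable law.
\<close>

lemma sibuya_law_exists:
  assumes a: "0 < a" "a < 1"
  shows "\<exists>L. laplace_law L (\<lambda>l. 1 - (1 - exp (- l)) powr a)"
proof -
  define c where "c k = (if k = 0 then 0 else - ((a gchoose k) * (-1) ^ k))" for k :: nat
  have step: "(a gchoose Suc k) = (a gchoose k) * (a - real k) / (real k + 1)" for k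
    using gbinomial_absorb_comp[of a k] gbinomial_absorption[of k a]
    by (simp add: field_simps) 
  have c_nonneg: "0 \<le> c k" for k
  proof (induction k)
    case (Suc k)
    show ?case
    proof (cases "k = 0")
      case False
      have "c (Suc k) = c k * ((real k - a) / (real k + 1))"
        using False by (simp add: c_def step field_simps)
      then show ?thesis using Suc False a by simp
    qed (use a in \<open>simp add: c_def\<close>)
  qed (simp add: c_def)
  have gf: "(\<lambda>k. c k * z ^ k) sums (1 - (1 - z) powr a)" if z: "0 \<le> z" "z < 1" for z
  proof -
    have s: "(\<lambda>k. (a gchoose k) * (- z) ^ k) sums ((1 - z) powr a)"
      using gen_binomial_real[of "- z" a] z by simp
    have e: "(\<lambda>k. (if k = 0 then 1 else 0) - (a gchoose k) * (- z) ^ k) = (\<lambda>k. c k * z ^ k)"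
      by (auto simp: c_def power_minus[of z])
    have "(\<lambda>k. if k = 0 then 1 else 0 :: real) sums 1"
      using sums_single[of 0 "\<lambda>_. 1 :: real"] by simp
    from sums_diff[OF this s] show ?thesis unfolding e .
  qed
  have c_le: "(\<Sum>k<n. c k) \<le> 1" for n
  proof (rule tendsto_upperbound)
    show "((\<lambda>z. \<Sum>k<n. c k * z ^ k) \<longlongrightarrow> (\<Sum>k<n. c k)) (at_left 1)"
      by (auto intro!: tendsto_eq_intros)
    have "eventually (\<lambda>z :: real. 0 < z \<and> z < 1) (at_left 1)"
      unfolding eventually_at_left[of 0 1, OF zero_less_one] by (auto intro!: exI[of _ 0])
    then show "eventually (\<lambda>z. (\<Sum>k<n. c k * z ^ k) \<le> 1) (at_left 1)"
    proof eventually_elim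
      case (elim z)
      have "(\<Sum>k<n. c k * z ^ k) \<le> 1 - (1 - z) powr a"
        using gf[of z] elim c_nonneg
        by (subst sums_unique[OF gf[of z]]) (auto intro!: sum_le_suminf sums_summable)
      then show ?case by (smt (verit) powr_ge_zero)
    qed
  qed simp
  have summ: "summable c"
    using c_nonneg c_le by (intro summableI_nonneg_bounded)
  have "suminf c = 1"
  proof (rule antisym)
    show "suminf c \<le> 1" using c_le summ by (intro suminf_le_const) auto
    have "((\<lambda>z. 1 - (1 - z) powr a) \<longlongrightarrow> 1 - 0) (at_left 1)" using a by real_asymp
    moreover have "eventually (\<lambda>z :: real. 0 < z \<and> z < 1) (at_left 1)"
      unfolding eventually_at_left[of 0 1, OF zero_less_one] by (auto intro!: exI[of _ 0])
    then have "eventually (\<lambda>z. 1 - (1 - z) powr a \<le> suminf c) (at_left 1)"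
    proof eventually_elim
      case (elim z)
      have "z ^ k \<le> 1" for k using elim by (simp add: power_le_one)
      then show ?case
        using elim c_nonneg summ
        by (intro sums_le[OF _ gf[of z] summable_sums]) (auto intro: mult_left_le)
    qed
    ultimately have "1 - 0 \<le> suminf c"
      by (intro tendsto_upperbound[where F = "at_left (1 :: real)"]) auto
    then show "1 \<le> suminf c" by simp
  qed
  then have nnc: "(\<integral>\<^sup>+k. ennreal (c k) \<partial>count_space UNIV) = 1"
    using c_nonneg summ by (simp add: nn_integral_count_space_nat suminf_ennreal2)
  define P where "P = embed_pmf c"
  have pmfP: "pmf P k = c k" for k
    unfolding P_def by (rule pmf_embed_pmf) (auto simp: c_nonneg nnc)
  define L where "L = distr (measure_pmf P) borel real"
  have "laplace_law L (\<lambda>l. 1 - (1 - exp (- l)) powr a)"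
    unfolding laplace_law_def
  proof (intro conjI allI impI)
    show "real_distribution L"
      unfolding L_def by (rule prob_space.real_distribution_distr[OF prob_space_measure_pmf]) simp
    show "AE x in L. 0 \<le> x" unfolding L_def by (subst AE_distr_iff) auto
    fix l :: real assume l: "0 < l"
    have pw: "exp (- (l * real k)) = exp (- l) ^ k" for k
      by (simp add: exp_of_nat_mult[symmetric] mult.commute)
    have gfl: "(\<lambda>k. c k * exp (- l) ^ k) sums (1 - (1 - exp (- l)) powr a)"
      using l by (intro gf) auto
    have nn: "0 \<le> 1 - (1 - exp (- l)) powr a"
      by (rule sums_le[OF _ sums_zero gfl]) (simp add: c_nonneg)
    have "(\<integral>x. exp (- (l * x)) \<partial>L) = (\<integral>k. exp (- l) ^ k \<partial>measure_pmf P)"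
      unfolding L_def by (subst integral_distr) (auto simp: pw)
    also have "\<dots> = enn2real (\<integral>\<^sup>+k. exp (- l) ^ k \<partial>measure_pmf P)"
      by (rule integral_eq_nn_integral) auto
    also have "(\<integral>\<^sup>+k. exp (- l) ^ k \<partial>measure_pmf P) = (\<Sum>k. ennreal (c k * exp (- l) ^ k))"
      by (simp add: nn_integral_measure_pmf pmfP nn_integral_count_space_nat ennreal_mult c_nonneg)
    also have "\<dots> = ennreal (1 - (1 - exp (- l)) powr a)"
      using gfl c_nonneg by (subst suminf_ennreal_eq) auto
    finally show "(\<integral>x. exp (- (l * x)) \<partial>L) = 1 - (1 - exp (- l)) powr a"
      using nn by simp
  qed
  then show ?thesis ..
qed

text \<open>
The sum of \<open>n\<close> independent Sibuya variables, divided by \<open>n\<close> to the power \<open>1/a\<close>, has the Laplace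
transform \<open>(1 - w)\<^sup>n\<close> with \<open>n * w\<close> tending to \<open>l\<^sup>a\<close>. The limit law has no atom at \<open>0\<close> because its
transform vanishes at infinity. For \<open>a = 1\<close> the law is the point mass at \<open>1\<close>.
\<close>

lemma stable_law_exists:
  assumes a: "0 < a" "a \<le> 1"
  shows "\<exists>L. laplace_law L (\<lambda>l. exp (- (l powr a))) \<and> (AE x in L. 0 < x)"
proof -
  have "\<exists>L. laplace_law L (\<lambda>l. exp (- (l powr a)))"
  proof (cases "a = 1")
    case True
    have "laplace_law (return borel 1) (\<lambda>l. exp (- (l powr a)))"
      unfolding laplace_law_def real_distribution_def real_distribution_axioms_def True
      by (auto simp: prob_space_return AE_return integral_return)
    then show ?thesis ..
  next
    case False
    with a have a1: "a < 1" by simp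
    \<comment> \<open>\<open>n\<close> is shifted by one so that the scaling factor is positive\<close>
    define h where "h n l = (real (Suc n)) powr (- 1 / a) * l" for n l
    define f where "f n l = (1 - (1 - exp (- h n l)) powr a) ^ Suc n" for n l
    obtain S where S: "laplace_law S (\<lambda>l. 1 - (1 - exp (- l)) powr a)"
      using sibuya_law_exists a a1 by blast
    have "\<exists>L. laplace_law L (f n)" for n
    proof -
      obtain L where "laplace_law L (\<lambda>l. (1 - (1 - exp (- l)) powr a) ^ Suc n)"
        using laplace_law_power[OF S] by blast
      from laplace_law_scale[OF this, of "real (Suc n) powr (- 1 / a)"]
      show ?thesis unfolding f_def h_def by auto
    qed
    then obtain M where M: "\<And>n. laplace_law (M n) (f n)" by metis
    show ?thesis
    proof (rule laplace_law_limit[OF M])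
      fix n and l :: real assume l: "0 < l"
      have hp: "0 < h n l" using l by (simp add: h_def)
      have "(1 - exp (- h n l)) powr a \<le> h n l powr a"
        using hp a exp_ge_add_one_self[of "- h n l"] by (intro powr_mono2) auto
      also have "h n l powr a = l powr a / real (Suc n)"
        using a l by (simp add: h_def powr_mult powr_powr powr_divide powr_minus_divide del: of_nat_Suc)
      finally have w: "real (Suc n) * (1 - exp (- h n l)) powr a \<le> l powr a"
        by (simp add: field_simps)
      have "(1 - exp (- h n l)) powr a \<le> 1"
        using hp a by (intro powr_le1) auto
      \<comment> \<open>Bernoulli's inequality gives the lower bound that is uniform in \<open>n\<close>\<close>
      then have "1 + real (Suc n) * (- ((1 - exp (- h n l)) powr a)) \<le> f n l"
        unfolding f_def using Bernoulli_inequality[of "- ((1 - exp (- h n l)) powr a)" "Suc n"]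
        by simp
      with w show "1 - l powr a \<le> f n l" by linarith
    next
      fix l :: real assume l: "0 < l"
      show "(\<lambda>n. f n l) \<longlonglongrightarrow> exp (- (l powr a))"
        unfolding f_def h_def using l a a1 by real_asymp
    qed (rule a)
  qed
  then obtain L where L: "laplace_law L (\<lambda>l. exp (- (l powr a)))" ..
  interpret L: real_distribution L using L by (rule laplace_lawD)
  have "measure L {0} \<le> exp (- (l powr a))" if l: "0 < l" for l
  proof -
    have "measure L {0} = (\<integral>x. indicator {0} x \<partial>L)" by simp
    also have "\<dots> \<le> (\<integral>x. exp (- (l * x)) \<partial>L)"
      by (intro integral_mono laplace_law_integrable[OF L l] integrable_real_indicator)
         (auto simp: L.emeasure_eq_measure split: split_indicator)
    finally show ?thesis using laplace_lawD(3)[OF L l] by simp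
  qed
  then have "eventually (\<lambda>l. measure L {0} \<le> exp (- (l powr a))) at_top"
    by (intro eventually_mono[OF eventually_gt_at_top[of "0 :: real"]])
  moreover have "((\<lambda>l :: real. exp (- (l powr a))) \<longlongrightarrow> 0) at_top" using a by real_asymp
  ultimately have "measure L {0} \<le> 0"
    by (intro tendsto_lowerbound[of "\<lambda>l. exp (- (l powr a))"]) auto
  then have "emeasure L {0} = 0" by (simp add: L.emeasure_eq_measure measure_le_0_iff)
  then have "AE x in L. x \<noteq> 0" by (intro AE_I[of _ _ "{0}"]) auto
  with laplace_lawD(2)[OF L] have "AE x in L. 0 < x" by eventually_elim auto
  with L show ?thesis by blast
qed

section \<open>Mittag-Leffler functions as Laplace transforms\<close>

lemma nn_integral_powr_from_0:
  fixes c d :: real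
  assumes "0 \<le> c" "0 < d"
  shows "(\<integral>\<^sup>+x. ennreal (indicator {0<..<c} x * x powr (d - 1)) \<partial>lborel) = ennreal (c powr d / d)"
proof (rule nn_integral_has_integral_lborel)
  have "((\<lambda>x. x powr (d - 1)) has_integral (c powr d / d)) {0..c}"
    using has_integral_powr_from_0[of "d - 1" c] assms by simp
  then have "((\<lambda>x. if x \<in> {0..c} then x powr (d - 1) else 0) has_integral (c powr d / d)) UNIV"
    by (subst has_integral_restrict_UNIV)
  then show "((\<lambda>x. indicator {0<..<c} x * x powr (d - 1)) has_integral (c powr d / d)) UNIV"
    by (rule has_integral_spike_finite[of "{0, c}", rotated 2]) auto
qed auto

lemma nn_integral_exp_tail:
  fixes w :: real
  shows "(\<integral>\<^sup>+v. ennreal (indicator {w..} v * exp (- v)) \<partial>lborel) = ennreal (exp (- w))"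
proof (rule nn_integral_has_integral_lborel)
  have "((\<lambda>x. exp (- 1 * x)) has_integral exp (- 1 * w) / 1) {w..}"
    by (rule has_integral_exp_minus_to_infinity) simp
  then have "((\<lambda>x. exp (- x)) has_integral exp (- w)) {w..}" by simp
  then have "((\<lambda>x. if x \<in> {w..} then exp (- x) else 0) has_integral exp (- w)) UNIV"
    by (subst has_integral_restrict_UNIV)
  then show "((\<lambda>x. indicator {w..} x * exp (- x)) has_integral exp (- w)) UNIV"
    by (rule has_integral_spike_finite[of "{}", rotated 2]) auto
qed auto

lemma nn_integral_powr_exp:
  assumes "0 < x" "0 < d"
  shows "(\<integral>\<^sup>+l. ennreal (indicator {0<..} l * l powr (d - 1) * exp (- (l * x))) \<partial>lborel) =
    ennreal (Gamma d * x powr (- d))"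
proof -
  have "ennreal (Gamma d) = (\<integral>\<^sup>+t. ennreal (indicator {0..} t * t powr (d - 1) / exp t) \<partial>lborel)"
    by (rule Gamma_conv_nn_integral_real) fact
  also have "\<dots> = ennreal \<bar>x\<bar> * (\<integral>\<^sup>+l. ennreal (indicator {0..} (0 + x * l) * (0 + x * l) powr (d - 1) / exp (0 + x * l)) \<partial>lborel)"
    using assms by (intro nn_integral_real_affine) auto
  also have "(\<integral>\<^sup>+l. ennreal (indicator {0..} (0 + x * l) * (0 + x * l) powr (d - 1) / exp (0 + x * l)) \<partial>lborel)
     = (\<integral>\<^sup>+l. ennreal (x powr (d - 1)) * ennreal (indicator {0<..} l * l powr (d - 1) * exp (- (l * x))) \<partial>lborel)"
    using assms by (intro nn_integral_cong)
      (auto simp: indicator_def powr_mult exp_minus field_simps zero_le_mult_iff simp flip: ennreal_mult)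
  also have "\<dots> = ennreal (x powr (d - 1)) * (\<integral>\<^sup>+l. ennreal (indicator {0<..} l * l powr (d - 1) * exp (- (l * x))) \<partial>lborel)"
    by (rule nn_integral_cmult) measurable
  finally have *: "ennreal (Gamma d) = ennreal (x powr d) *
      (\<integral>\<^sup>+l. ennreal (indicator {0<..} l * l powr (d - 1) * exp (- (l * x))) \<partial>lborel)" (is "_ = _ * ?I")
    using assms by (simp add: mult.assoc[symmetric] powr_mult_base flip: ennreal_mult)
  have "ennreal (Gamma d * x powr (- d)) = ennreal (x powr (- d)) * ennreal (Gamma d)"
    using assms Gamma_real_pos[of d] by (simp flip: ennreal_mult add: mult.commute)
  also have "\<dots> = ennreal (x powr (- d) * x powr d) * ?I"
    unfolding * by (simp add: mult.assoc ennreal_mult)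
  also have "\<dots> = ?I" using assms by (simp add: powr_add[symmetric])
  finally show ?thesis by simp
qed

text \<open>
Writing the exponential as the integral of \<open>exp (- v)\<close> over \<open>v \<ge> l powr a\<close> and exchanging the
integrals leaves a Gamma integral in \<open>v\<close>; this avoids a change of variables in an improper
integral.
\<close>

lemma nn_integral_powr_exp_powr:
  assumes a: "0 < a" and d: "0 < d"
  shows "(\<integral>\<^sup>+l. ennreal (indicator {0<..} l * l powr (d - 1) * exp (- (l powr a))) \<partial>lborel) =
    ennreal (Gamma (1 + d / a) / d)"
proof -
  let ?f = "\<lambda>l v. ennreal (indicator {0<..} l * l powr (d - 1) * (indicator {l powr a..} v * exp (- v)))"
  have "(\<integral>\<^sup>+l. ennreal (indicator {0<..} l * l powr (d - 1) * exp (- (l powr a))) \<partial>lborel)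
      = (\<integral>\<^sup>+l. \<integral>\<^sup>+v. ?f l v \<partial>lborel \<partial>lborel)"
  proof (rule nn_integral_cong)
    fix l :: real
    have "(\<integral>\<^sup>+v. ?f l v \<partial>lborel) = (\<integral>\<^sup>+v. ennreal (indicator {0<..} l * l powr (d - 1)) * ennreal (indicator {l powr a..} v * exp (- v)) \<partial>lborel)"
      by (intro nn_integral_cong) (auto simp flip: ennreal_mult)
    also have "\<dots> = ennreal (indicator {0<..} l * l powr (d - 1)) * ennreal (exp (- (l powr a)))"
      by (subst nn_integral_cmult) (simp_all add: nn_integral_exp_tail)
    finally show "ennreal (indicator {0<..} l * l powr (d - 1) * exp (- (l powr a))) = (\<integral>\<^sup>+v. ?f l v \<partial>lborel)"
      by (simp add: ennreal_mult)
  qed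
  also have "\<dots> = (\<integral>\<^sup>+v. \<integral>\<^sup>+l. ?f l v \<partial>lborel \<partial>lborel)"
  proof (rule lborel_pair.Fubini')
    have "(\<lambda>(l, v). ?f l v) = (\<lambda>(l, v). ennreal (indicator {0<..} l * l powr (d - 1) * (if l powr a \<le> v then exp (- v) else 0)))"
      by (auto simp: indicator_def)
    also have "\<dots> \<in> borel_measurable (lborel \<Otimes>\<^sub>M lborel)" by measurable
    finally have "(\<lambda>(l, v). ?f l v) \<in> borel_measurable (lborel \<Otimes>\<^sub>M lborel)" .
    from measurable_pair_swap[OF this] show "(\<lambda>(v, l). ?f l v) \<in> borel_measurable (lborel \<Otimes>\<^sub>M lborel)" by (simp add: split_beta comp_def)
  qed
  also have "\<dots> = (\<integral>\<^sup>+v. ennreal (1 / d) * ennreal (indicator {0..} v * v powr ((1 + d / a) - 1) / exp v) \<partial>lborel)"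
  proof (rule nn_integral_cong_AE)
    show "AE v in lborel. (\<integral>\<^sup>+l. ?f l v \<partial>lborel) = ennreal (1 / d) * ennreal (indicator {0..} v * v powr ((1 + d / a) - 1) / exp v)"
    proof (rule AE_I2)
      fix v :: real
      consider "v \<le> 0" | "0 < v" by linarith
      then show "(\<integral>\<^sup>+l. ?f l v \<partial>lborel) = ennreal (1 / d) * ennreal (indicator {0..} v * v powr ((1 + d / a) - 1) / exp v)"
      proof cases
        case 1
        have "\<not> l powr a \<le> v" if "0 < l" for l
          using 1 that by (simp add: not_le less_le_trans le_less_trans)
        then have z: "?f l v = 0" for l by (auto simp: indicator_def)
        have "(\<integral>\<^sup>+l. ?f l v \<partial>lborel) = (\<integral>\<^sup>+l. 0 \<partial>(lborel :: real measure))"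
          by (rule nn_integral_cong) (rule z)
        also have "\<dots> = ennreal (1 / d) * ennreal (indicator {0..} v * v powr ((1 + d / a) - 1) / exp v)"
          using 1 a d by (cases "v = 0") auto
        finally show ?thesis .
      next
        case 2
        have "(\<integral>\<^sup>+l. ?f l v \<partial>lborel) = (\<integral>\<^sup>+l. ennreal (exp (- v)) * ennreal (indicator {0<..<v powr (1 / a)} l * l powr (d - 1)) \<partial>lborel)"
        proof (rule nn_integral_cong_AE)
          show "AE l in lborel. ?f l v = ennreal (exp (- v)) * ennreal (indicator {0<..<v powr (1 / a)} l * l powr (d - 1))"
            using AE_lborel_singleton[of "v powr (1 / a)"]
          proof eventually_elim
            case (elim l)
            have "l powr a \<le> v \<longleftrightarrow> l < v powr (1 / a)" if "0 < l"
            proof -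
              have "l powr a \<le> v \<longleftrightarrow> l powr a \<le> (v powr (1 / a)) powr a"
                using a 2 by (simp add: powr_powr)
              also have "\<dots> \<longleftrightarrow> l \<le> v powr (1 / a)"
                using a that powr_less_mono2[of a "v powr (1 / a)" l] powr_mono2[of a l "v powr (1 / a)"]
                by fastforce
              finally show ?thesis using elim by auto
            qed
            then show ?case by (auto simp: indicator_def mult_ac simp flip: ennreal_mult)
          qed
        qed
        also have "\<dots> = ennreal (exp (- v)) * ennreal ((v powr (1 / a)) powr d / d)"
          using d by (subst nn_integral_cmult) (auto simp: nn_integral_powr_from_0)
        also have "\<dots> = ennreal (1 / d) * ennreal (indicator {0..} v * v powr ((1 + d / a) - 1) / exp v)"
          using 2 d by (auto simp: powr_powr exp_minus field_simps simp flip: ennreal_mult)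
        finally show ?thesis .
      qed
    qed
  qed
  also have "\<dots> = ennreal (1 / d) * ennreal (Gamma (1 + d / a))"
    using a d by (subst nn_integral_cmult) (auto simp: Gamma_conv_nn_integral_real add_pos_pos)
  also have "\<dots> = ennreal (Gamma (1 + d / a) / d)"
    using a d Gamma_real_pos[of "1 + d / a"] by (simp add: add_pos_pos flip: ennreal_mult)
  finally show ?thesis .
qed

text \<open>
The power \<open>x powr (- d)\<close> is a superposition of exponentials (\<open>nn_integral_powr_exp\<close>), so its
expectation is determined by the Laplace transform.
\<close>

lemma stable_law_negative_moment:
  assumes L: "laplace_law L (\<lambda>l. exp (- (l powr a)))" and pos: "AE x in L. 0 < x"
    and a: "0 < a" and d: "0 < d"
  shows "(\<integral>\<^sup>+x. ennreal (x powr (- d)) \<partial>L) = ennreal (Gamma (1 + d / a) / Gamma (1 + d))"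
proof -
  interpret L: real_distribution L using L by (rule laplace_lawD)
  interpret P: pair_sigma_finite lborel L ..
  let ?g = "\<lambda>l x. ennreal (indicator {0<..} l * l powr (d - 1) * exp (- (l * x)))"
  have "ennreal (Gamma d) * (\<integral>\<^sup>+x. ennreal (x powr (- d)) \<partial>L) = (\<integral>\<^sup>+x. ennreal (Gamma d) * ennreal (x powr (- d)) \<partial>L)"
    by (rule nn_integral_cmult[symmetric]) simp
  also have "\<dots> = (\<integral>\<^sup>+x. \<integral>\<^sup>+l. ?g l x \<partial>lborel \<partial>L)"
  proof (rule nn_integral_cong_AE)
    show "AE x in L. ennreal (Gamma d) * ennreal (x powr (- d)) = (\<integral>\<^sup>+l. ?g l x \<partial>lborel)"
      using pos
    proof eventually_elim
      case (elim x)
      show ?case using nn_integral_powr_exp[OF elim d] Gamma_real_pos[of d] d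
        by (simp add: ennreal_mult)
    qed
  qed
  also have "\<dots> = (\<integral>\<^sup>+l. \<integral>\<^sup>+x. ?g l x \<partial>L \<partial>lborel)"
    by (rule P.Fubini') measurable
  also have "\<dots> = (\<integral>\<^sup>+l. ennreal (indicator {0<..} l * l powr (d - 1) * exp (- (l powr a))) \<partial>lborel)"
  proof (rule nn_integral_cong)
    fix l :: real
    show "(\<integral>\<^sup>+x. ?g l x \<partial>L) = ennreal (indicator {0<..} l * l powr (d - 1) * exp (- (l powr a)))"
    proof (cases "0 < l")
      case True
      have "(\<integral>\<^sup>+x. ?g l x \<partial>L) = (\<integral>\<^sup>+x. ennreal (l powr (d - 1)) * ennreal (exp (- (l * x))) \<partial>L)"
        using True by (intro nn_integral_cong) (auto simp flip: ennreal_mult)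
      also have "\<dots> = ennreal (l powr (d - 1)) * ennreal (\<integral>x. exp (- (l * x)) \<partial>L)"
        using laplace_law_integrable[OF L True]
        by (subst nn_integral_cmult) (auto simp: nn_integral_eq_integral)
      finally show ?thesis using True laplace_lawD(3)[OF L True] by (simp flip: ennreal_mult)
    qed auto
  qed
  also have "\<dots> = ennreal (Gamma (1 + d / a) / d)"
    by (rule nn_integral_powr_exp_powr) fact+
  finally have *: "ennreal (Gamma d) * (\<integral>\<^sup>+x. ennreal (x powr (- d)) \<partial>L) = ennreal (Gamma (1 + d / a) / d)" .
  have G: "0 < Gamma d" using d by (rule Gamma_real_pos)
  have "(\<integral>\<^sup>+x. ennreal (x powr (- d)) \<partial>L) = ennreal (1 / Gamma d) * (ennreal (Gamma d) * (\<integral>\<^sup>+x. ennreal (x powr (- d)) \<partial>L))"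
    using G by (simp add: mult.assoc[symmetric] flip: ennreal_mult)
  also have "\<dots> = ennreal (Gamma (1 + d / a) / (d * Gamma d))"
    unfolding * using G a d Gamma_real_pos[of "1 + d / a"] by (simp add: add_pos_pos flip: ennreal_mult)
  also have "d * Gamma d = Gamma (1 + d)" using Gamma_plus1[of d] d
    by (metis add.commute less_irrefl nonpos_Ints_nonpos not_le)
  finally show ?thesis .
qed

lemma stable_law_negative_moment_integral:
  assumes L: "laplace_law L (\<lambda>l. exp (- (l powr a)))" and pos: "AE x in L. 0 < x"
    and a: "0 < a" and d: "0 \<le> d"
  shows "integrable L (\<lambda>x. x powr (- d))"
    and "(\<integral>x. x powr (- d) \<partial>L) = Gamma (1 + d / a) / Gamma (1 + d)"
proof -
  interpret L: real_distribution L using L by (rule laplace_lawD)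
  have G: "0 \<le> Gamma (1 + d / a) / Gamma (1 + d)"
    using a d by (intro divide_nonneg_nonneg less_imp_le[OF Gamma_real_pos]) (auto intro: add_pos_nonneg)
  have nn: "(\<integral>\<^sup>+x. ennreal (x powr (- d)) \<partial>L) = ennreal (Gamma (1 + d / a) / Gamma (1 + d))"
  proof (cases "d = 0")
    case True
    have "(\<integral>\<^sup>+x. ennreal (x powr (- d)) \<partial>L) = (\<integral>\<^sup>+x. 1 \<partial>L)"
      using pos True by (intro nn_integral_cong_AE) (auto elim!: eventually_mono)
    then show ?thesis using True L.emeasure_space_1 by simp
  next
    case False
    then show ?thesis using stable_law_negative_moment[OF L pos a] d by simp
  qed
  show "integrable L (\<lambda>x. x powr (- d))"
    using nn by (intro integrableI_nonneg) auto
  show "(\<integral>x. x powr (- d) \<partial>L) = Gamma (1 + d / a) / Gamma (1 + d)"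
    using nn G by (simp add: integral_eq_nn_integral)
qed

text \<open>
For every \<open>m \<ge> 1\<close>, the part of the Gamma integral over \<open>[m, m + 1]\<close> shows that \<open>Gamma z\<close> grows at
least like \<open>m powr z\<close>. With \<open>m powr a \<ge> 2 \<bar>x\<bar>\<close> the series is dominated by a geometric one.
\<close>

lemma summable_mittag_leffler:
  fixes x a g :: real
  assumes a: "0 < a" and g: "0 < g"
  shows "summable (\<lambda>k. \<bar>x\<bar> ^ k / Gamma (a * real k + g))"
proof -
  obtain m :: real where m: "1 \<le> m" "2 * \<bar>x\<bar> \<le> m powr a"
  proof
    let ?m = "(1 + 2 * \<bar>x\<bar>) powr (1 / a)"
    show "1 \<le> ?m" using a by (intro ge_one_powr_ge_zero) auto
    show "2 * \<bar>x\<bar> \<le> ?m powr a" using a by (simp add: powr_powr)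
  qed
  have low: "m powr (z - 1) * exp (- (m + 1)) \<le> Gamma z" if z: "1 \<le> z" for z
  proof -
    have "ennreal (m powr (z - 1) * exp (- (m + 1)))
        = (\<integral>\<^sup>+t. ennreal (m powr (z - 1) * exp (- (m + 1))) * indicator {m..m+1} t \<partial>lborel)"
      by (subst nn_integral_cmult_indicator) auto
    also have "\<dots> \<le> (\<integral>\<^sup>+t. ennreal (indicator {0..} t * t powr (z - 1) / exp t) \<partial>lborel)"
    proof (rule nn_integral_mono)
      fix t :: real
      have "m powr (z - 1) * exp (- (m + 1)) \<le> t powr (z - 1) * exp (- t)" if "t \<in> {m..m+1}"
        using that m z by (intro mult_mono powr_mono2) auto
      then show "ennreal (m powr (z - 1) * exp (- (m + 1))) * indicator {m..m+1} t
          \<le> ennreal (indicator {0..} t * t powr (z - 1) / exp t)"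
        using m by (auto simp: indicator_def exp_minus field_simps intro!: ennreal_leI)
    qed
    also have "\<dots> = ennreal (Gamma z)" using z by (subst Gamma_conv_nn_integral_real) auto
    finally show ?thesis using Gamma_real_pos[of z] z by (subst (asm) ennreal_le_iff) auto
  qed
  define C where "C = m powr (1 - g) * exp (m + 1)"
  show ?thesis
  proof (rule summable_comparison_test_ev)
    show "summable (\<lambda>k. C * (1 / 2) ^ k)"
      by (intro summable_mult summable_geometric) auto
    have "filterlim (\<lambda>k. a * real k + g) at_top sequentially" using a by real_asymp
    then have "eventually (\<lambda>k. 1 \<le> a * real k + g) sequentially"
      by (rule filterlim_at_top_dense[THEN iffD1, rule_format, THEN eventually_mono, of _ _ 1]) simp
    then show "eventually (\<lambda>k. norm (\<bar>x\<bar> ^ k / Gamma (a * real k + g)) \<le> C * (1 / 2) ^ k) sequentially"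
    proof eventually_elim
      case (elim k)
      have mp: "0 < m" using m by simp
      let ?D = "m powr (a * real k + g - 1) * exp (- (m + 1))"
      have D: "0 < ?D" using mp by simp
      have "\<bar>x\<bar> ^ k / Gamma (a * real k + g) \<le> \<bar>x\<bar> ^ k / ?D"
        using low[OF elim] D by (intro divide_left_mono) (auto intro!: mult_pos_pos Gamma_real_pos elim)
      also have "\<dots> = C * (\<bar>x\<bar> / m powr a) ^ k"
      proof -
        have "m powr (a * real k + g - 1) = (m powr a) ^ k / m powr (1 - g)"
          using mp by (simp add: powr_diff[symmetric] powr_powr flip: powr_realpow) (simp add: algebra_simps)
        moreover have "exp (- (m + 1)) = 1 / exp (m + 1)" by (simp only: exp_minus inverse_eq_divide)
        ultimately show ?thesis unfolding C_def using mp by (simp add: power_divide del: powr_power)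
      qed
      also have "\<dots> \<le> C * (1 / 2) ^ k"
        using m mp by (intro mult_left_mono power_mono) (auto simp: C_def field_simps)
      finally show ?case using elim Gamma_real_pos[of "a * real k + g"] by simp
    qed
  qed
qed

text \<open>
The exponential series may be integrated termwise because the series of absolute moments is again
a Mittag-Leffler series, at \<open>\<bar>x\<bar>\<close>.
\<close>

lemma expectation_exp_series:
  fixes L :: "real measure" and w u :: "real \<Rightarrow> real"
  assumes [measurable]: "w \<in> borel_measurable L" "u \<in> borel_measurable L"
    and nn: "\<And>s. 0 \<le> w s" "\<And>s. 0 \<le> u s"
    and int: "\<And>k. integrable L (\<lambda>s. w s * u s ^ k)"
    and mom: "\<And>k. (\<integral>s. w s * u s ^ k \<partial>L) = fact k / Gamma (a * real k + g)"
    and a: "0 < a" and g: "0 < g"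
  shows "(\<integral>s. w s * exp (- (x * u s)) \<partial>L) = mittag_leffler a g (- x)"
proof -
  define f where "f k s = (- x) ^ k / fact k * (w s * u s ^ k)" for k s
  have fnorm: "norm (f k s) = \<bar>x\<bar> ^ k / fact k * (w s * u s ^ k)" for k s
    using nn by (simp add: f_def abs_mult power_abs)
  have su: "(\<lambda>k. f k s) sums (w s * exp (- (x * u s)))" for s
  proof -
    have "(\<lambda>k. w s * ((- (x * u s)) ^ k /\<^sub>R fact k)) sums (w s * exp (- (x * u s)))"
      by (intro sums_mult exp_converges)
    moreover have "w s * ((- (x * u s)) ^ k /\<^sub>R fact k) = f k s" for k
    proof -
      have "(- (x * u s)) ^ k = (- x) ^ k * u s ^ k" by (simp flip: power_mult_distrib)
      then show ?thesis by (simp add: f_def field_simps)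
    qed
    ultimately show ?thesis by simp
  qed
  have "(\<lambda>k. integral\<^sup>L L (f k)) sums (\<integral>s. (\<Sum>k. f k s) \<partial>L)"
  proof (rule sums_integral)
    show "integrable L (f k)" for k unfolding f_def by (intro integrable_mult_right int)
    show "AE s in L. summable (\<lambda>k. norm (f k s))"
    proof (rule AE_I2)
      fix s
      have "summable (\<lambda>k. w s * (norm ((x * u s) ^ k /\<^sub>R fact k)))"
        by (intro summable_mult summable_norm_exp)
      moreover have "w s * (norm ((x * u s) ^ k /\<^sub>R fact k)) = norm (f k s)" for k
        using nn unfolding fnorm by (simp add: power_mult_distrib abs_mult power_abs field_simps)
      ultimately show "summable (\<lambda>k. norm (f k s))" by (simp only:)
    qed
    have "(\<integral>s. norm (f k s) \<partial>L) = \<bar>x\<bar> ^ k / Gamma (a * real k + g)" for k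
      unfolding fnorm using mom[of k] by simp
    then show "summable (\<lambda>k. \<integral>s. norm (f k s) \<partial>L)"
      using summable_mittag_leffler[OF a g] by simp
  qed
  moreover have "integral\<^sup>L L (f k) = (- x) ^ k / Gamma (a * real k + g)" for k
    unfolding f_def using mom[of k] by simp
  moreover have "(\<Sum>k. f k s) = w s * exp (- (x * u s))" for s
    using su by (rule sums_unique[symmetric])
  ultimately show ?thesis
    unfolding mittag_leffler_def by (simp add: sums_iff)
qed

lemma mittag_leffler_1_stable:
  assumes L: "laplace_law L (\<lambda>l. exp (- (l powr a)))" and pos: "AE x in L. 0 < x" and a: "0 < a"
  shows "(\<integral>s. exp (- (x * s powr (- a))) \<partial>L) = mittag_leffler a 1 (- x)"
proof -
  interpret L: real_distribution L using L by (rule laplace_lawD)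
  have pw: "AE s in L. (s powr (- a)) ^ k = s powr (- (a * real k))" for k
    using pos by eventually_elim (simp add: powr_powr flip: powr_realpow)
  have "(\<integral>s. 1 * exp (- (x * s powr (- a))) \<partial>L) = mittag_leffler a 1 (- x)"
  proof (rule expectation_exp_series)
    fix k :: nat
    note m = stable_law_negative_moment_integral[OF L pos a, of "a * real k"]
    have "integrable L (\<lambda>s. (s powr (- a)) ^ k) \<longleftrightarrow> integrable L (\<lambda>s. s powr (- (a * real k)))"
      by (intro integrable_cong_AE pw) auto
    then show "integrable L (\<lambda>s. 1 * (s powr (- a)) ^ k)" using m a by simp
    have "(\<integral>s. (s powr (- a)) ^ k \<partial>L) = (\<integral>s. s powr (- (a * real k)) \<partial>L)"
      by (intro integral_cong_AE pw) auto
    then show "(\<integral>s. 1 * (s powr (- a)) ^ k \<partial>L) = fact k / Gamma (a * real k + 1)"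
      using m(2) a Gamma_fact[of k, where ?'a = real] by (simp add: add.commute)
  qed (use a in auto)
  then show ?thesis by simp
qed

text \<open>
The weight shifts the order of the moments by one, and
\<open>a * Gamma (k + 2) / Gamma (1 + a * (k + 1)) = k! / Gamma (a * k + a)\<close>.
\<close>

lemma mittag_leffler_same_stable:
  assumes L: "laplace_law L (\<lambda>l. exp (- (l powr a)))" and pos: "AE x in L. 0 < x" and a: "0 < a"
  shows "(\<integral>s. a * s powr (- a) * exp (- (x * s powr (- a))) \<partial>L) = mittag_leffler a a (- x)"
proof -
  interpret L: real_distribution L using L by (rule laplace_lawD)
  have pw: "AE s in L. a * s powr (- a) * (s powr (- a)) ^ k = a * s powr (- (a * (1 + real k)))" for k
    using pos
    by eventually_elim (simp add: powr_powr distrib_left flip: powr_realpow powr_add)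
  show ?thesis
  proof (rule expectation_exp_series)
    fix k :: nat
    note m = stable_law_negative_moment_integral[OF L pos a, of "a * (1 + real k)"]
    have "integrable L (\<lambda>s. a * s powr (- a) * (s powr (- a)) ^ k) \<longleftrightarrow>
        integrable L (\<lambda>s. a * s powr (- (a * (1 + real k))))"
      by (intro integrable_cong_AE pw) auto
    then show "integrable L (\<lambda>s. a * s powr (- a) * (s powr (- a)) ^ k)" using m a by simp
    have "(\<integral>s. a * s powr (- a) * (s powr (- a)) ^ k \<partial>L) = (\<integral>s. a * s powr (- (a * (1 + real k))) \<partial>L)"
      by (intro integral_cong_AE pw) auto
    also have "\<dots> = a * (fact (Suc k) / Gamma (1 + a * (1 + real k)))"
      using m(2) a Gamma_fact[of "Suc k", where ?'a = real] by (simp add: add.commute)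
    also have "\<dots> = fact k / Gamma (a * real k + a)"
    proof -
      have p: "0 < a * real k + a" using a by (simp add: add_nonneg_pos)
      have "Gamma (1 + a * (1 + real k)) = a * (1 + real k) * Gamma (a * real k + a)"
        using Gamma_plus1[of "a * real k + a"] p
        by (simp add: algebra_simps) (metis less_irrefl nonpos_Ints_nonpos not_le p)
      then have "a * (fact (Suc k) / Gamma (1 + a * (1 + real k))) =
          (a * (1 + real k)) * fact k / ((a * (1 + real k)) * Gamma (a * real k + a))"
        by (simp add: mult_ac)
      moreover have "a * (1 + real k) \<noteq> 0" using a by (simp add: add_nonneg_eq_0_iff)
      ultimately show ?thesis using mult_divide_mult_cancel_left[of "a * (1 + real k)" "fact k" "Gamma (a * real k + a)"]
        by metis
    qed
    finally show "(\<integral>s. a * s powr (- a) * (s powr (- a)) ^ k \<partial>L) = fact k / Gamma (a * real k + a)" .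
  qed (use a in auto)
qed

text \<open>
Bochner's subordination. If \<open>V\<close> is \<open>\<beta>\<close>-stable and independent of \<open>S\<close>, then conditionally on \<open>S\<close>
the variable \<open>\<theta> = S powr (- \<alpha> / \<beta>) * V\<close> has the Laplace transform
\<open>exp (- (y powr \<beta> * S powr (- \<alpha>)))\<close>; the measure \<open>\<nu>\<close> is the law of \<open>\<theta>\<close> under the weight \<open>w S\<close>.
Its moment of order \<open>- \<gamma>\<close> splits into a product since all negative moments of \<open>V\<close> are finite.
\<close>

lemma subordination_measure:
  fixes \<alpha> \<beta> \<gamma> :: real and w h :: "real \<Rightarrow> real"
  assumes b: "0 < \<beta>" "\<beta> \<le> 1" and g: "0 \<le> \<gamma>"
    and S: "real_distribution S" "AE s in S. 0 < s"
    and w[measurable]: "w \<in> borel_measurable borel" and w0: "\<And>s. 0 \<le> w s"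
    and wint: "integrable S w"
    and h: "\<And>x. 0 \<le> x \<Longrightarrow> (\<integral>s. w s * exp (- (x * s powr (- \<alpha>))) \<partial>S) = h x"
    and mom: "(\<integral>\<^sup>+s. ennreal (w s * s powr (\<alpha> * \<gamma> / \<beta>)) \<partial>S) < \<infinity>"
  shows "\<exists>\<nu>. finite_measure \<nu> \<and> sets \<nu> = sets borel \<and> (AE \<theta> in \<nu>. 0 < \<theta>) \<and>
    (\<forall>y\<ge>0. (\<integral>\<theta>. exp (- (y * \<theta>)) \<partial>\<nu>) = h (y powr \<beta>)) \<and>
    (\<integral>\<^sup>+\<theta>. ennreal (\<theta> powr (- \<gamma>)) \<partial>\<nu>) < \<infinity>"
proof -
  obtain V where V: "laplace_law V (\<lambda>l. exp (- (l powr \<beta>)))" and Vpos: "AE x in V. 0 < x"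
    using stable_law_exists[OF b] by blast
  interpret S: real_distribution S by (rule S)
  interpret V: real_distribution V using V by (rule laplace_lawD)
  interpret P: pair_prob_space S V ..
  define t where "t z = fst z powr (- (\<alpha> / \<beta>)) * snd z" for z :: "real \<times> real"
  have t[measurable]: "t \<in> borel_measurable (S \<Otimes>\<^sub>M V)" unfolding t_def by measurable
  define D where "D = density (S \<Otimes>\<^sub>M V) (\<lambda>z. ennreal (w (fst z)))"
  have tD[measurable]: "t \<in> borel_measurable D" unfolding D_def by simp
  define \<nu> where "\<nu> = distr D borel t"
  have nn: "(\<integral>\<^sup>+\<theta>. f \<theta> \<partial>\<nu>) = (\<integral>\<^sup>+s. ennreal (w s) * (\<integral>\<^sup>+v. f (t (s, v)) \<partial>V) \<partial>S)"
    if f[measurable]: "f \<in> borel_measurable borel" for f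
  proof -
    have "(\<integral>\<^sup>+\<theta>. f \<theta> \<partial>\<nu>) = (\<integral>\<^sup>+z. ennreal (w (fst z)) * f (t z) \<partial>(S \<Otimes>\<^sub>M V))"
      unfolding \<nu>_def D_def by (subst nn_integral_distr) (auto simp: nn_integral_density)
    also have "\<dots> = (\<integral>\<^sup>+s. \<integral>\<^sup>+v. ennreal (w s) * f (t (s, v)) \<partial>V \<partial>S)"
      by (subst V.nn_integral_fst[symmetric]) auto
    also have "\<dots> = (\<integral>\<^sup>+s. ennreal (w s) * (\<integral>\<^sup>+v. f (t (s, v)) \<partial>V) \<partial>S)"
      by (intro nn_integral_cong nn_integral_cmult) measurable
    finally show ?thesis .
  qed
  have "finite_measure \<nu>"
  proof
    have "emeasure \<nu> (space \<nu>) = (\<integral>\<^sup>+\<theta>. 1 \<partial>\<nu>)" by simp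
    also have "\<dots> = (\<integral>\<^sup>+s. ennreal (w s) \<partial>S)"
      by (subst nn) (auto simp: V.emeasure_space_1[simplified])
    also have "\<dots> < \<infinity>" using wint w0 by (simp add: nn_integral_eq_integral)
    finally show "emeasure \<nu> (space \<nu>) \<noteq> \<infinity>" by simp
  qed
  moreover have "AE \<theta> in \<nu>. 0 < \<theta>"
  proof -
    have "AE z in S \<Otimes>\<^sub>M V. 0 < t z"
    proof (rule P.AE_pair_measure)
      show "{z \<in> space (S \<Otimes>\<^sub>M V). 0 < t z} \<in> sets (S \<Otimes>\<^sub>M V)" by measurable
      show "AE s in S. AE v in V. 0 < t (s, v)"
        using S(2)
      proof eventually_elim
        case (elim s)
        show ?case using Vpos by eventually_elim (use elim in \<open>simp add: t_def\<close>)
      qed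
    qed
    then have "AE z in D. 0 < t z" unfolding D_def by (subst AE_density) (auto elim: eventually_mono)
    then show ?thesis unfolding \<nu>_def by (subst AE_distr_iff) auto
  qed
  moreover have "(\<integral>\<theta>. exp (- (y * \<theta>)) \<partial>\<nu>) = h (y powr \<beta>)" if y: "0 \<le> y" for y
  proof -
    have inner: "(\<integral>\<^sup>+v. ennreal (exp (- (y * t (s, v)))) \<partial>V) = ennreal (exp (- (y powr \<beta> * s powr (- \<alpha>))))"
      if s: "0 < s" for s
    proof (cases "y = 0")
      case True
      then show ?thesis using V.emeasure_space_1 by simp
    next
      case False
      define l where "l = y * s powr (- (\<alpha> / \<beta>))"
      have l: "0 < l" using False y s by (simp add: l_def)
      have "(\<integral>\<^sup>+v. ennreal (exp (- (y * t (s, v)))) \<partial>V) = ennreal (\<integral>v. exp (- (l * v)) \<partial>V)"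
        using laplace_law_integrable[OF V l]
        by (subst nn_integral_eq_integral[symmetric]) (auto simp: t_def l_def mult.assoc)
      also have "(\<integral>v. exp (- (l * v)) \<partial>V) = exp (- (l powr \<beta>))"
        by (rule laplace_lawD(3)[OF V l])
      also have "l powr \<beta> = y powr \<beta> * s powr (- \<alpha>)"
        using y s b by (simp add: l_def powr_mult powr_powr)
      finally show ?thesis .
    qed
    have "(\<integral>\<theta>. exp (- (y * \<theta>)) \<partial>\<nu>) = enn2real (\<integral>\<^sup>+\<theta>. ennreal (exp (- (y * \<theta>))) \<partial>\<nu>)"
      by (rule integral_eq_nn_integral) (auto simp: \<nu>_def)
    also have "(\<integral>\<^sup>+\<theta>. ennreal (exp (- (y * \<theta>))) \<partial>\<nu>) = (\<integral>\<^sup>+s. ennreal (w s * exp (- (y powr \<beta> * s powr (- \<alpha>)))) \<partial>S)"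
    proof (subst nn)
      show "(\<integral>\<^sup>+s. ennreal (w s) * (\<integral>\<^sup>+v. ennreal (exp (- (y * t (s, v)))) \<partial>V) \<partial>S)
         = (\<integral>\<^sup>+s. ennreal (w s * exp (- (y powr \<beta> * s powr (- \<alpha>)))) \<partial>S)"
        using S(2) by (intro nn_integral_cong_AE) (auto elim!: eventually_mono simp: inner ennreal_mult w0)
    qed simp
    also have "enn2real \<dots> = (\<integral>s. w s * exp (- (y powr \<beta> * s powr (- \<alpha>))) \<partial>S)"
      by (rule integral_eq_nn_integral[symmetric]) (auto simp: w0)
    also have "\<dots> = h (y powr \<beta>)" by (rule h) simp
    finally show ?thesis .
  qed
  moreover have "(\<integral>\<^sup>+\<theta>. ennreal (\<theta> powr (- \<gamma>)) \<partial>\<nu>) < \<infinity>"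
  proof -
    define m where "m = (\<integral>v. v powr (- \<gamma>) \<partial>V)"
    have m: "(\<integral>\<^sup>+v. ennreal (v powr (- \<gamma>)) \<partial>V) = ennreal m"
      unfolding m_def using stable_law_negative_moment_integral(1)[OF V Vpos b(1) g]
      by (intro nn_integral_eq_integral) auto
    have inner: "(\<integral>\<^sup>+v. ennreal (t (s, v) powr (- \<gamma>)) \<partial>V) = ennreal (s powr (\<alpha> * \<gamma> / \<beta>)) * ennreal m"
      if s: "0 < s" for s
    proof -
      have "(\<integral>\<^sup>+v. ennreal (t (s, v) powr (- \<gamma>)) \<partial>V) = (\<integral>\<^sup>+v. ennreal (s powr (\<alpha> * \<gamma> / \<beta>)) * ennreal (v powr (- \<gamma>)) \<partial>V)"
        using Vpos s by (intro nn_integral_cong_AE)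
          (auto elim!: eventually_mono simp: t_def powr_mult powr_powr simp flip: ennreal_mult)
      also have "\<dots> = ennreal (s powr (\<alpha> * \<gamma> / \<beta>)) * ennreal m"
        by (subst nn_integral_cmult) (auto simp: m)
      finally show ?thesis .
    qed
    have "(\<integral>\<^sup>+\<theta>. ennreal (\<theta> powr (- \<gamma>)) \<partial>\<nu>) = (\<integral>\<^sup>+s. ennreal (w s * s powr (\<alpha> * \<gamma> / \<beta>)) * ennreal m \<partial>S)"
    proof (subst nn)
      show "(\<integral>\<^sup>+s. ennreal (w s) * (\<integral>\<^sup>+v. ennreal (t (s, v) powr (- \<gamma>)) \<partial>V) \<partial>S) =
          (\<integral>\<^sup>+s. ennreal (w s * s powr (\<alpha> * \<gamma> / \<beta>)) * ennreal m \<partial>S)"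
        using S(2) by (intro nn_integral_cong_AE) (auto elim!: eventually_mono simp: inner ennreal_mult w0 mult.assoc)
    qed simp
    also have "\<dots> = (\<integral>\<^sup>+s. ennreal (w s * s powr (\<alpha> * \<gamma> / \<beta>)) \<partial>S) * ennreal m"
      by (rule nn_integral_multc) measurable
    also have "\<dots> < \<infinity>" using mom by (simp add: ennreal_mult_less_top)
    finally show ?thesis .
  qed
  ultimately show ?thesis by (intro exI[of _ \<nu>]) (auto simp: \<nu>_def)
qed

lemma mixing_measure_Z:
  assumes a: "0 < \<alpha>" "\<alpha> < 1" and b: "0 < \<beta>" "\<beta> \<le> 1"
  shows "\<exists>\<nu>. finite_measure \<nu> \<and> sets \<nu> = sets borel \<and> (AE \<theta> in \<nu>. 0 < \<theta>) \<and>
    (\<forall>y\<ge>0. (\<integral>\<theta>. exp (- (y * \<theta>)) \<partial>\<nu>) = mittag_leffler \<alpha> 1 (- (y powr \<beta>))) \<and>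
    (\<integral>\<^sup>+\<theta>. ennreal (\<theta> powr (- 0)) \<partial>\<nu>) < \<infinity>"
proof -
  obtain S where S: "laplace_law S (\<lambda>l. exp (- (l powr \<alpha>)))" and Spos: "AE x in S. 0 < x"
    using stable_law_exists[of \<alpha>] a by auto
  interpret S: real_distribution S using S by (rule laplace_lawD)
  have "(\<integral>\<^sup>+s. ennreal (1 * s powr (\<alpha> * 0 / \<beta>)) \<partial>S) \<le> (\<integral>\<^sup>+s. 1 \<partial>S)"
    by (intro nn_integral_mono) auto
  also have "\<dots> < \<infinity>" using S.emeasure_space_1 by simp
  finally have mom: "(\<integral>\<^sup>+s. ennreal (1 * s powr (\<alpha> * 0 / \<beta>)) \<partial>S) < \<infinity>" .
  show ?thesis
    by (rule subordination_measure[OF b order_refl laplace_lawD(1)[OF S] Spos,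
          of "\<lambda>_. 1" \<alpha> "\<lambda>x. mittag_leffler \<alpha> 1 (- x)"])
       (use mom mittag_leffler_1_stable[OF S Spos a(1)] in auto)
qed

text \<open>
The weight \<open>\<alpha> S powr (- \<alpha>)\<close> compensates the positive power of \<open>S\<close> in the moment of order \<open>- \<gamma>\<close>:
the total exponent \<open>- \<alpha> (1 - \<gamma> / \<beta>)\<close> is not positive as long as \<open>\<gamma> \<le> \<beta>\<close>.
\<close>

lemma mixing_measure_Y:
  assumes a: "0 < \<alpha>" "\<alpha> < 1" and b: "0 < \<beta>" "\<beta> \<le> 1" and g: "0 \<le> \<gamma>" "\<gamma> < \<beta>"
  shows "\<exists>\<nu>. finite_measure \<nu> \<and> sets \<nu> = sets borel \<and> (AE \<theta> in \<nu>. 0 < \<theta>) \<and>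
    (\<forall>y\<ge>0. (\<integral>\<theta>. exp (- (y * \<theta>)) \<partial>\<nu>) = mittag_leffler \<alpha> \<alpha> (- (y powr \<beta>))) \<and>
    (\<integral>\<^sup>+\<theta>. ennreal (\<theta> powr (- \<gamma>)) \<partial>\<nu>) < \<infinity>"
proof -
  obtain S where S: "laplace_law S (\<lambda>l. exp (- (l powr \<alpha>)))" and Spos: "AE x in S. 0 < x"
    using stable_law_exists[of \<alpha>] a by auto
  interpret S: real_distribution S using S by (rule laplace_lawD)
  have e: "0 \<le> \<alpha> * (1 - \<gamma> / \<beta>)" using a b g by (simp add: field_simps)
  have "(\<integral>\<^sup>+s. ennreal (\<alpha> * s powr (- \<alpha>) * s powr (\<alpha> * \<gamma> / \<beta>)) \<partial>S)
      = (\<integral>\<^sup>+s. ennreal (\<alpha> * s powr (- (\<alpha> * (1 - \<gamma> / \<beta>)))) \<partial>S)"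
    by (intro nn_integral_cong) (simp add: mult.assoc right_diff_distrib flip: powr_add)
  also have "\<dots> = ennreal (\<integral>s. \<alpha> * s powr (- (\<alpha> * (1 - \<gamma> / \<beta>))) \<partial>S)"
    using stable_law_negative_moment_integral(1)[OF S Spos a(1) e] a
    by (intro nn_integral_eq_integral) auto
  also have "\<dots> < \<infinity>" by simp
  finally have mom: "(\<integral>\<^sup>+s. ennreal (\<alpha> * s powr (- \<alpha>) * s powr (\<alpha> * \<gamma> / \<beta>)) \<partial>S) < \<infinity>" .
  show ?thesis
    by (rule subordination_measure[OF b g(1) laplace_lawD(1)[OF S] Spos,
          of "\<lambda>s. \<alpha> * s powr (- \<alpha>)" \<alpha> "\<lambda>x. mittag_leffler \<alpha> \<alpha> (- x)"])
       (use a mom mittag_leffler_same_stable[OF S Spos a(1)]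
          stable_law_negative_moment_integral(1)[OF S Spos a(1), of \<alpha>] in auto)
qed

section \<open>The heat kernel and uniqueness of the Fourier transform\<close>

definition heat_kernel :: "real \<Rightarrow> real^'n \<Rightarrow> real" where
  "heat_kernel \<theta> x = (4 * pi * \<theta>) powr (- (real CARD('n) / 2)) * exp (- (norm x)\<^sup>2 / (4 * \<theta>))"

lemma heat_kernel_nonneg [simp]: "0 \<le> heat_kernel \<theta> x"
  by (simp add: heat_kernel_def)

lemma heat_kernel_measurable [measurable]:
  assumes [measurable]: "f \<in> borel_measurable M" "g \<in> borel_measurable M"
  shows "(\<lambda>z. heat_kernel (f z) (g z)) \<in> borel_measurable M"
  unfolding heat_kernel_def by measurable

lemma heat_kernel_eq_prod:
  fixes x :: "real^'n"
  assumes "0 < \<theta>"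
  shows "heat_kernel \<theta> x = (\<Prod>b\<in>Basis. normal_density 0 (sqrt (2 * \<theta>)) (x \<bullet> b))"
proof -
  have n: "(norm x)\<^sup>2 = (\<Sum>b\<in>Basis. (x \<bullet> b)\<^sup>2)"
    unfolding power2_norm_eq_inner by (subst euclidean_inner) (simp add: power2_eq_square)
  have "(\<Prod>b\<in>Basis. normal_density 0 (sqrt (2 * \<theta>)) (x \<bullet> b))
      = (\<Prod>b\<in>(Basis::(real^'n) set). 1 / sqrt (4 * pi * \<theta>)) * (\<Prod>b\<in>Basis. exp (- (x \<bullet> b)\<^sup>2 / (4 * \<theta>)))"
    unfolding prod.distrib[symmetric] using assms by (intro prod.cong refl) (simp add: normal_density_def mult_ac)
  also have "(\<Prod>b\<in>Basis. exp (- (x \<bullet> b)\<^sup>2 / (4 * \<theta>))) = exp (- (norm x)\<^sup>2 / (4 * \<theta>))"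
    unfolding n by (simp add: exp_sum[symmetric] sum_divide_distrib sum_negf)
  also have "(\<Prod>b\<in>(Basis::(real^'n) set). 1 / sqrt (4 * pi * \<theta>)) = (4 * pi * \<theta>) powr (- (real CARD('n) / 2))"
  proof -
    have "1 / sqrt (4 * pi * \<theta>) = (4 * pi * \<theta>) powr (- (1 / 2))"
      using assms by (simp add: powr_half_sqrt powr_minus_divide)
    then show ?thesis using assms by (simp add: powr_powr mult_ac flip: powr_realpow)
  qed
  finally show ?thesis by (simp add: heat_kernel_def)
qed

lemma nn_integral_heat_kernel:
  assumes "0 < \<theta>"
  shows "(\<integral>\<^sup>+x. ennreal (heat_kernel \<theta> (x :: real^'n)) \<partial>lborel) = 1"
proof -
  have "(\<integral>\<^sup>+x. ennreal (heat_kernel \<theta> (x :: real^'n)) \<partial>lborel)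
      = (\<integral>\<^sup>+x. (\<Prod>b\<in>(Basis::(real^'n) set). ennreal (normal_density 0 (sqrt (2 * \<theta>)) (x \<bullet> b))) \<partial>lborel)"
    using assms by (intro nn_integral_cong) (simp add: heat_kernel_eq_prod prod_ennreal)
  also have "\<dots> = (\<Prod>b\<in>(Basis::(real^'n) set). (\<integral>\<^sup>+x. ennreal (normal_density 0 (sqrt (2 * \<theta>)) x) \<partial>lborel))"
    by (rule nn_integral_lborel_prod) auto
  also have "(\<integral>\<^sup>+x. ennreal (normal_density 0 (sqrt (2 * \<theta>)) x) \<partial>lborel) = 1"
    using assms by (subst nn_integral_eq_integral) auto
  finally show ?thesis by simp
qed

lemma integrable_heat_kernel: "0 < \<theta> \<Longrightarrow> integrable lborel (heat_kernel \<theta> :: real^'n \<Rightarrow> real)"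
  by (intro integrableI_nonneg) (auto simp: nn_integral_heat_kernel)

lemma integral_heat_kernel: "0 < \<theta> \<Longrightarrow> (\<integral>x. heat_kernel \<theta> (x :: real^'n) \<partial>lborel) = 1"
  by (subst integral_eq_nn_integral) (auto simp: nn_integral_heat_kernel)

text \<open>
A power of a Gaussian is a multiple of a Gaussian: the heat kernel at time \<open>\<theta>\<close> to the power \<open>r\<close>
is a multiple of the heat kernel at time \<open>\<theta> / r\<close>. The numerical factor is at most \<open>1\<close>.
\<close>

lemma nn_integral_heat_kernel_powr:
  assumes t: "0 < \<theta>" and r: "1 \<le> r"
  shows "(\<integral>\<^sup>+x. ennreal (heat_kernel \<theta> (x :: real^'n) powr r) \<partial>lborel)
    \<le> ennreal (\<theta> powr (- (real CARD('n) / 2 * (r - 1))))"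
proof -
  let ?N = "real CARD('n) / 2"
  have eq: "heat_kernel \<theta> x powr r = (4 * pi * \<theta>) powr (- (?N * (r - 1))) * r powr (- ?N) * heat_kernel (\<theta> / r) x"
    for x :: "real^'n"
  proof -
    have "heat_kernel \<theta> x powr r = (4 * pi * \<theta>) powr (- (?N * r)) * exp (- (norm x)\<^sup>2 / (4 * \<theta>) * r)"
      using t by (simp add: heat_kernel_def powr_mult powr_powr exp_powr_real)
    also have "exp (- (norm x)\<^sup>2 / (4 * \<theta>) * r) = exp (- (norm x)\<^sup>2 / (4 * (\<theta> / r)))"
      using r t by (simp add: field_simps)
    also have "(4 * pi * \<theta>) powr (- (?N * r)) = (4 * pi * \<theta>) powr (- (?N * (r - 1))) * (4 * pi * \<theta>) powr (- ?N)"
      by (simp add: powr_add[symmetric] field_simps)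
    also have "(4 * pi * \<theta>) powr (- ?N) = r powr (- ?N) * (4 * pi * (\<theta> / r)) powr (- ?N)"
      using r t by (subst powr_mult[symmetric]) auto
    finally show ?thesis by (simp add: heat_kernel_def mult_ac)
  qed
  have "(\<integral>\<^sup>+x. ennreal (heat_kernel \<theta> (x :: real^'n) powr r) \<partial>lborel)
      = (\<integral>\<^sup>+x. ennreal ((4 * pi * \<theta>) powr (- (?N * (r - 1))) * r powr (- ?N)) * ennreal (heat_kernel (\<theta> / r) (x :: real^'n)) \<partial>lborel)"
    unfolding eq by (simp add: ennreal_mult)
  also have "\<dots> = ennreal ((4 * pi * \<theta>) powr (- (?N * (r - 1))) * r powr (- ?N))"
    using t r by (subst nn_integral_cmult) (auto simp: nn_integral_heat_kernel)
  also have "\<dots> \<le> ennreal (\<theta> powr (- (?N * (r - 1))))"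
  proof (rule ennreal_leI)
    have "1 \<le> 4 * pi" using pi_gt3 by simp
    then have "\<theta> \<le> 4 * pi * \<theta>" using t by (simp add: mult_le_cancel_right2)
    then have "(4 * pi * \<theta>) powr (- (?N * (r - 1))) \<le> \<theta> powr (- (?N * (r - 1)))"
      using t r by (intro powr_mono2') auto
    moreover have "r powr (- ?N) \<le> 1"
      using powr_mono2'[of "- ?N" 1 r] r by simp
    ultimately show "(4 * pi * \<theta>) powr (- (?N * (r - 1))) * r powr (- ?N) \<le> \<theta> powr (- (?N * (r - 1)))"
      using mult_mono[of "(4 * pi * \<theta>) powr (- (?N * (r - 1)))" "\<theta> powr (- (?N * (r - 1)))" "r powr (- ?N)" 1] by simp
  qed
  finally show ?thesis .
qed

lemma integral_cis_normal_density:
  fixes k \<theta> :: real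
  assumes "0 < \<theta>"
  shows "(\<integral>x. cis (- (k * x)) * complex_of_real (normal_density 0 (sqrt (2 * \<theta>)) x) \<partial>lborel) = complex_of_real (exp (- (\<theta> * k\<^sup>2)))"
proof -
  define s where "s = sqrt (2 * \<theta>)"
  have s: "0 < s" "s\<^sup>2 = 2 * \<theta>" using assms by (simp_all add: s_def)
  have "(\<integral>x. cis (- (k * x)) * complex_of_real (normal_density 0 s x) \<partial>lborel)
      = \<bar>s\<bar> *\<^sub>R (\<integral>y. cis (- (k * (0 + s * y))) * complex_of_real (normal_density 0 s (0 + s * y)) \<partial>lborel)"
    using s by (intro lborel_integral_real_affine) simp
  also have "\<dots> = (\<integral>y. std_normal_density y *\<^sub>R cis ((- (k * s)) * y) \<partial>lborel)"
  proof -
    have nd: "s * normal_density 0 s (s * y) = std_normal_density y" for y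
      using s(1) by (simp add: normal_density_def power_mult_distrib real_sqrt_mult)
    have "\<bar>s\<bar> *\<^sub>R (cis (- (k * (0 + s * y))) * complex_of_real (normal_density 0 s (0 + s * y)))
        = std_normal_density y *\<^sub>R cis ((- (k * s)) * y)" for y
      unfolding nd[symmetric] using s by (simp add: scaleR_conv_of_real mult_ac)
    then show ?thesis by (simp flip: integral_scaleR_right)
  qed
  also have "\<dots> = char std_normal_distribution (- (k * s))"
    unfolding char_def by (subst integral_density) (auto simp: cis_conv_exp)
  also have "\<dots> = complex_of_real (exp (- (\<theta> * k\<^sup>2)))"
    using s by (simp add: char_std_normal_distribution power_mult_distrib)
  finally show ?thesis by (simp add: s_def)
qed

text \<open>
Lebesgue measure and the heat kernel are products over the coordinates, which reduces the claim to
the characteristic function of the normal distribution on the line.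
\<close>

lemma fourier_heat_kernel:
  fixes \<xi> :: "real^'n"
  assumes t: "0 < \<theta>"
  shows "fourier (heat_kernel \<theta>) \<xi> = complex_of_real (exp (- (\<theta> * (norm \<xi>)\<^sup>2)))"
proof -
  let ?B = "Basis :: (real^'n) set"
  let ?nd = "normal_density 0 (sqrt (2 * \<theta>))"
  interpret product_sigma_finite "\<lambda>_ :: real^'n. lborel :: real measure" ..
  have ip: "(\<Sum>b\<in>?B. f b *\<^sub>R b) \<bullet> c = f c" if "c \<in> ?B" for f c
    using that by (rule inner_sum_left_Basis)
  have prod: "cis (- (\<xi> \<bullet> (\<Sum>b\<in>?B. f b *\<^sub>R b))) * complex_of_real (heat_kernel \<theta> (\<Sum>b\<in>?B. f b *\<^sub>R b))
      = (\<Prod>b\<in>?B. cis (- ((\<xi> \<bullet> b) * f b)) * complex_of_real (?nd (f b)))" for f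
  proof -
    have "cis (- (\<xi> \<bullet> (\<Sum>b\<in>?B. f b *\<^sub>R b))) = (\<Prod>b\<in>?B. cis (- ((\<xi> \<bullet> b) * f b)))"
      by (simp add: inner_sum_right cis_conv_exp exp_sum[symmetric] sum_distrib_left mult_ac sum_negf)
    moreover have "heat_kernel \<theta> (\<Sum>b\<in>?B. f b *\<^sub>R b) = (\<Prod>b\<in>?B. ?nd (f b))"
      using t by (simp add: heat_kernel_eq_prod ip)
    ultimately show ?thesis by (simp add: prod.distrib)
  qed
  have "fourier (heat_kernel \<theta>) \<xi> = (\<integral>f. cis (- (\<xi> \<bullet> (\<Sum>b\<in>?B. f b *\<^sub>R b))) * complex_of_real (heat_kernel \<theta> (\<Sum>b\<in>?B. f b *\<^sub>R b))
       \<partial>(\<Pi>\<^sub>M b\<in>?B. lborel))"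
    unfolding fourier_def
    by (subst lborel_eq, subst integral_distr) (auto simp: cis_conv_exp)
  also have "\<dots> = (\<integral>f. (\<Prod>b\<in>?B. cis (- ((\<xi> \<bullet> b) * f b)) * complex_of_real (?nd (f b))) \<partial>(\<Pi>\<^sub>M b\<in>?B. lborel))"
    unfolding prod ..
  also have "\<dots> = (\<Prod>b\<in>?B. \<integral>x. cis (- ((\<xi> \<bullet> b) * x)) * complex_of_real (?nd x) \<partial>lborel)"
  proof (rule product_integral_prod)
    fix b :: "real^'n" assume "b \<in> ?B"
    have "integrable lborel (\<lambda>x. complex_of_real (?nd x))" using t by simp
    then show "integrable lborel (\<lambda>x. cis (- ((\<xi> \<bullet> b) * x)) * complex_of_real (?nd x))"
      by (rule Bochner_Integration.integrable_bound) (auto simp: norm_mult cis_conv_exp)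
  qed simp
  also have "\<dots> = (\<Prod>b\<in>?B. complex_of_real (exp (- (\<theta> * (\<xi> \<bullet> b)\<^sup>2))))"
    using t by (simp add: integral_cis_normal_density)
  also have "\<dots> = complex_of_real (exp (\<Sum>b\<in>?B. - (\<theta> * (\<xi> \<bullet> b)\<^sup>2)))"
    by (simp add: exp_sum)
  also have "(\<Sum>b\<in>?B. - (\<theta> * (\<xi> \<bullet> b)\<^sup>2)) = - (\<theta> * (norm \<xi>)\<^sup>2)"
    using euclidean_inner[of \<xi> \<xi>]
    by (simp only: power2_norm_eq_inner) (simp add: power2_eq_square sum_distrib_left sum_negf)
  finally show ?thesis .
qed

lemma integral_lborel_affine:
  fixes f :: "real^'n \<Rightarrow> real"
  assumes [measurable]: "f \<in> borel_measurable borel" and c: "c \<noteq> 0"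
  shows "(\<integral>x. f x \<partial>lborel) = (\<integral>x. \<bar>c\<bar> ^ CARD('n) * f (t + c *\<^sub>R x) \<partial>lborel)"
  by (subst lborel_affine[OF c, of t], subst integral_density)
     (auto simp: integral_distr)

lemma integrable_tensor:
  fixes f :: "real^'n \<Rightarrow> real" and g :: "real^'m \<Rightarrow> real"
  assumes f: "integrable lborel f" and g: "integrable lborel g"
  shows "integrable (lborel \<Otimes>\<^sub>M lborel) (\<lambda>(x, y). f x * g y)"
proof (rule lborel_pair.Fubini_integrable)
  have [measurable]: "f \<in> borel_measurable lborel" "g \<in> borel_measurable lborel" using f g by auto
  show "(\<lambda>(x, y). f x * g y) \<in> borel_measurable (lborel \<Otimes>\<^sub>M lborel)" by measurable
  show "integrable lborel (\<lambda>x. \<integral>y. norm (case (x, y) of (x, y) \<Rightarrow> f x * g y) \<partial>lborel)"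
    using f by (simp add: abs_mult)
  show "AE x in lborel. integrable lborel (\<lambda>y. case (x, y) of (x, y) \<Rightarrow> f x * g y)"
    using g by simp
qed

text \<open>
A Gaussian is itself the Fourier transform of a Gaussian, so by Fubini's theorem the convolution of
\<open>f\<close> with a Gaussian is an integral of the Fourier transform of \<open>f\<close>.
\<close>

lemma heat_convolution_eq_0:
  fixes f :: "real^'n \<Rightarrow> real"
  assumes f: "integrable lborel f" and F: "\<And>\<xi>. fourier f \<xi> = 0" and e: "0 < \<epsilon>"
  shows "(\<integral>y. f y * heat_kernel \<epsilon> (x - y) \<partial>lborel) = 0"
proof -
  have [measurable]: "f \<in> borel_measurable borel" using f by auto
  \<comment> \<open>with this \<open>d\<close> the transform of the heat kernel at time \<open>d\<close> is \<open>exp (- (norm z)\<^sup>2 / (4 * \<epsilon>))\<close>\<close>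
  define d where "d = 1 / (4 * \<epsilon>)"
  have d: "0 < d" using e by (simp add: d_def)
  let ?G = "heat_kernel d :: real^'n \<Rightarrow> real"
  have ex: "complex_of_real (exp (- (norm z)\<^sup>2 / (4 * \<epsilon>))) = (\<integral>\<xi>. cis (- (z \<bullet> \<xi>)) * complex_of_real (?G \<xi>) \<partial>lborel)" for z :: "real^'n"
    using fourier_heat_kernel[OF d, of z] unfolding fourier_def by (simp add: d_def)
  have int: "integrable (lborel \<Otimes>\<^sub>M lborel) (\<lambda>(y, \<xi>). complex_of_real (f y) * (cis (- ((x - y) \<bullet> \<xi>)) * complex_of_real (?G \<xi>)))"
  proof (rule Bochner_Integration.integrable_bound)
    show "integrable (lborel \<Otimes>\<^sub>M lborel) (\<lambda>(y, \<xi>). f y * ?G \<xi>)"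
      by (rule integrable_tensor[OF f integrable_heat_kernel[OF d]])
    show "(\<lambda>(y, \<xi>). complex_of_real (f y) * (cis (- ((x - y) \<bullet> \<xi>)) * complex_of_real (?G \<xi>))) \<in> borel_measurable (lborel \<Otimes>\<^sub>M lborel)"
      unfolding cis_conv_exp by measurable
  qed (auto simp: norm_mult abs_mult)
  have "complex_of_real (\<integral>y. f y * exp (- (norm (x - y))\<^sup>2 / (4 * \<epsilon>)) \<partial>lborel)
      = (\<integral>y. complex_of_real (f y) * complex_of_real (exp (- (norm (x - y))\<^sup>2 / (4 * \<epsilon>))) \<partial>lborel)"
    by (simp flip: of_real_mult add: integral_complex_of_real del: exp_of_real)
  also have "\<dots> = (\<integral>y. \<integral>\<xi>. complex_of_real (f y) * (cis (- ((x - y) \<bullet> \<xi>)) * complex_of_real (?G \<xi>)) \<partial>lborel \<partial>lborel)"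
    unfolding ex by simp
  also have "\<dots> = (\<integral>\<xi>. \<integral>y. complex_of_real (f y) * (cis (- ((x - y) \<bullet> \<xi>)) * complex_of_real (?G \<xi>)) \<partial>lborel \<partial>lborel)"
    using lborel_pair.Fubini_integral[OF int] by simp
  also have "\<dots> = (\<integral>\<xi>. cis (- (x \<bullet> \<xi>)) * complex_of_real (?G \<xi>) * fourier f (- \<xi>) \<partial>lborel)"
  proof (rule Bochner_Integration.integral_cong[OF refl])
    fix \<xi> :: "real^'n"
    have "cis (- ((x - y) \<bullet> \<xi>)) = cis (- (x \<bullet> \<xi>)) * cis (y \<bullet> \<xi>)" for y
      by (simp add: cis_mult inner_diff_left)
    then have "(\<integral>y. complex_of_real (f y) * (cis (- ((x - y) \<bullet> \<xi>)) * complex_of_real (?G \<xi>)) \<partial>lborel)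
       = (\<integral>y. (cis (- (x \<bullet> \<xi>)) * complex_of_real (?G \<xi>)) * (cis (- ((- \<xi>) \<bullet> y)) * complex_of_real (f y)) \<partial>lborel)"
      by (intro Bochner_Integration.integral_cong refl)
         (simp add: mult_ac inner_commute[of \<xi>])
    then show "(\<integral>y. complex_of_real (f y) * (cis (- ((x - y) \<bullet> \<xi>)) * complex_of_real (?G \<xi>)) \<partial>lborel)
        = cis (- (x \<bullet> \<xi>)) * complex_of_real (?G \<xi>) * fourier f (- \<xi>)"
      unfolding fourier_def by simp
  qed
  also have "\<dots> = 0" by (simp add: F)
  finally have "(\<integral>y. f y * exp (- (norm (x - y))\<^sup>2 / (4 * \<epsilon>)) \<partial>lborel) = 0" by simp
  moreover have "(\<integral>y. f y * heat_kernel \<epsilon> (x - y) \<partial>lborel) =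
      (\<integral>y. (4 * pi * \<epsilon>) powr (- (real CARD('n) / 2)) * (f y * exp (- (norm (x - y))\<^sup>2 / (4 * \<epsilon>))) \<partial>lborel)"
    by (intro Bochner_Integration.integral_cong refl) (simp add: heat_kernel_def mult_ac)
  ultimately show ?thesis by (simp del: times_divide_eq_right)
qed

text \<open>
The integral of \<open>f\<close> over a box is the limit of integrals of \<open>f\<close> against the Gaussian
regularisations \<open>\<psi> n\<close> of the indicator function. Those vanish, because a regularisation may be moved
to \<open>f\<close>. The regularisations converge off the frontier of the box, which is a null set.
\<close>

lemma fourier_eq_0_imp_box_integral_0:
  fixes f :: "real^'n \<Rightarrow> real"
  assumes f: "integrable lborel f" and F: "\<And>\<xi>. fourier f \<xi> = 0"
  shows "(\<integral>y. f y * indicator (box a b) y \<partial>lborel) = 0"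
proof -
  have [measurable]: "f \<in> borel_measurable borel" using f by auto
  let ?B = "box a b"
  define h where "h n = 1 / real (Suc n)" for n
  have h: "0 < h n" for n by (simp add: h_def)
  have h0: "h \<longlonglongrightarrow> 0" unfolding h_def by (rule LIMSEQ_Suc) (simp add: lim_1_over_n)
  define \<psi> where "\<psi> n y = (\<integral>z. indicator ?B (y + h n *\<^sub>R z) * heat_kernel 1 z \<partial>lborel)" for n and y :: "real^'n"
  have scale: "\<psi> n y = (\<integral>x. indicator ?B x * heat_kernel ((h n)\<^sup>2) (x - y) \<partial>lborel)" for n y
  proof -
    have "(4 * pi) powr (- (real CARD('n) / 2)) = h n ^ CARD('n) * (4 * pi * (h n)\<^sup>2) powr (- (real CARD('n) / 2))"
    proof -
      have "((h n)\<^sup>2) powr (- (real CARD('n) / 2)) = 1 / h n ^ CARD('n)"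
      proof -
        have "((h n)\<^sup>2) powr (- (real CARD('n) / 2)) = (h n powr 2) powr (- (real CARD('n) / 2))"
          using h[of n] by simp
        also have "\<dots> = h n powr (- real CARD('n))" by (subst powr_powr) simp
        also have "\<dots> = 1 / h n ^ CARD('n)" using h[of n] by (simp add: powr_minus_divide powr_realpow)
        finally show ?thesis .
      qed
      then show ?thesis using h[of n] by (simp add: powr_mult)
    qed
    then have "heat_kernel 1 z = \<bar>h n\<bar> ^ CARD('n) * heat_kernel ((h n)\<^sup>2) (h n *\<^sub>R z)" for z :: "real^'n"
      using h[of n] by (simp add: heat_kernel_def power_mult_distrib)
    then show ?thesis
      unfolding \<psi>_def using h[of n]
      by (subst (2) integral_lborel_affine[where c = "h n" and t = y]) (auto simp: mult_ac)
  qed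
  have "(\<integral>y. f y * \<psi> n y \<partial>lborel) = 0" for n
  proof -
    define \<epsilon> where "\<epsilon> = (h n)\<^sup>2"
    have e: "0 < \<epsilon>" using h[of n] by (simp add: \<epsilon>_def)
    define C where "C = (4 * pi * \<epsilon>) powr (- (real CARD('n) / 2))"
    have C: "heat_kernel \<epsilon> z \<le> C" for z :: "real^'n"
      using e by (simp add: heat_kernel_def C_def mult_left_le)
    have "integrable lborel (indicator ?B :: real^'n \<Rightarrow> real)"
      by (intro integrable_real_indicator) (auto simp: emeasure_lborel_box_eq)
    from integrable_tensor[OF this f] have "integrable (lborel \<Otimes>\<^sub>M lborel) (\<lambda>z. C * (case z of (x, y) \<Rightarrow> indicator ?B x * f y))"
      by (rule integrable_mult_right)
    then have t: "integrable (lborel \<Otimes>\<^sub>M lborel) (\<lambda>(x, y). C * (indicator ?B x * f y))"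
      by (simp only: case_prod_unfold)
    have int: "integrable (lborel \<Otimes>\<^sub>M lborel) (\<lambda>(x, y). f y * (indicator ?B x * heat_kernel \<epsilon> (x - y)))"
    proof (rule Bochner_Integration.integrable_bound[OF t])
      show "AE z in lborel \<Otimes>\<^sub>M lborel. norm (case z of (x, y) \<Rightarrow> f y * (indicator ?B x * heat_kernel \<epsilon> (x - y)))
          \<le> norm (case z of (x, y) \<Rightarrow> C * (indicator ?B x * f y))"
      proof (rule AE_I2, clarify)
        fix x y :: "real^'n"
        have "\<bar>f y\<bar> * (indicator ?B x * heat_kernel \<epsilon> (x - y)) \<le> \<bar>f y\<bar> * (indicator ?B x * C)"
          by (intro mult_left_mono C) auto
        also have "\<dots> \<le> \<bar>f y\<bar> * (indicator ?B x * \<bar>C\<bar>)" by (intro mult_left_mono) auto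
        finally show "norm (f y * (indicator ?B x * heat_kernel \<epsilon> (x - y))) \<le> norm (C * (indicator ?B x * f y))"
          by (simp add: abs_mult mult_ac)
      qed
    qed measurable
    have "(\<integral>y. f y * \<psi> n y \<partial>lborel) = (\<integral>y. \<integral>x. f y * (indicator ?B x * heat_kernel \<epsilon> (x - y)) \<partial>lborel \<partial>lborel)"
      by (simp add: scale \<epsilon>_def)
    also have "\<dots> = (\<integral>x. \<integral>y. f y * (indicator ?B x * heat_kernel \<epsilon> (x - y)) \<partial>lborel \<partial>lborel)"
      using lborel_pair.Fubini_integral[OF int] by simp
    also have "\<dots> = (\<integral>x. indicator ?B x * (\<integral>y. f y * heat_kernel \<epsilon> (x - y) \<partial>lborel) \<partial>lborel)"
    proof (rule Bochner_Integration.integral_cong[OF refl])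
      fix x
      have "(\<integral>y. f y * (indicator ?B x * heat_kernel \<epsilon> (x - y)) \<partial>lborel) =
          (\<integral>y. indicator ?B x * (f y * heat_kernel \<epsilon> (x - y)) \<partial>lborel)"
        by (intro Bochner_Integration.integral_cong refl) (simp add: mult_ac)
      then show "(\<integral>y. f y * (indicator ?B x * heat_kernel \<epsilon> (x - y)) \<partial>lborel) =
          indicator ?B x * (\<integral>y. f y * heat_kernel \<epsilon> (x - y) \<partial>lborel)" by simp
    qed
    also have "\<dots> = 0" using heat_convolution_eq_0[OF f F e] by simp
    finally show ?thesis .
  qed
  moreover have "(\<lambda>n. \<integral>y. f y * \<psi> n y \<partial>lborel) \<longlonglongrightarrow> (\<integral>y. f y * indicator ?B y \<partial>lborel)"
  proof (rule integral_dominated_convergence[where w = "\<lambda>y. \<bar>f y\<bar>"])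
    show m: "(\<lambda>y. f y * \<psi> n y) \<in> borel_measurable lborel" for n
      unfolding \<psi>_def by measurable
    have "\<bar>\<psi> n y\<bar> \<le> 1" for n y
    proof -
      have i: "integrable lborel (\<lambda>z. indicator ?B (y + h n *\<^sub>R z) * heat_kernel 1 z)"
        by (rule Bochner_Integration.integrable_bound[OF integrable_heat_kernel[of 1]]) (auto simp: indicator_def)
      have "\<psi> n y \<le> (\<integral>z. heat_kernel 1 (z :: real^'n) \<partial>lborel)"
        unfolding \<psi>_def by (intro integral_mono i integrable_heat_kernel) (auto simp: indicator_def)
      moreover have "0 \<le> \<psi> n y" unfolding \<psi>_def by (intro integral_nonneg_AE AE_I2) auto
      ultimately show ?thesis by (simp add: integral_heat_kernel)
    qed
    then show "AE y in lborel. norm (f y * \<psi> n y) \<le> \<bar>f y\<bar>" for n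
      by (intro AE_I2) (simp add: abs_mult mult_left_le)
    have "frontier ?B \<in> null_sets lborel"
      using negligible_convex_frontier[OF convex_box(2), of a b]
      by (simp add: negligible_iff_null_sets null_sets_completion_iff frontier_closed borel_closed)
    then have "AE y in lborel. y \<notin> frontier ?B" by (rule AE_not_in)
    then show "AE y in lborel. (\<lambda>n. f y * \<psi> n y) \<longlonglongrightarrow> f y * indicator ?B y"
    proof eventually_elim
      case (elim y)
      have "(\<lambda>n. \<psi> n y) \<longlonglongrightarrow> (\<integral>z. indicator ?B y * heat_kernel 1 (z :: real^'n) \<partial>lborel)"
        unfolding \<psi>_def
      proof (rule integral_dominated_convergence[where w = "heat_kernel 1"])
        show "AE z in lborel. (\<lambda>n. indicator ?B (y + h n *\<^sub>R z) * heat_kernel 1 z) \<longlonglongrightarrow> indicator ?B y * heat_kernel 1 z"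
        proof (rule AE_I2)
          fix z :: "real^'n"
          have lim: "(\<lambda>n. y + h n *\<^sub>R z) \<longlonglongrightarrow> y" using tendsto_add[OF tendsto_const tendsto_scaleR[OF h0 tendsto_const]] by simp
          have "eventually (\<lambda>n. indicator ?B (y + h n *\<^sub>R z) = (indicator ?B y :: real)) sequentially"
          proof (cases "y \<in> ?B")
            case True
            from topological_tendstoD[OF lim open_box True] show ?thesis
              by eventually_elim (use True in simp)
          next
            case False
            then have "y \<in> - closure ?B" using elim interior_open[OF open_box[of a b]] by (auto simp: frontier_def)
            from topological_tendstoD[OF lim _ this] have "eventually (\<lambda>n. y + h n *\<^sub>R z \<in> - closure ?B) sequentially"
              by (simp add: open_Compl)
            then show ?thesis
              by eventually_elim (use False closure_subset[of ?B] in \<open>auto simp: indicator_def\<close>)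
          qed
          then show "(\<lambda>n. indicator ?B (y + h n *\<^sub>R z) * heat_kernel 1 z) \<longlonglongrightarrow> indicator ?B y * heat_kernel 1 z"
            by (intro tendsto_intros tendsto_eventually)
        qed
      qed (auto simp: integrable_heat_kernel indicator_def)
      then show ?case by (intro tendsto_intros) (simp add: integral_heat_kernel)
    qed
  qed (use f in auto)
  ultimately show ?thesis by (simp add: LIMSEQ_const_iff)
qed

lemma box_integrals_0_imp_AE_0:
  fixes f :: "real^'n \<Rightarrow> real"
  assumes f: "integrable lborel f" and box: "\<And>a b. (\<integral>y. f y * indicator (box a b) y \<partial>lborel) = 0"
  shows "AE x in lborel. f x = 0"
proof -
  have [measurable]: "f \<in> borel_measurable borel" using f by auto
  \<comment> \<open>\<open>P\<close> and \<open>M\<close> are the positive and the negative part of \<open>f\<close>, as measures: \<open>ennreal\<close> sends negative numbers to \<open>0\<close>\<close>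
  define P where "P = density lborel (\<lambda>x. ennreal (f x))"
  define M where "M = density lborel (\<lambda>x. ennreal (- f x))"
  have eq: "emeasure P (box a b) = emeasure M (box a b)" for a b
  proof -
    have i: "integrable lborel (\<lambda>y. f y * indicator (box a b) y)"
      by (rule Bochner_Integration.integrable_bound[OF f]) (auto simp: indicator_def)
    have fin: "(\<integral>\<^sup>+x. ennreal (f x * indicator (box a b) x) \<partial>lborel) < \<infinity>"
      "(\<integral>\<^sup>+x. ennreal (- (f x * indicator (box a b) x)) \<partial>lborel) < \<infinity>"
      using i by (auto simp: real_integrable_def less_top)
    have "enn2real (\<integral>\<^sup>+x. ennreal (f x * indicator (box a b) x) \<partial>lborel) =
        enn2real (\<integral>\<^sup>+x. ennreal (- (f x * indicator (box a b) x)) \<partial>lborel)"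
      using box[of a b] real_lebesgue_integral_def[OF i] by simp
    then have "(\<integral>\<^sup>+x. ennreal (f x * indicator (box a b) x) \<partial>lborel) =
        (\<integral>\<^sup>+x. ennreal (- (f x * indicator (box a b) x)) \<partial>lborel)"
      using fin by (metis ennreal_enn2real infinity_ennreal_def)
    moreover have "emeasure P (box a b) = (\<integral>\<^sup>+x. ennreal (f x * indicator (box a b) x) \<partial>lborel)"
      unfolding P_def by (subst emeasure_density) (auto intro!: nn_integral_cong simp: indicator_def)
    moreover have "emeasure M (box a b) = (\<integral>\<^sup>+x. ennreal (- (f x * indicator (box a b) x)) \<partial>lborel)"
      unfolding M_def by (subst emeasure_density) (auto intro!: nn_integral_cong simp: indicator_def)
    ultimately show ?thesis by simp
  qed
  have "P = M"
  proof (rule measure_eqI_generator_eq[where E = "range (\<lambda>(a, b). box a b)" and \<Omega> = UNIV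
        and A = "\<lambda>n. box (- (real n *\<^sub>R One)) (real n *\<^sub>R One)"])
    show "Int_stable (range (\<lambda>(a, b). box a b :: (real^'n) set))"
      by (auto simp: Int_stable_def box_Int_box)
    show "sets P = sigma_sets UNIV (range (\<lambda>(a, b). box a b))" "sets M = sigma_sets UNIV (range (\<lambda>(a, b). box a b))"
      unfolding P_def M_def by (simp_all add: borel_eq_box)
    show "(\<Union>n. box (- (real n *\<^sub>R One)) (real n *\<^sub>R One)) = (UNIV :: (real^'n) set)"
      by (rule UN_box_eq_UNIV)
    show "emeasure P (box (- (real n *\<^sub>R One)) (real n *\<^sub>R One)) \<noteq> \<infinity>" for n
    proof -
      have "emeasure P (box (- (real n *\<^sub>R One)) (real n *\<^sub>R One)) \<le> (\<integral>\<^sup>+x. ennreal (f x) \<partial>lborel)"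
        unfolding P_def by (subst emeasure_density) (auto intro!: nn_integral_mono simp: indicator_def)
      also have "\<dots> < \<infinity>" using f by (auto simp: real_integrable_def less_top)
      finally show ?thesis by simp
    qed
  qed (auto simp: eq)
  then have "AE x in lborel. ennreal (f x) = ennreal (- f x)"
    unfolding P_def M_def by (subst (asm) sigma_finite_measure.density_unique_iff[OF lborel.sigma_finite_measure_axioms]) auto
  then show ?thesis
  proof eventually_elim
    case (elim x)
    show ?case
      using elim by (cases "0 \<le> f x") (auto simp: ennreal_neg not_le)
  qed
qed

lemma fourier_unique:
  fixes f g :: "real^'n \<Rightarrow> real"
  assumes f: "integrable lborel f" and g: "integrable lborel g"
    and F: "\<And>\<xi>. fourier f \<xi> = fourier g \<xi>"
  shows "AE x in lborel. f x = g x"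
proof -
  have [measurable]: "f \<in> borel_measurable borel" "g \<in> borel_measurable borel" using f g by auto
  have i: "integrable lborel (\<lambda>x. cis (- (\<xi> \<bullet> x)) * complex_of_real (k x))" if k: "integrable lborel k" for k :: "real^'n \<Rightarrow> real" and \<xi>
  proof (rule Bochner_Integration.integrable_bound[OF k])
    have [measurable]: "k \<in> borel_measurable borel" using k by auto
    show "(\<lambda>x. cis (- (\<xi> \<bullet> x)) * complex_of_real (k x)) \<in> borel_measurable lborel"
      unfolding cis_conv_exp by measurable
  qed (auto simp: norm_mult)
  have "fourier (\<lambda>x. f x - g x) \<xi> = 0" for \<xi>
    using Bochner_Integration.integral_diff[OF i[OF f] i[OF g], of \<xi> \<xi>] F[of \<xi>]
    unfolding fourier_def by (simp add: algebra_simps)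
  then have "AE x in lborel. f x - g x = 0"
    using f g by (intro box_integrals_0_imp_AE_0 fourier_eq_0_imp_box_integral_0) auto
  then show ?thesis by eventually_elim simp
qed

section \<open>Inequalities of Hoelder type\<close>

text \<open>
Inner integrals in the inequalities below may be infinite at some points, so powers of extended
nonnegative reals are needed.
\<close>

definition epowr :: "ennreal \<Rightarrow> real \<Rightarrow> ennreal" where
  "epowr x q = (if x = \<top> then \<top> else ennreal (enn2real x powr q))"

lemma epowr_ennreal [simp]: "0 \<le> x \<Longrightarrow> epowr (ennreal x) q = ennreal (x powr q)"
  by (simp add: epowr_def)

lemma epowr_0 [simp]: "epowr 0 q = 0"
  by (simp add: epowr_def)

lemma epowr_mono:
  assumes "x \<le> y" "0 \<le> q"
  shows "epowr x q \<le> epowr y q"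
proof (cases "y = \<top>")
  case False
  with assms have "x \<noteq> \<top>" by (auto simp: top_unique)
  with False assms show ?thesis
    by (auto simp: epowr_def less_top intro!: ennreal_leI powr_mono2 enn2real_mono)
qed (simp add: epowr_def)

lemma epowr_measurable [measurable]:
  assumes [measurable]: "f \<in> borel_measurable M"
  shows "(\<lambda>x. epowr (f x) q) \<in> borel_measurable M"
  unfolding epowr_def by measurable

lemma weighted_amgm3:
  fixes x y z :: real
  assumes p: "0 < x" "0 < y" "0 < z" and t: "0 \<le> t0" "0 \<le> t1" "0 \<le> t2" "t0 + t1 + t2 = 1"
  shows "x powr t0 * y powr t1 * z powr t2 \<le> t0 * x + t1 * y + t2 * z"
proof -
  define m where "m = t0 * x + t1 * y + t2 * z"
  have m: "0 < m"
  proof -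
    have "0 < t0 \<or> 0 < t1 \<or> 0 < t2" using t by linarith
    then show ?thesis unfolding m_def using p t
      by (metis add_nonneg_pos add_pos_nonneg mult_nonneg_nonneg mult_pos_pos less_imp_le add_nonneg_nonneg)
  qed
  have l: "ln w \<le> ln m + w / m - 1" if "0 < w" for w
    using ln_le_minus_one[of "w / m"] that m by (simp add: ln_div)
  have "t0 * ln x + t1 * ln y + t2 * ln z
      \<le> t0 * (ln m + x / m - 1) + t1 * (ln m + y / m - 1) + t2 * (ln m + z / m - 1)"
    using p t by (intro add_mono mult_left_mono l) auto
  also have "\<dots> = (t0 + t1 + t2) * (ln m - 1) + (t0 * x + t1 * y + t2 * z) / m"
    by (simp add: algebra_simps add_divide_distrib)
  also have "\<dots> = ln m" using m t(4) unfolding m_def[symmetric] by simp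
  finally have "exp (t0 * ln x + t1 * ln y + t2 * ln z) \<le> m"
    using m by (metis exp_le_cancel_iff exp_ln)
  then show ?thesis using p by (simp add: powr_def exp_add m_def)
qed

text \<open>
Hoelder's inequality for three factors, in the form in which it proves both Minkowski's and Young's
inequality: the bounds \<open>V\<close> and \<open>W\<close> for two of the integrals are known in advance and the third
integral appears linearly. It suffices to integrate the weighted inequality of the arithmetic and
geometric means for the normalised functions. Positivity of the factors is required only where \<open>g\<close>
is positive, since \<open>0 powr 0 = 0\<close> would spoil the case of an exponent \<open>0\<close>.
\<close>

lemma nn_integral_holder3:
  fixes g u v w :: "'a \<Rightarrow> real"
  assumes [measurable]: "g \<in> borel_measurable M" "u \<in> borel_measurable M"
      "v \<in> borel_measurable M" "w \<in> borel_measurable M"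
    and nn: "\<And>i. 0 \<le> g i" "\<And>i. 0 \<le> u i" "\<And>i. 0 \<le> v i" "\<And>i. 0 \<le> w i"
    and pos: "\<And>i. 0 < g i \<Longrightarrow> 0 < u i \<and> 0 < v i \<and> 0 < w i"
    and le: "\<And>i. 0 < g i \<Longrightarrow> g i \<le> u i powr t0 * v i powr t1 * w i powr t2"
    and t: "0 < t0" "0 \<le> t1" "0 \<le> t2" "t0 + t1 + t2 = 1"
    and V: "(\<integral>\<^sup>+i. ennreal (v i) \<partial>M) \<le> ennreal V" "0 < V"
    and W: "(\<integral>\<^sup>+i. ennreal (w i) \<partial>M) \<le> ennreal W" "0 < W"
  shows "epowr (\<integral>\<^sup>+i. ennreal (g i) \<partial>M) (1 / t0) \<le>
    ennreal (V powr (t1 / t0) * W powr (t2 / t0)) * (\<integral>\<^sup>+i. ennreal (u i) \<partial>M)"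
proof -
  let ?U = "\<integral>\<^sup>+i. ennreal (u i) \<partial>M"
  consider "?U = \<top>" | "?U = 0" | U where "?U = ennreal U" "0 < U"
    by (cases ?U) (auto simp: less_le)
  then show ?thesis
  proof cases
    case 1
    then show ?thesis using V W by (simp add: ennreal_mult_top)
  next
    case 2
    then have "AE i in M. ennreal (u i) = 0" by (subst (asm) nn_integral_0_iff_AE) auto
    then have "AE i in M. ennreal (g i) = 0"
      by eventually_elim (use pos nn in \<open>force simp: ennreal_eq_0_iff not_le[symmetric]\<close>)
    then have "(\<integral>\<^sup>+i. ennreal (g i) \<partial>M) = 0" by (subst nn_integral_0_iff_AE) auto
    then show ?thesis by simp
  next
    case (3 U)
    define c where "c = U powr t0 * V powr t1 * W powr t2"
    have c: "0 < c" using 3 V W by (simp add: c_def)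
    have pt: "g i \<le> c * (t0 / U * u i + t1 / V * v i + t2 / W * w i)" for i
    proof (cases "0 < g i")
      case True
      note p = pos[OF True]
      have "g i \<le> u i powr t0 * v i powr t1 * w i powr t2" by (rule le[OF True])
      also have "\<dots> = c * ((u i / U) powr t0 * (v i / V) powr t1 * (w i / W) powr t2)"
        using p 3 V W by (simp add: c_def powr_divide)
      also have "\<dots> \<le> c * (t0 * (u i / U) + t1 * (v i / V) + t2 * (w i / W))"
        using p 3 V W c t by (intro mult_left_mono weighted_amgm3) auto
      finally show ?thesis by simp
    next
      case False
      then have "g i = 0" using nn(1)[of i] by simp
      then show ?thesis using c nn(2-4)[of i] t 3 V W by simp
    qed
    have "(\<integral>\<^sup>+i. ennreal (g i) \<partial>M) \<le> (\<integral>\<^sup>+i. ennreal c * (ennreal (t0 / U) * ennreal (u i) + ennreal (t1 / V) * ennreal (v i) + ennreal (t2 / W) * ennreal (w i)) \<partial>M)"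
    proof (rule nn_integral_mono)
      fix i
      have "ennreal c * (ennreal (t0 / U) * ennreal (u i) + ennreal (t1 / V) * ennreal (v i) + ennreal (t2 / W) * ennreal (w i))
         = ennreal (c * (t0 / U * u i + t1 / V * v i + t2 / W * w i))"
        using c nn t 3 V W by (simp add: ennreal_mult ennreal_plus[symmetric] del: ennreal_plus flip: ennreal_mult)
      then show "ennreal (g i) \<le> ennreal c * (ennreal (t0 / U) * ennreal (u i) + ennreal (t1 / V) * ennreal (v i) + ennreal (t2 / W) * ennreal (w i))"
        using pt by (simp add: ennreal_leI)
    qed
    also have "\<dots> = ennreal c * (ennreal (t0 / U) * ?U + ennreal (t1 / V) * (\<integral>\<^sup>+i. ennreal (v i) \<partial>M) + ennreal (t2 / W) * (\<integral>\<^sup>+i. ennreal (w i) \<partial>M))"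
      by (simp add: nn_integral_cmult nn_integral_add)
    also have "\<dots> \<le> ennreal c * (ennreal (t0 / U) * ennreal U + ennreal (t1 / V) * ennreal V + ennreal (t2 / W) * ennreal W)"
      using 3 V W by (intro mult_left_mono add_mono) auto
    also have "\<dots> = ennreal c * ennreal (t0 + t1 + t2)"
      using t 3 V W by (simp add: ennreal_plus[symmetric] del: ennreal_plus flip: ennreal_mult)
    also have "\<dots> = ennreal c" using t by simp
    finally have "epowr (\<integral>\<^sup>+i. ennreal (g i) \<partial>M) (1 / t0) \<le> epowr (ennreal c) (1 / t0)"
      using t by (intro epowr_mono) auto
    also have "\<dots> = ennreal (V powr (t1 / t0) * W powr (t2 / t0)) * ennreal U"
      using c 3 V W t by (simp add: c_def powr_mult powr_powr mult_ac flip: ennreal_mult)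
    finally show ?thesis using 3 by simp
  qed
qed

text \<open>
Minkowski's integral inequality. The function \<open>\<kappa>\<close> majorises the \<open>L\<^sup>r\<close> norms of the \<open>k i\<close>, and
\<open>k = (\<kappa> powr (1 - r) * k powr r) powr (1 / r) * \<kappa> powr (1 - 1 / r)\<close> is the splitting to which
Hoelder's inequality is applied.
\<close>

lemma minkowski_nn:
  fixes k :: "'i \<Rightarrow> 'x \<Rightarrow> real" and \<kappa> :: "'i \<Rightarrow> real"
  assumes sf: "sigma_finite_measure \<mu>" "sigma_finite_measure \<nu>"
    and [measurable]: "(\<lambda>(i, x). k i x) \<in> borel_measurable (\<mu> \<Otimes>\<^sub>M \<nu>)" "\<kappa> \<in> borel_measurable \<mu>"
    and nn: "\<And>i x. 0 \<le> k i x" "\<And>i. 0 \<le> \<kappa> i" and z: "\<And>i x. \<kappa> i = 0 \<Longrightarrow> k i x = 0"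
    and le: "AE i in \<mu>. (\<integral>\<^sup>+x. ennreal (k i x powr r) \<partial>\<nu>) \<le> ennreal (\<kappa> i powr r)"
    and A: "(\<integral>\<^sup>+i. ennreal (\<kappa> i) \<partial>\<mu>) \<le> ennreal A" "0 < A" and r: "1 \<le> r"
  shows "(\<integral>\<^sup>+x. epowr (\<integral>\<^sup>+i. ennreal (k i x) \<partial>\<mu>) r \<partial>\<nu>) \<le> ennreal (A powr r)"
proof -
  interpret pair_sigma_finite \<mu> \<nu> using sf by (rule pair_sigma_finite.intro)
  have pt: "epowr (\<integral>\<^sup>+i. ennreal (k i x) \<partial>\<mu>) r \<le> ennreal (A powr (r - 1)) * (\<integral>\<^sup>+i. ennreal (\<kappa> i powr (1 - r) * k i x powr r) \<partial>\<mu>)"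
    if x[measurable]: "x \<in> space \<nu>" for x
  proof -
    have [measurable]: "(\<lambda>i. k i x) \<in> borel_measurable \<mu>"
      using measurable_compose[OF measurable_Pair[OF measurable_id measurable_const[OF x]] assms(3)] by (simp add: id_def)
    have "epowr (\<integral>\<^sup>+i. ennreal (k i x) \<partial>\<mu>) (1 / (1 / r)) \<le>
       ennreal (A powr ((1 - 1 / r) / (1 / r)) * A powr (0 / (1 / r))) * (\<integral>\<^sup>+i. ennreal (\<kappa> i powr (1 - r) * k i x powr r) \<partial>\<mu>)"
    proof (rule nn_integral_holder3[where v = \<kappa> and w = \<kappa>])
      fix i assume k: "0 < k i x"
      then have kp: "0 < \<kappa> i" using z[of i x] nn(2)[of i] by (auto simp: less_le)
      with k show "0 < \<kappa> i powr (1 - r) * k i x powr r \<and> 0 < \<kappa> i \<and> 0 < \<kappa> i" by simp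
      have "(\<kappa> i powr (1 - r) * k i x powr r) powr (1 / r) * \<kappa> i powr (1 - 1 / r) * \<kappa> i powr 0
          = k i x * (\<kappa> i powr ((1 - r) * (1 / r)) * \<kappa> i powr (1 - 1 / r))"
        using k kp r by (simp add: powr_mult powr_powr mult_ac)
      also have "\<kappa> i powr ((1 - r) * (1 / r)) * \<kappa> i powr (1 - 1 / r) = \<kappa> i powr 0"
        unfolding powr_add[symmetric] using r by (simp add: field_simps)
      finally show "k i x \<le> (\<kappa> i powr (1 - r) * k i x powr r) powr (1 / r) * \<kappa> i powr (1 - 1 / r) * \<kappa> i powr 0"
        using kp by simp
    qed (use nn r A in auto)
    also have "(1 - 1 / r) / (1 / r) = r - 1" using r by (simp add: field_simps)
    finally show ?thesis using A by simp
  qed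
  have "(\<integral>\<^sup>+x. epowr (\<integral>\<^sup>+i. ennreal (k i x) \<partial>\<mu>) r \<partial>\<nu>)
      \<le> (\<integral>\<^sup>+x. ennreal (A powr (r - 1)) * (\<integral>\<^sup>+i. ennreal (\<kappa> i powr (1 - r) * k i x powr r) \<partial>\<mu>) \<partial>\<nu>)"
    by (intro nn_integral_mono pt)
  also have "\<dots> = ennreal (A powr (r - 1)) * (\<integral>\<^sup>+x. \<integral>\<^sup>+i. ennreal (\<kappa> i powr (1 - r) * k i x powr r) \<partial>\<mu> \<partial>\<nu>)"
    by (rule nn_integral_cmult) measurable
  also have "(\<integral>\<^sup>+x. \<integral>\<^sup>+i. ennreal (\<kappa> i powr (1 - r) * k i x powr r) \<partial>\<mu> \<partial>\<nu>)
      = (\<integral>\<^sup>+i. \<integral>\<^sup>+x. ennreal (\<kappa> i powr (1 - r) * k i x powr r) \<partial>\<nu> \<partial>\<mu>)"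
    by (rule Fubini') measurable
  also have "\<dots> \<le> (\<integral>\<^sup>+i. ennreal (\<kappa> i) \<partial>\<mu>)"
  proof (rule nn_integral_mono_AE)
    show "AE i in \<mu>. (\<integral>\<^sup>+x. ennreal (\<kappa> i powr (1 - r) * k i x powr r) \<partial>\<nu>) \<le> ennreal (\<kappa> i)"
      using le AE_space
    proof eventually_elim
      case (elim i)
      have [measurable]: "(\<lambda>x. k i x) \<in> borel_measurable \<nu>"
        using measurable_compose[OF measurable_Pair1'[OF elim(2)] assms(3)] by simp
      have "(\<integral>\<^sup>+x. ennreal (\<kappa> i powr (1 - r) * k i x powr r) \<partial>\<nu>) = ennreal (\<kappa> i powr (1 - r)) * (\<integral>\<^sup>+x. ennreal (k i x powr r) \<partial>\<nu>)"
        by (subst nn_integral_cmult[symmetric]) (auto simp: ennreal_mult)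
      also have "\<dots> \<le> ennreal (\<kappa> i powr (1 - r)) * ennreal (\<kappa> i powr r)"
        by (intro mult_left_mono elim) auto
      also have "\<dots> = ennreal (\<kappa> i)"
        using nn(2)[of i] by (simp add: powr_add[symmetric] flip: ennreal_mult)
      finally show ?case .
    qed
  qed
  also have "\<dots> \<le> ennreal A" by (rule A)
  also have "ennreal (A powr (r - 1)) * ennreal A = ennreal (A powr r)"
    using A(2) by (simp add: powr_diff flip: ennreal_mult)
  finally show ?thesis by (simp add: mult_left_mono)
qed

lemma nn_integral_reflect_translate:
  fixes f :: "real^'n \<Rightarrow> ennreal"
  assumes [measurable]: "f \<in> borel_measurable borel"
  shows "(\<integral>\<^sup>+y. f (x - y) \<partial>lborel) = (\<integral>\<^sup>+y. f y \<partial>lborel)"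
proof -
  have "(\<integral>\<^sup>+y. f y \<partial>lborel) = (\<integral>\<^sup>+y. ennreal (\<bar>-1\<bar> ^ DIM(real^'n)) * f (x + (-1) *\<^sub>R y) \<partial>lborel)"
    by (subst lborel_affine[of "-1" x], simp, subst nn_integral_density) (auto simp: nn_integral_distr ennreal_power)
  then show ?thesis by simp
qed

lemma nn_integral_translate:
  fixes f :: "real^'n \<Rightarrow> ennreal"
  assumes [measurable]: "f \<in> borel_measurable borel"
  shows "(\<integral>\<^sup>+x. f (x - y) \<partial>lborel) = (\<integral>\<^sup>+x. f x \<partial>lborel)"
proof -
  have "(\<integral>\<^sup>+x. f x \<partial>lborel) = (\<integral>\<^sup>+x. ennreal (\<bar>1\<bar> ^ DIM(real^'n)) * f (- y + 1 *\<^sub>R x) \<partial>lborel)"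
    by (subst lborel_affine[of 1 "- y"], simp, subst nn_integral_density) (auto simp: nn_integral_distr)
  then show ?thesis by simp
qed

lemma AE_reflect_translate:
  fixes P :: "real^'n \<Rightarrow> bool"
  assumes P: "AE y in lborel. P y"
  shows "AE y in lborel. P (x - y)"
proof -
  obtain N where N: "N \<in> null_sets lborel" "{y \<in> space lborel. \<not> P y} \<subseteq> N"
    using P by (auto simp: eventually_ae_filter)
  have [measurable]: "N \<in> sets borel" using N by auto
  have "(\<integral>\<^sup>+y. indicator N (x - y) \<partial>lborel) = (\<integral>\<^sup>+y. indicator N y \<partial>lborel)"
    by (rule nn_integral_reflect_translate) measurable
  also have "\<dots> = 0" using N by (auto simp: null_sets_def)
  finally have "AE y in lborel. (indicator N (x - y) :: ennreal) = 0"
    by (subst (asm) nn_integral_0_iff_AE) measurable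
  then show ?thesis
    by eventually_elim (use N in \<open>auto simp: indicator_def split: if_splits\<close>)
qed

text \<open>
Young's inequality for convolutions combined with Minkowski's inequality in a parameter \<open>i\<close>. The
usual three factors of Young's proof are weighted by powers of \<open>\<kappa> i\<close> chosen so that the total power
of \<open>\<kappa> i\<close> is zero, and a single application of Hoelder's inequality over \<open>(i, y)\<close> then suffices.
\<close>

lemma young_nn:
  fixes F K :: "'i \<Rightarrow> real^'n \<Rightarrow> real" and \<kappa> :: "'i \<Rightarrow> real"
  assumes sf: "sigma_finite_measure \<mu>"
    and Fm: "(\<lambda>(i, y). F i y) \<in> borel_measurable (\<mu> \<Otimes>\<^sub>M lborel)"
    and Km: "(\<lambda>(i, y). K i y) \<in> borel_measurable (\<mu> \<Otimes>\<^sub>M lborel)"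
    and [measurable]: "\<kappa> \<in> borel_measurable \<mu>"
    and nn: "\<And>i y. 0 \<le> F i y" "\<And>i y. 0 \<le> K i y" "\<And>i. 0 \<le> \<kappa> i"
    and z: "\<And>i y. \<kappa> i = 0 \<Longrightarrow> K i y = 0"
    and F: "AE i in \<mu>. (\<integral>\<^sup>+y. ennreal (F i y powr a) \<partial>lborel) \<le> ennreal (B powr a)"
    and K: "\<And>i. (\<integral>\<^sup>+y. ennreal (K i y powr r) \<partial>lborel) \<le> ennreal (\<kappa> i powr r)"
    and A: "(\<integral>\<^sup>+i. ennreal (\<kappa> i) \<partial>\<mu>) \<le> ennreal A" "0 < A" and B: "0 < B"
    and ex: "1 \<le> a" "1 \<le> r" "0 < q" "1 / a + 1 / r = 1 + 1 / q"
  shows "(\<integral>\<^sup>+x. epowr (\<integral>\<^sup>+z. ennreal (F (fst z) (snd z) * K (fst z) (x - snd z)) \<partial>(\<mu> \<Otimes>\<^sub>M lborel)) q \<partial>lborel)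
    \<le> ennreal ((A * B) powr q)"
proof -
  interpret sigma_finite_measure \<mu> by (rule sf)
  interpret P: pair_sigma_finite \<mu> "lborel :: (real^'n) measure" ..
  interpret P2: pair_sigma_finite "\<mu> \<Otimes>\<^sub>M (lborel :: (real^'n) measure)" "lborel :: (real^'n) measure" ..
  \<comment> \<open>the exponents of Hoelder's inequality, belonging to \<open>F\<close> and \<open>K\<close> jointly, to \<open>F\<close> alone and to \<open>K\<close> alone\<close>
  define t0 where "t0 = 1 / q"
  define t1 where "t1 = 1 / a - 1 / q"
  define t2 where "t2 = 1 / r - 1 / q"
  have t: "0 < t0" "0 \<le> t1" "0 \<le> t2" "t0 + t1 + t2 = 1"
    using ex by (auto simp: t0_def t1_def t2_def divide_le_eq_1)
      (smt (verit) divide_le_eq_1)+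
  have at: "a * t0 + a * t1 = 1" "r * t0 + r * t2 = 1" "(1 - r) * t0 + t1 + (1 - r) * t2 = 0"
  proof -
    show "a * t0 + a * t1 = 1" "r * t0 + r * t2 = 1"
      using ex by (simp_all add: t0_def t1_def t2_def right_diff_distrib)
    then show "(1 - r) * t0 + t1 + (1 - r) * t2 = 0" using t(4) by (simp add: algebra_simps)
  qed
  define u where "u x z = \<kappa> (fst z) powr (1 - r) * F (fst z) (snd z) powr a * K (fst z) (x - snd z) powr r" for x z
  define v where "v z = \<kappa> (fst z) * F (fst z) (snd z) powr a" for z
  define w where "w x z = \<kappa> (fst z) powr (1 - r) * K (fst z) (x - snd z) powr r" for x z
  have [measurable]: "(\<lambda>z. F (f z) (g z)) \<in> borel_measurable N" "(\<lambda>z. K (f z) (g z)) \<in> borel_measurable N"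
    if f: "f \<in> N \<rightarrow>\<^sub>M \<mu>" and g: "g \<in> N \<rightarrow>\<^sub>M borel" for f N and g :: "_ \<Rightarrow> real^'n"
  proof -
    have p: "(\<lambda>z. (f z, g z)) \<in> N \<rightarrow>\<^sub>M \<mu> \<Otimes>\<^sub>M lborel" using f g by measurable
    show "(\<lambda>z. F (f z) (g z)) \<in> borel_measurable N" "(\<lambda>z. K (f z) (g z)) \<in> borel_measurable N"
      using measurable_compose[OF p Fm] measurable_compose[OF p Km] by simp_all
  qed
  have [measurable]: "v \<in> borel_measurable (\<mu> \<Otimes>\<^sub>M lborel)" "w x \<in> borel_measurable (\<mu> \<Otimes>\<^sub>M lborel)"
      "u x \<in> borel_measurable (\<mu> \<Otimes>\<^sub>M lborel)" for x
    unfolding u_def v_def w_def by measurable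
  have kk: "ennreal (\<kappa> i powr (1 - r)) * ennreal (\<kappa> i powr r) = ennreal (\<kappa> i)" for i
    using nn(3)[of i] by (simp add: powr_add[symmetric] flip: ennreal_mult)
  have V: "(\<integral>\<^sup>+z. ennreal (v z) \<partial>(\<mu> \<Otimes>\<^sub>M lborel)) \<le> ennreal (A * B powr a)"
  proof -
    have "(\<integral>\<^sup>+z. ennreal (v z) \<partial>(\<mu> \<Otimes>\<^sub>M lborel)) = (\<integral>\<^sup>+i. \<integral>\<^sup>+y. ennreal (\<kappa> i) * ennreal (F i y powr a) \<partial>lborel \<partial>\<mu>)"
      unfolding v_def by (subst lborel.nn_integral_fst[symmetric]) (auto simp: ennreal_mult nn)
    also have "\<dots> \<le> (\<integral>\<^sup>+i. ennreal (\<kappa> i) * ennreal (B powr a) \<partial>\<mu>)"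
    proof (rule nn_integral_mono_AE)
      show "AE i in \<mu>. (\<integral>\<^sup>+y. ennreal (\<kappa> i) * ennreal (F i y powr a) \<partial>lborel) \<le> ennreal (\<kappa> i) * ennreal (B powr a)"
        using F AE_space
      proof eventually_elim
        case (elim i)
        have [measurable]: "(\<lambda>y. F i y) \<in> borel_measurable lborel"
          using measurable_compose[OF measurable_Pair1'[OF elim(2)] Fm] by simp
        show ?case by (subst nn_integral_cmult) (auto intro!: mult_left_mono elim)
      qed
    qed
    also have "\<dots> = (\<integral>\<^sup>+i. ennreal (\<kappa> i) \<partial>\<mu>) * ennreal (B powr a)" by (rule nn_integral_multc) measurable
    also have "\<dots> \<le> ennreal A * ennreal (B powr a)" by (intro mult_right_mono A) auto
    finally show ?thesis using A by (simp add: ennreal_mult)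
  qed
  have W: "(\<integral>\<^sup>+z. ennreal (w x z) \<partial>(\<mu> \<Otimes>\<^sub>M lborel)) \<le> ennreal A" for x
  proof -
    have "(\<integral>\<^sup>+z. ennreal (w x z) \<partial>(\<mu> \<Otimes>\<^sub>M lborel)) = (\<integral>\<^sup>+i. \<integral>\<^sup>+y. ennreal (\<kappa> i powr (1 - r)) * ennreal (K i (x - y) powr r) \<partial>lborel \<partial>\<mu>)"
      unfolding w_def by (subst lborel.nn_integral_fst[symmetric]) (auto simp: ennreal_mult nn)
    also have "\<dots> \<le> (\<integral>\<^sup>+i. ennreal (\<kappa> i) \<partial>\<mu>)"
    proof (rule nn_integral_mono)
      fix i assume i[measurable]: "i \<in> space \<mu>"
      have [measurable]: "(\<lambda>y. K i y) \<in> borel_measurable borel"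
        using measurable_compose[OF measurable_Pair1'[OF i] Km] by simp
      have "(\<integral>\<^sup>+y. ennreal (\<kappa> i powr (1 - r)) * ennreal (K i (x - y) powr r) \<partial>lborel)
          = ennreal (\<kappa> i powr (1 - r)) * (\<integral>\<^sup>+y. ennreal (K i (x - y) powr r) \<partial>lborel)"
        by (rule nn_integral_cmult) measurable
      also have "(\<integral>\<^sup>+y. ennreal (K i (x - y) powr r) \<partial>lborel) = (\<integral>\<^sup>+y. ennreal (K i y powr r) \<partial>lborel)"
        by (rule nn_integral_reflect_translate) measurable
      also have "ennreal (\<kappa> i powr (1 - r)) * \<dots> \<le> ennreal (\<kappa> i powr (1 - r)) * ennreal (\<kappa> i powr r)"
        by (intro mult_left_mono K) auto
      finally show "(\<integral>\<^sup>+y. ennreal (\<kappa> i powr (1 - r)) * ennreal (K i (x - y) powr r) \<partial>lborel) \<le> ennreal (\<kappa> i)"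
        by (simp only: kk)
    qed
    also note A(1)
    finally show ?thesis .
  qed
  have U: "(\<integral>\<^sup>+x. \<integral>\<^sup>+z. ennreal (u x z) \<partial>(\<mu> \<Otimes>\<^sub>M lborel) \<partial>lborel) \<le> ennreal (A * B powr a)"
  proof -
    have "(\<integral>\<^sup>+x. \<integral>\<^sup>+z. ennreal (u x z) \<partial>(\<mu> \<Otimes>\<^sub>M lborel) \<partial>lborel) = (\<integral>\<^sup>+z. \<integral>\<^sup>+x. ennreal (u x z) \<partial>lborel \<partial>(\<mu> \<Otimes>\<^sub>M lborel))"
      unfolding u_def by (rule P2.Fubini') measurable
    also have "\<dots> \<le> (\<integral>\<^sup>+z. ennreal (v z) \<partial>(\<mu> \<Otimes>\<^sub>M lborel))"
    proof (rule nn_integral_mono)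
      fix z assume "z \<in> space (\<mu> \<Otimes>\<^sub>M (lborel :: (real^'n) measure))"
      then have i: "fst z \<in> space \<mu>" by (auto simp: space_pair_measure)
      let ?i = "fst z" and ?f = "F (fst z) (snd z)"
      have [measurable]: "(\<lambda>y. K ?i y) \<in> borel_measurable borel"
        using measurable_compose[OF measurable_Pair1'[OF i] Km] by simp
      have "(\<integral>\<^sup>+x. ennreal (u x z) \<partial>lborel) = (\<integral>\<^sup>+x. ennreal (\<kappa> ?i powr (1 - r) * ?f powr a) * ennreal (K ?i (x - snd z) powr r) \<partial>lborel)"
        by (simp add: u_def ennreal_mult)
      also have "\<dots> = ennreal (\<kappa> ?i powr (1 - r) * ?f powr a) * (\<integral>\<^sup>+x. ennreal (K ?i (x - snd z) powr r) \<partial>lborel)"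
        by (rule nn_integral_cmult) measurable
      also have "(\<integral>\<^sup>+x. ennreal (K ?i (x - snd z) powr r) \<partial>lborel) = (\<integral>\<^sup>+x. ennreal (K ?i x powr r) \<partial>lborel)"
        by (rule nn_integral_translate) measurable
      also have "ennreal (\<kappa> ?i powr (1 - r) * ?f powr a) * \<dots> \<le> ennreal (\<kappa> ?i powr (1 - r) * ?f powr a) * ennreal (\<kappa> ?i powr r)"
        by (intro mult_left_mono K) auto
      also have "\<dots> = ennreal (\<kappa> ?i powr (1 - r)) * ennreal (\<kappa> ?i powr r) * ennreal (?f powr a)"
        by (simp add: ennreal_mult mult_ac)
      also have "\<dots> = ennreal (v z)" unfolding kk v_def using nn by (simp add: ennreal_mult)
      finally show "(\<integral>\<^sup>+x. ennreal (u x z) \<partial>lborel) \<le> ennreal (v z)" .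
    qed
    also note V
    finally show ?thesis .
  qed
  define c where "c = (A * B powr a) powr (t1 / t0) * A powr (t2 / t0)"
  have pt: "epowr (\<integral>\<^sup>+z. ennreal (F (fst z) (snd z) * K (fst z) (x - snd z)) \<partial>(\<mu> \<Otimes>\<^sub>M lborel)) (1 / t0)
      \<le> ennreal c * (\<integral>\<^sup>+z. ennreal (u x z) \<partial>(\<mu> \<Otimes>\<^sub>M lborel))" for x
    unfolding c_def
  proof (rule nn_integral_holder3[where v = v and w = "w x"])
    fix z
    assume "0 < F (fst z) (snd z) * K (fst z) (x - snd z)"
    then have p: "0 < F (fst z) (snd z)" "0 < K (fst z) (x - snd z)"
      using nn(1)[of "fst z" "snd z"] nn(2)[of "fst z" "x - snd z"] by (auto simp: zero_less_mult_iff)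
    then have kp: "0 < \<kappa> (fst z)" using z[of "fst z" "x - snd z"] nn(3)[of "fst z"] by (auto simp: less_le)
    show "0 < u x z \<and> 0 < v z \<and> 0 < w x z"
      using p kp by (simp add: u_def v_def w_def)
    have "u x z powr t0 * v z powr t1 * w x z powr t2 =
       F (fst z) (snd z) powr (a * t0 + a * t1) * K (fst z) (x - snd z) powr (r * t0 + r * t2) *
       \<kappa> (fst z) powr ((1 - r) * t0 + t1 + (1 - r) * t2)"
      using p kp by (simp add: u_def v_def w_def powr_mult powr_powr powr_add mult_ac)
    also have "\<dots> = F (fst z) (snd z) * K (fst z) (x - snd z)"
      unfolding at using p kp by simp
    finally show "F (fst z) (snd z) * K (fst z) (x - snd z) \<le> u x z powr t0 * v z powr t1 * w x z powr t2" by simp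
  qed (use nn t V W A B in \<open>auto simp: u_def v_def w_def\<close>)
  have "(\<integral>\<^sup>+x. epowr (\<integral>\<^sup>+z. ennreal (F (fst z) (snd z) * K (fst z) (x - snd z)) \<partial>(\<mu> \<Otimes>\<^sub>M lborel)) q \<partial>lborel)
     \<le> (\<integral>\<^sup>+x. ennreal c * (\<integral>\<^sup>+z. ennreal (u x z) \<partial>(\<mu> \<Otimes>\<^sub>M lborel)) \<partial>lborel)"
    using pt unfolding t0_def by (intro nn_integral_mono) simp
  also have "\<dots> = ennreal c * (\<integral>\<^sup>+x. \<integral>\<^sup>+z. ennreal (u x z) \<partial>(\<mu> \<Otimes>\<^sub>M lborel) \<partial>lborel)"
    unfolding u_def by (rule nn_integral_cmult) measurable
  also have "\<dots> \<le> ennreal c * ennreal (A * B powr a)" by (intro mult_left_mono U) auto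
  also have "\<dots> = ennreal (c * (A * B powr a))"
    using A by (simp add: c_def flip: ennreal_mult)
  also have "c * (A * B powr a) = (A * B) powr q"
  proof -
    have tq: "t1 / t0 = q * t1" "t2 / t0 = q * t2" using ex by (simp_all add: t0_def)
    have "c * (A * B powr a) = A powr (q * t1 + q * t2 + 1) * B powr (a * (q * t1) + a)"
      using A B by (simp add: c_def tq powr_mult powr_powr powr_add mult_ac)
    also have "q * t1 + q * t2 + 1 = q"
      using t(4) ex by (simp add: t0_def field_simps)
    also have "a * (q * t1) + a = q"
      using ex by (simp add: t1_def field_simps)
    finally show ?thesis using A B by (simp add: powr_mult)
  qed
  finally show ?thesis .
qed

section \<open>Bounds in Lebesgue spaces with exponent in [1,\<infinity>]\<close>

text \<open>
The statement that the \<open>L\<^sup>q\<close> norm of \<open>H\<close> is at most \<open>B\<close>, for a function that may take the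
value \<open>\<infinity>\<close>; it covers \<open>q = \<infinity>\<close> on the same footing.
\<close>

definition Lq_bound :: "ereal \<Rightarrow> (real^'n \<Rightarrow> ennreal) \<Rightarrow> real \<Rightarrow> bool" where
  "Lq_bound q H B \<longleftrightarrow>
     (if q = \<infinity> then AE x in lborel. H x \<le> ennreal B
      else (\<integral>\<^sup>+x. epowr (H x) (real_of_ereal q) \<partial>lborel) \<le> ennreal (B powr real_of_ereal q))"

lemma ereal_exponent_cases:
  fixes q :: ereal
  assumes "1 \<le> q"
  obtains "q = \<infinity>" | q' where "q = ereal q'" "1 \<le> q'"
  using assms by (cases q) auto

lemma Lq_bound_mono:
  assumes q: "1 \<le> q" and "Lq_bound q H B" "B \<le> B'" "0 \<le> B" and H: "AE x in lborel. H' x \<le> H x"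
  shows "Lq_bound q H' B'"
  using q
proof (cases q rule: ereal_exponent_cases)
  case 1
  with assms(2) have "AE x in lborel. H x \<le> ennreal B" by (simp add: Lq_bound_def)
  with H have "AE x in lborel. H' x \<le> ennreal B'"
    by eventually_elim (meson assms(3) ennreal_leI order_trans)
  with 1 show ?thesis by (simp add: Lq_bound_def)
next
  case (2 q')
  have "(\<integral>\<^sup>+x. epowr (H' x) q' \<partial>lborel) \<le> (\<integral>\<^sup>+x. epowr (H x) q' \<partial>lborel)"
    using H 2 by (intro nn_integral_mono_AE) (auto elim!: eventually_mono intro: epowr_mono)
  also have "\<dots> \<le> ennreal (B powr q')" using assms(2) 2 by (simp add: Lq_bound_def)
  also have "\<dots> \<le> ennreal (B' powr q')" using assms(3,4) 2 by (intro ennreal_leI powr_mono2) auto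
  finally show ?thesis using 2 by (simp add: Lq_bound_def)
qed

lemma Lq_bound_imp_AE_finite:
  assumes q: "1 \<le> q" and [measurable]: "H \<in> borel_measurable lborel" and "Lq_bound q H B"
  shows "AE x in lborel. H x < \<top>"
  using q
proof (cases q rule: ereal_exponent_cases)
  case 1
  with assms have "AE x in lborel. H x \<le> ennreal B" by (simp add: Lq_bound_def)
  then show ?thesis by eventually_elim (auto simp: le_less_trans)
next
  case (2 q')
  have "(\<integral>\<^sup>+x. epowr (H x) q' \<partial>lborel) \<le> ennreal (B powr q')"
    using assms 2 by (simp add: Lq_bound_def)
  then have "(\<integral>\<^sup>+x. epowr (H x) q' \<partial>lborel) \<noteq> \<infinity>" by (auto simp: top_unique)
  then have "AE x in lborel. epowr (H x) q' \<noteq> \<infinity>"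
    by (intro nn_integral_noteq_infinite) auto
  then show ?thesis by eventually_elim (auto simp: epowr_def less_top split: if_splits)
qed

lemma powr_add_le:
  fixes x y r :: real
  assumes "0 \<le> x" "0 \<le> y" "0 \<le> r"
  shows "(x + y) powr r \<le> 2 powr r * (x powr r + y powr r)"
proof -
  have "(x + y) powr r \<le> (2 * max x y) powr r" using assms by (intro powr_mono2) auto
  also have "\<dots> = 2 powr r * max x y powr r" using assms by (simp add: powr_mult)
  also have "\<dots> \<le> 2 powr r * (x powr r + y powr r)" by (intro mult_left_mono) (auto simp: max_def)
  finally show ?thesis .
qed

text \<open>
The sharp constant is \<open>1\<close> instead of \<open>2\<close>. A quasi-triangle inequality is all that a
continuity argument requires, and it follows from a pointwise inequality.
\<close>

lemma Lq_bound_add: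
  assumes q: "1 \<le> q" and [measurable]: "H1 \<in> borel_measurable lborel" "H2 \<in> borel_measurable lborel"
    and b: "Lq_bound q H1 B1" "Lq_bound q H2 B2" "0 \<le> B1" "0 \<le> B2"
  shows "Lq_bound q (\<lambda>x. H1 x + H2 x) (2 * (B1 + B2))"
  using q
proof (cases q rule: ereal_exponent_cases)
  case 1
  with b have "AE x in lborel. H1 x \<le> ennreal B1" "AE x in lborel. H2 x \<le> ennreal B2"
    by (simp_all add: Lq_bound_def)
  then have "AE x in lborel. H1 x + H2 x \<le> ennreal (2 * (B1 + B2))"
  proof eventually_elim
    case (elim x)
    have "H1 x + H2 x \<le> ennreal (B1 + B2)" using elim b by (simp add: add_mono)
    also have "\<dots> \<le> ennreal (2 * (B1 + B2))" using b by (intro ennreal_leI) auto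
    finally show ?case .
  qed
  with 1 show ?thesis by (simp add: Lq_bound_def)
next
  case (2 q')
  have pt: "epowr (h1 + h2) q' \<le> ennreal (2 powr q') * (epowr h1 q' + epowr h2 q')" for h1 h2 :: ennreal
  proof (cases "h1 = \<top> \<or> h2 = \<top>")
    case True
    then show ?thesis by (auto simp: epowr_def ennreal_mult_top)
  next
    case False
    then obtain a1 a2 where a: "h1 = ennreal a1" "0 \<le> a1" "h2 = ennreal a2" "0 \<le> a2"
      by (metis ennreal_cases)
    have "(a1 + a2) powr q' \<le> 2 powr q' * (a1 powr q' + a2 powr q')"
      using a 2 by (intro powr_add_le) auto
    then show ?thesis using a by (simp flip: ennreal_plus ennreal_mult add: ennreal_leI)
  qed
  have "(\<integral>\<^sup>+x. epowr (H1 x + H2 x) q' \<partial>lborel) \<le> (\<integral>\<^sup>+x. ennreal (2 powr q') * (epowr (H1 x) q' + epowr (H2 x) q') \<partial>lborel)"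
    by (intro nn_integral_mono pt)
  also have "\<dots> = ennreal (2 powr q') * ((\<integral>\<^sup>+x. epowr (H1 x) q' \<partial>lborel) + (\<integral>\<^sup>+x. epowr (H2 x) q' \<partial>lborel))"
    by (simp add: nn_integral_cmult nn_integral_add)
  also have "\<dots> \<le> ennreal (2 powr q') * (ennreal (B1 powr q') + ennreal (B2 powr q'))"
    using b 2 by (intro mult_left_mono add_mono) (auto simp: Lq_bound_def)
  also have "\<dots> = ennreal (2 powr q' * (B1 powr q' + B2 powr q'))"
    by (simp flip: ennreal_plus ennreal_mult)
  also have "\<dots> \<le> ennreal ((2 * (B1 + B2)) powr q')"
  proof (rule ennreal_leI)
    have "B1 powr q' + B2 powr q' \<le> (B1 + B2) powr q'"
    proof (cases "B1 + B2 = 0")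
      case True
      then have "B1 = 0" "B2 = 0" using b by auto
      then show ?thesis by simp
    next
      case False
      then have s: "0 < B1 + B2" using b by linarith
      have pw: "x powr q' \<le> x" if "0 \<le> x" "x \<le> 1" for x :: real
        using powr_mono'[of 1 q' x] that 2 by simp
      have "(B1 / (B1 + B2)) powr q' + (B2 / (B1 + B2)) powr q' \<le> B1 / (B1 + B2) + B2 / (B1 + B2)"
        using b s by (intro add_mono pw) auto
      also have "\<dots> = 1" using s by (simp add: add_divide_distrib[symmetric])
      finally show ?thesis using b s by (simp add: powr_divide add_divide_distrib[symmetric])
    qed
    then show "2 powr q' * (B1 powr q' + B2 powr q') \<le> (2 * (B1 + B2)) powr q'"
      using b by (subst powr_mult) auto
  qed
  finally show ?thesis using 2 by (simp add: Lq_bound_def)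
qed

lemma in_Lq_imp_bound:
  fixes f :: "real^'n \<Rightarrow> real"
  assumes q: "1 \<le> q" and f: "in_Lq q f"
  shows "f \<in> borel_measurable borel" "0 \<le> Lq_norm q f" "Lq_bound q (\<lambda>x. ennreal \<bar>f x\<bar>) (Lq_norm q f)"
proof -
  show [measurable]: "f \<in> borel_measurable borel" using f by (simp add: in_Lq_def)
  have "0 \<le> Lq_norm q f \<and> Lq_bound q (\<lambda>x. ennreal \<bar>f x\<bar>) (Lq_norm q f)"
    using q
  proof (cases q rule: ereal_exponent_cases)
    case 1
    let ?e = "esssup lborel (\<lambda>x. ereal \<bar>f x\<bar>)"
    have "esssup (lborel :: (real^'n) measure) (\<lambda>x. 0 :: ereal) \<le> ?e" by (rule esssup_mono) auto
    then have e0: "0 \<le> ?e" by (subst (asm) esssup_const) auto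
    moreover have "?e < \<infinity>" using f 1 by (simp add: in_Lq_def)
    ultimately obtain e where e: "?e = ereal e" "0 \<le> e" by (cases ?e) auto
    have "AE x in lborel. ereal \<bar>f x\<bar> \<le> ?e" by (rule esssup_AE)
    then have "AE x in lborel. ennreal \<bar>f x\<bar> \<le> ennreal e"
      by eventually_elim (simp add: e ennreal_leI)
    then show ?thesis using 1 e by (simp add: Lq_norm_def Lq_bound_def)
  next
    case (2 q')
    have i: "integrable lborel (\<lambda>x. \<bar>f x\<bar> powr q')" using f 2 by (simp add: in_Lq_def)
    let ?I = "LINT x|lborel. \<bar>f x\<bar> powr q'"
    have I: "0 \<le> ?I" by (rule integral_nonneg_AE) auto
    have "(\<integral>\<^sup>+x. ennreal (\<bar>f x\<bar> powr q') \<partial>lborel) = ennreal ?I"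
      using i by (intro nn_integral_eq_integral) auto
    moreover have "(?I powr (1 / q')) powr q' = ?I" using I 2 by (simp add: powr_powr)
    ultimately show ?thesis using 2 by (simp add: Lq_norm_def Lq_bound_def)
  qed
  then show "0 \<le> Lq_norm q f" "Lq_bound q (\<lambda>x. ennreal \<bar>f x\<bar>) (Lq_norm q f)" by auto
qed

lemma Lq_bound_imp_in_Lq:
  fixes f :: "real^'n \<Rightarrow> real"
  assumes q: "1 \<le> q" and [measurable]: "f \<in> borel_measurable borel"
    and b: "Lq_bound q (\<lambda>x. ennreal \<bar>f x\<bar>) B" "0 \<le> B"
  shows "in_Lq q f" "Lq_norm q f \<le> B"
proof -
  have "in_Lq q f \<and> Lq_norm q f \<le> B"
    using q
  proof (cases q rule: ereal_exponent_cases)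
    case 1
    have "AE x in lborel. ennreal \<bar>f x\<bar> \<le> ennreal B" using b 1 by (simp add: Lq_bound_def)
    then have "AE x in lborel. ereal \<bar>f x\<bar> \<le> ereal B"
      by eventually_elim (use b in simp)
    then have e: "esssup lborel (\<lambda>x. ereal \<bar>f x\<bar>) \<le> ereal B" by (intro esssup_I) auto
    then have "esssup lborel (\<lambda>x. ereal \<bar>f x\<bar>) < \<infinity>" by (auto simp: le_less_trans)
    moreover have "real_of_ereal (esssup lborel (\<lambda>x. ereal \<bar>f x\<bar>)) \<le> B"
      using e b by (cases "esssup lborel (\<lambda>x. ereal \<bar>f x\<bar>)") auto
    ultimately show ?thesis using 1 by (simp add: in_Lq_def Lq_norm_def)
  next
    case (2 q')
    have nn: "(\<integral>\<^sup>+x. ennreal (\<bar>f x\<bar> powr q') \<partial>lborel) \<le> ennreal (B powr q')"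
      using b 2 by (simp add: Lq_bound_def)
    then have i: "integrable lborel (\<lambda>x. \<bar>f x\<bar> powr q')"
      by (intro integrableI_nonneg) (auto simp: le_less_trans)
    let ?I = "LINT x|lborel. \<bar>f x\<bar> powr q'"
    have I: "0 \<le> ?I" by (rule integral_nonneg_AE) auto
    have "ennreal ?I \<le> ennreal (B powr q')"
      using nn i by (subst (asm) nn_integral_eq_integral) auto
    then have "?I \<le> B powr q'" by (simp add: ennreal_le_iff)
    then have "?I powr (1 / q') \<le> (B powr q') powr (1 / q')"
      using I 2 by (intro powr_mono2) auto
    also have "\<dots> = B" using b 2 by (simp add: powr_powr)
    finally show ?thesis using 2 i by (simp add: in_Lq_def Lq_norm_def)
  qed
  then show "in_Lq q f" "Lq_norm q f \<le> B" by auto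
qed

text \<open>
The relation \<open>1/a + 1/r = 1 + 1/q\<close> of Young's inequality. For \<open>q = \<infinity>\<close> it is restricted to the
endpoint \<open>a = \<infinity>\<close>, \<open>r = 1\<close>: bounded data need not belong to \<open>L\<^sup>a\<close> for any finite \<open>a\<close>.
\<close>

definition young_exponents :: "ereal \<Rightarrow> ereal \<Rightarrow> real \<Rightarrow> bool" where
  "young_exponents q a r \<longleftrightarrow> (q = \<infinity> \<and> a = \<infinity> \<and> r = 1) \<or>
     (\<exists>q' a'. q = ereal q' \<and> a = ereal a' \<and> 1 \<le> a' \<and> 1 \<le> r \<and> 0 < q' \<and> 1 / a' + 1 / r = 1 + 1 / q')"

lemma young_Lq_bound:
  fixes F K :: "'i \<Rightarrow> real^'n \<Rightarrow> real" and \<kappa> :: "'i \<Rightarrow> real"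
  assumes sf: "sigma_finite_measure \<mu>"
    and Fm: "(\<lambda>(i, y). F i y) \<in> borel_measurable (\<mu> \<Otimes>\<^sub>M lborel)"
    and Km: "(\<lambda>(i, y). K i y) \<in> borel_measurable (\<mu> \<Otimes>\<^sub>M lborel)"
    and \<kappa>[measurable]: "\<kappa> \<in> borel_measurable \<mu>"
    and nn: "\<And>i y. 0 \<le> F i y" "\<And>i y. 0 \<le> K i y" "\<And>i. 0 \<le> \<kappa> i"
    and z: "\<And>i y. \<kappa> i = 0 \<Longrightarrow> K i y = 0"
    and F: "AE i in \<mu>. Lq_bound a (\<lambda>y. ennreal (F i y)) B"
    and K: "\<And>i. (\<integral>\<^sup>+y. ennreal (K i y powr r) \<partial>lborel) \<le> ennreal (\<kappa> i powr r)"
    and A: "(\<integral>\<^sup>+i. ennreal (\<kappa> i) \<partial>\<mu>) \<le> ennreal A" "0 < A" and B: "0 < B"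
    and ex: "young_exponents q a r"
  shows "Lq_bound q (\<lambda>x. \<integral>\<^sup>+z. ennreal (F (fst z) (snd z) * K (fst z) (x - snd z)) \<partial>(\<mu> \<Otimes>\<^sub>M lborel)) (A * B)"
proof -
  from ex consider "q = \<infinity>" "a = \<infinity>" "r = 1"
    | q' a' where "q = ereal q'" "a = ereal a'" "1 \<le> a'" "1 \<le> r" "0 < q'" "1 / a' + 1 / r = 1 + 1 / q'"
    unfolding young_exponents_def by blast
  then show ?thesis
  proof cases
    case 1
    interpret sigma_finite_measure \<mu> by (rule sf)
    interpret P: pair_sigma_finite \<mu> "lborel :: (real^'n) measure" ..
    have [measurable]: "(\<lambda>z. F (f z) (g z)) \<in> borel_measurable N" "(\<lambda>z. K (f z) (g z)) \<in> borel_measurable N"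
      if f: "f \<in> N \<rightarrow>\<^sub>M \<mu>" and g: "g \<in> N \<rightarrow>\<^sub>M borel" for f N and g :: "_ \<Rightarrow> real^'n"
    proof -
      have p: "(\<lambda>z. (f z, g z)) \<in> N \<rightarrow>\<^sub>M \<mu> \<Otimes>\<^sub>M lborel" using f g by measurable
      show "(\<lambda>z. F (f z) (g z)) \<in> borel_measurable N" "(\<lambda>z. K (f z) (g z)) \<in> borel_measurable N"
        using measurable_compose[OF p Fm] measurable_compose[OF p Km] by simp_all
    qed
    have "(\<integral>\<^sup>+z. ennreal (F (fst z) (snd z) * K (fst z) (x - snd z)) \<partial>(\<mu> \<Otimes>\<^sub>M lborel)) \<le> ennreal (A * B)" for x
    proof -
      have "(\<integral>\<^sup>+z. ennreal (F (fst z) (snd z) * K (fst z) (x - snd z)) \<partial>(\<mu> \<Otimes>\<^sub>M lborel))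
          = (\<integral>\<^sup>+i. \<integral>\<^sup>+y. ennreal (F i y * K i (x - y)) \<partial>lborel \<partial>\<mu>)"
        by (subst lborel.nn_integral_fst[symmetric]) auto
      also have "\<dots> \<le> (\<integral>\<^sup>+i. ennreal B * ennreal (\<kappa> i) \<partial>\<mu>)"
      proof (rule nn_integral_mono_AE)
        show "AE i in \<mu>. (\<integral>\<^sup>+y. ennreal (F i y * K i (x - y)) \<partial>lborel) \<le> ennreal B * ennreal (\<kappa> i)"
          using F AE_space
        proof eventually_elim
          case (elim i)
          have [measurable]: "(\<lambda>y. K i y) \<in> borel_measurable borel"
            using measurable_compose[OF measurable_Pair1'[OF elim(2)] Km] by simp
          have Fb: "AE y in lborel. F i y \<le> B"
          proof -
            have "AE y in lborel. ennreal (F i y) \<le> ennreal B" using elim(1) 1 by (simp add: Lq_bound_def)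
            then show ?thesis by eventually_elim (use B in simp)
          qed
          have "(\<integral>\<^sup>+y. ennreal (F i y * K i (x - y)) \<partial>lborel) \<le> (\<integral>\<^sup>+y. ennreal B * ennreal (K i (x - y)) \<partial>lborel)"
            using Fb
            by (intro nn_integral_mono_AE)
               (auto elim!: eventually_mono intro!: ennreal_leI mult_right_mono simp: nn B less_imp_le simp flip: ennreal_mult)
          also have "\<dots> = ennreal B * (\<integral>\<^sup>+y. ennreal (K i (x - y)) \<partial>lborel)"
            by (rule nn_integral_cmult) measurable
          also have "(\<integral>\<^sup>+y. ennreal (K i (x - y)) \<partial>lborel) = (\<integral>\<^sup>+y. ennreal (K i y) \<partial>lborel)"
            by (rule nn_integral_reflect_translate) measurable
          also have "\<dots> \<le> ennreal (\<kappa> i)" using K[of i] nn 1 by simp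
          finally show ?case by (simp add: mult_left_mono)
        qed
      qed
      also have "\<dots> = ennreal B * (\<integral>\<^sup>+i. ennreal (\<kappa> i) \<partial>\<mu>)" by (rule nn_integral_cmult) measurable
      also have "\<dots> \<le> ennreal B * ennreal A" by (intro mult_left_mono A) auto
      also have "\<dots> = ennreal (A * B)" using A B by (simp add: mult.commute flip: ennreal_mult)
      finally show ?thesis .
    qed
    then show ?thesis using 1 by (simp add: Lq_bound_def)
  next
    case 2
    have F': "AE i in \<mu>. (\<integral>\<^sup>+y. ennreal (F i y powr a') \<partial>lborel) \<le> ennreal (B powr a')"
      using F 2 nn by (auto simp: Lq_bound_def elim!: eventually_mono)
    show ?thesis
      using young_nn[OF sf Fm Km \<kappa> nn z F' K A B 2(3-6)] 2 by (simp add: Lq_bound_def)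
  qed
qed

section \<open>Mixtures of heat kernels\<close>

text \<open>
Away from the origin the heat kernel is bounded uniformly in time: in terms of
\<open>u = (norm x)\<^sup>2 / (4 * \<theta>)\<close> it is a multiple of \<open>u powr (N / 2) * exp (- u)\<close>.
\<close>

lemma heat_kernel_le_at:
  fixes x :: "real^'n"
  assumes x: "x \<noteq> 0"
  shows "\<exists>C. \<forall>\<theta>>0. heat_kernel \<theta> x \<le> C"
proof -
  define s where "s = real CARD('n) / 2"
  have s: "0 < s" by (simp add: s_def)
  define R where "R = pi * (norm x)\<^sup>2"
  have R: "0 < R" using x by (simp add: R_def)
  have "heat_kernel \<theta> x \<le> R powr (- s) * exp (s * ln s - s)" if t: "0 < \<theta>" for \<theta>
  proof -
    define u where "u = (norm x)\<^sup>2 / (4 * \<theta>)"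
    have u: "0 < u" using x t by (simp add: u_def)
    have "4 * pi * \<theta> = R / u" using x t by (simp add: R_def u_def)
    moreover have "heat_kernel \<theta> x = (4 * pi * \<theta>) powr (- s) * exp (- u)"
      by (simp add: heat_kernel_def s_def u_def)
    moreover have "(R / u) powr (- s) = R powr (- s) * u powr s"
      using R u by (simp add: powr_divide powr_minus_divide)
    ultimately have "heat_kernel \<theta> x = R powr (- s) * (u powr s * exp (- u))" by simp
    also have "u powr s * exp (- u) \<le> exp (s * ln s - s)"
    proof -
      have "ln (u / s) \<le> u / s - 1" using u s by (intro ln_le_minus_one) auto
      then have "s * ln (u / s) \<le> s * (u / s - 1)" using s by (intro mult_left_mono) auto
      then have "s * ln u - u \<le> s * ln s - s" using u s by (simp add: ln_div algebra_simps)
      then show ?thesis using u by (simp add: powr_def flip: exp_add)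
    qed
    finally show ?thesis using R by (simp add: mult_left_mono)
  qed
  then show ?thesis by blast
qed

lemma heat_kernel_double:
  fixes x :: "real^'n"
  assumes "0 < \<theta>"
  shows "2 powr (real CARD('n) / 2) * heat_kernel (2 * \<theta>) x
    = (4 * pi * \<theta>) powr (- (real CARD('n) / 2)) * exp (- ((norm x)\<^sup>2 / (4 * \<theta>)) / 2)"
proof -
  have "(4 * pi * (2 * \<theta>)) powr (- (real CARD('n) / 2)) = 2 powr (- (real CARD('n) / 2)) * (4 * pi * \<theta>) powr (- (real CARD('n) / 2))"
    using assms by (subst powr_mult[symmetric]) (auto simp: mult_ac)
  then show ?thesis
    by (simp add: heat_kernel_def powr_minus field_simps)
qed

lemma heat_kernel_le_double:
  fixes x :: "real^'n"
  assumes "0 < \<theta>"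
  shows "heat_kernel \<theta> x \<le> 2 powr (real CARD('n) / 2) * heat_kernel (2 * \<theta>) x"
  unfolding heat_kernel_double[OF assms] using assms
  by (auto simp: heat_kernel_def intro!: mult_left_mono divide_left_mono)

text \<open>
At a fixed point, a heat kernel at time \<open>t powr b * \<theta>\<close> times a power of \<open>t\<close> is a multiple of
\<open>t powr (- e) * exp (- (z * t powr (- b)))\<close>. Its increments are bounded by the same profile with half
the exponent: one half of the exponential absorbs the factor \<open>z * t powr (- b)\<close> that appears on
varying the exponent. The relative increment \<open>h = (t - s) / s\<close> first enters as \<open>min 1 h\<close>, which is
at most \<open>h powr \<epsilon>\<close>.
\<close>

lemma time_profile_difference:
  fixes e b z s t \<epsilon> :: real
  assumes st: "0 < s" "s < t" and eb: "0 \<le> e" "0 \<le> b" and z: "0 \<le> z" and \<epsilon>: "0 \<le> \<epsilon>" "\<epsilon> \<le> 1"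
  shows "\<bar>t powr (- e) * exp (- (z * t powr (- b))) - s powr (- e) * exp (- (z * s powr (- b)))\<bar>
    \<le> (1 + e + 2 * b) * ((t - s) / s) powr \<epsilon> *
      (s powr (- e) * exp (- (z * s powr (- b)) / 2) + t powr (- e) * exp (- (z * t powr (- b)) / 2))"
proof -
  define h where "h = (t - s) / s"
  have h: "0 < h" "t = s * (1 + h)" using st by (simp_all add: h_def field_simps)
  define m where "m = min 1 h"
  have m: "0 < m" "m \<le> h powr \<epsilon>"
  proof -
    show "0 < m" using h by (simp add: m_def)
    show "m \<le> h powr \<epsilon>"
    proof (cases "h \<le> 1")
      case True
      then show ?thesis using powr_mono'[of \<epsilon> 1 h] h \<epsilon> by (simp add: m_def)
    next
      case False
      then show ?thesis using ge_one_powr_ge_zero[of h \<epsilon>] \<epsilon> by (simp add: m_def)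
    qed
  qed
  have lnh: "0 \<le> ln (1 + h)" "ln (1 + h) \<le> h" using h ln_add_one_self_le_self[of h] by auto
  have tp: "t powr k = s powr k * (1 + h) powr k" for k using st h by (simp add: powr_mult)
  define y where "y = z * t powr (- b)"
  have y: "0 \<le> y" using z by (simp add: y_def)
  define d where "d = (1 + h) powr b - 1"
  have d: "0 \<le> d" using h eb ge_one_powr_ge_zero[of "1 + h" b] by (simp add: d_def)
  have zs: "z * s powr (- b) = y * (1 + d)"
  proof -
    have "(1 + h) powr (- b) * (1 + h) powr b = 1" using h by (simp add: powr_add[symmetric])
    moreover have "y * (1 + d) = z * s powr (- b) * ((1 + h) powr (- b) * (1 + h) powr b)"
      unfolding y_def d_def tp by simp
    ultimately show ?thesis by simp
  qed
  define E where "E = exp (- y)"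
  define E' where "E' = exp (- y / 2)"
  define F where "F = exp (- (z * s powr (- b)))"
  define F' where "F' = exp (- (z * s powr (- b)) / 2)"
  have pos: "0 \<le> E" "0 \<le> E'" "0 \<le> F" "0 \<le> F'" by (simp_all add: E_def E'_def F_def F'_def)
  have EE: "E \<le> E'" "F \<le> F'" using y z by (simp_all add: E_def E'_def F_def F'_def)
  \<comment> \<open>\<open>y \<le> (1 + y / 4)\<^sup>2 \<le> exp (y / 2)\<close>\<close>
  have yE: "y * E \<le> E'"
  proof -
    have "0 \<le> (1 - y / 4)\<^sup>2" by simp
    then have "y \<le> (1 + y / 4)\<^sup>2" by (simp add: power2_eq_square algebra_simps)
    also have "\<dots> \<le> (exp (y / 4))\<^sup>2" using y exp_ge_add_one_self[of "y / 4"] by (intro power_mono) auto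
    also have "\<dots> = exp (y / 2)" by (simp add: exp_double[symmetric])
    finally have "y * exp (- y) \<le> exp (y / 2) * exp (- y)" by (intro mult_right_mono) auto
    also have "\<dots> = exp (- y / 2)" by (simp flip: exp_add)
    finally show ?thesis by (simp add: E_def E'_def)
  qed
  have FE: "F = E * exp (- (y * d))" by (simp add: F_def E_def zs flip: exp_add) (simp add: algebra_simps)
  have yd: "0 \<le> y * d" using y d by simp
  have le1: "F \<le> E" unfolding FE using pos yd by (simp add: mult_left_le)
  have diff1: "E - F \<le> min 1 d * E'"
  proof -
    have a: "E - F = E * (1 - exp (- (y * d)))" by (simp add: FE algebra_simps)
    have "E - F \<le> E'" using EE pos by linarith
    moreover have "E - F \<le> d * E'"
    proof -
      have "E * (1 - exp (- (y * d))) \<le> E * (y * d)"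
        using pos exp_ge_add_one_self[of "- (y * d)"] by (intro mult_left_mono) auto
      also have "\<dots> = d * (y * E)" by simp
      also have "\<dots> \<le> d * E'" using d yE by (intro mult_left_mono)
      finally show ?thesis by (simp add: a)
    qed
    ultimately show ?thesis by (simp add: min_def)
  qed
  have dm: "min 1 d \<le> (1 + 2 * b) * m"
  proof (cases "h \<le> 1")
    case False
    then show ?thesis using eb by (simp add: m_def)
  next
    case True
    define w where "w = b * ln (1 + h)"
    have w: "0 \<le> w" "w \<le> b * h" using eb lnh by (auto simp: w_def mult_left_mono)
    have dw: "d = exp w - 1" using h by (simp add: d_def w_def powr_def)
    have "min 1 d \<le> 2 * w"
    proof (cases "w \<le> 1")
      case True
      then have "exp w \<le> 1 + w + w\<^sup>2" using w by (intro exp_bound) auto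
      moreover have "w\<^sup>2 \<le> w" using True w by (simp add: power2_eq_square mult_left_le)
      ultimately show ?thesis by (simp add: dw)
    qed auto
    also have "\<dots> \<le> 2 * (b * h)" using w by simp
    also have "\<dots> \<le> (1 + 2 * b) * m" using True h by (simp add: m_def algebra_simps)
    finally show ?thesis .
  qed
  have diff2: "s powr (- e) - t powr (- e) \<le> s powr (- e) * ((1 + e) * m)"
  proof -
    have "1 - (1 + h) powr (- e) \<le> e * h"
    proof -
      have "1 + (- e * ln (1 + h)) \<le> exp (- e * ln (1 + h))" by (rule exp_ge_add_one_self)
      then have "1 - (1 + h) powr (- e) \<le> e * ln (1 + h)" using h by (simp add: powr_def)
      also have "\<dots> \<le> e * h" using eb lnh by (intro mult_left_mono)
      finally show ?thesis .
    qed
    then have "1 - (1 + h) powr (- e) \<le> (1 + e) * m"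
    proof (cases "h \<le> 1")
      case True
      with \<open>1 - (1 + h) powr (- e) \<le> e * h\<close> h show ?thesis by (simp add: m_def algebra_simps)
    next
      case False
      have "1 - (1 + h) powr (- e) \<le> 1 + e" using eb powr_ge_zero[of "1 + h" "- e"] by linarith
      then show ?thesis using False by (simp add: m_def)
    qed
    then have "s powr (- e) * (1 - (1 + h) powr (- e)) \<le> s powr (- e) * ((1 + e) * m)"
      by (intro mult_left_mono) auto
    then show ?thesis by (simp add: tp algebra_simps)
  qed
  have mono: "t powr (- e) \<le> s powr (- e)" using st eb by (intro powr_mono2') auto
  have "\<bar>t powr (- e) * E - s powr (- e) * F\<bar> \<le> t powr (- e) * (E - F) + (s powr (- e) - t powr (- e)) * F"
  proof -
    have "t powr (- e) * E - s powr (- e) * F = t powr (- e) * (E - F) - (s powr (- e) - t powr (- e)) * F"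
      by (simp add: algebra_simps)
    moreover have "0 \<le> t powr (- e) * (E - F)" using le1 by simp
    moreover have "0 \<le> (s powr (- e) - t powr (- e)) * F" using mono pos by simp
    ultimately show ?thesis by linarith
  qed
  also have "\<dots> \<le> t powr (- e) * ((1 + 2 * b) * m * E') + s powr (- e) * ((1 + e) * m) * F'"
  proof (intro add_mono mult_left_mono mult_mono)
    show "E - F \<le> (1 + 2 * b) * m * E'"
      using diff1 mult_right_mono[OF dm pos(2)] by linarith
  qed (use diff2 EE pos m eb in auto)
  also have "\<dots> \<le> t powr (- e) * ((1 + e + 2 * b) * m * E') + s powr (- e) * ((1 + e + 2 * b) * m) * F'"
  proof (rule add_mono)
    show "t powr (- e) * ((1 + 2 * b) * m * E') \<le> t powr (- e) * ((1 + e + 2 * b) * m * E')"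
      using eb m pos by (intro mult_left_mono mult_right_mono) auto
    show "s powr (- e) * ((1 + e) * m) * F' \<le> s powr (- e) * ((1 + e + 2 * b) * m) * F'"
      using eb m pos by (intro mult_left_mono mult_right_mono) auto
  qed
  also have "\<dots> = (1 + e + 2 * b) * m * (s powr (- e) * F' + t powr (- e) * E')"
    by (simp add: algebra_simps)
  also have "\<dots> \<le> (1 + e + 2 * b) * h powr \<epsilon> * (s powr (- e) * F' + t powr (- e) * E')"
    using eb m pos by (intro mult_right_mono mult_left_mono) auto
  finally show ?thesis
    by (simp add: E_def E'_def F_def F'_def y_def h_def)
qed

lemma heat_kernel_time_difference:
  fixes x :: "real^'n" and c b \<theta> \<epsilon> s t :: real
  defines "D \<equiv> \<lambda>t. 2 powr (real CARD('n) / 2) * (t powr c * heat_kernel (2 * (t powr b * \<theta>)) x)"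
  assumes st: "0 < s" "s < t" and b: "0 \<le> b" and c: "c \<le> b * real CARD('n) / 2"
    and \<theta>: "0 < \<theta>" and \<epsilon>: "0 \<le> \<epsilon>" "\<epsilon> \<le> 1"
  shows "\<bar>t powr c * heat_kernel (t powr b * \<theta>) x - s powr c * heat_kernel (s powr b * \<theta>) x\<bar>
    \<le> (1 + (b * real CARD('n) / 2 - c) + 2 * b) * ((t - s) / s) powr \<epsilon> * (D s + D t)"
proof -
  define e where "e = b * real CARD('n) / 2 - c"
  define z where "z = (norm x)\<^sup>2 / (4 * \<theta>)"
  define P where "P = (4 * pi * \<theta>) powr (- (real CARD('n) / 2))"
  have P: "0 \<le> P" by (simp add: P_def)
  have pw: "u powr c * (4 * pi * (u powr b * \<theta>)) powr (- (real CARD('n) / 2)) = P * u powr (- e)" if "0 < u" for u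
  proof -
    have "(4 * pi * (u powr b * \<theta>)) powr (- (real CARD('n) / 2)) = u powr (- (b * real CARD('n) / 2)) * P"
      using that \<theta> by (simp add: P_def powr_mult powr_powr)
    moreover have "u powr (- e) = u powr c * u powr (- (b * real CARD('n) / 2))"
      by (simp add: e_def powr_add[symmetric])
    ultimately show ?thesis by simp
  qed
  have zz: "(norm x)\<^sup>2 / (4 * (u powr b * \<theta>)) = z * u powr (- b)" for u
    by (simp add: z_def powr_minus field_simps)
  have h1: "u powr c * heat_kernel (u powr b * \<theta>) x = P * (u powr (- e) * exp (- (z * u powr (- b))))" if "0 < u" for u
    unfolding heat_kernel_def using pw[OF that] zz[of u] by (simp add: mult.assoc[symmetric])
  have h2: "D u = P * (u powr (- e) * exp (- (z * u powr (- b)) / 2))" if u: "0 < u" for u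
  proof -
    have "0 < u powr b * \<theta>" using u \<theta> by simp
    from heat_kernel_double[OF this, of x]
    have "D u = u powr c * ((4 * pi * (u powr b * \<theta>)) powr (- (real CARD('n) / 2)) * exp (- (z * u powr (- b)) / 2))"
      unfolding D_def zz[of u] by (simp add: mult.left_commute)
    then show ?thesis using pw[OF u] by (simp add: mult.assoc[symmetric])
  qed
  have st0: "0 < t" using st by simp
  have "\<bar>t powr c * heat_kernel (t powr b * \<theta>) x - s powr c * heat_kernel (s powr b * \<theta>) x\<bar>
     = P * \<bar>t powr (- e) * exp (- (z * t powr (- b))) - s powr (- e) * exp (- (z * s powr (- b)))\<bar>"
    unfolding h1[OF st(1)] h1[OF st0] using P by (simp add: abs_mult flip: right_diff_distrib)
  also have "\<dots> \<le> P * ((1 + e + 2 * b) * ((t - s) / s) powr \<epsilon> *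
      (s powr (- e) * exp (- (z * s powr (- b)) / 2) + t powr (- e) * exp (- (z * t powr (- b)) / 2)))"
    using st b c \<theta> \<epsilon> P by (intro mult_left_mono time_profile_difference) (auto simp: e_def z_def)
  also have "\<dots> = (1 + e + 2 * b) * ((t - s) / s) powr \<epsilon> * (D s + D t)"
    unfolding h2[OF st(1)] h2[OF st0] by (simp add: algebra_simps)
  finally show ?thesis by (simp add: e_def)
qed

text \<open>
For \<open>m = 1\<close>, \<open>b = \<alpha> / \<beta>\<close> and suitable \<open>\<nu>\<close> and \<open>c\<close> this is the kernel of the fractional equation; the
factor \<open>m = 2\<close> produces the majorants. The value at \<open>x = 0\<close> is set to \<open>0\<close> because the integral may
diverge there, and elsewhere it converges. With the value \<open>0\<close> for \<open>t \<le> 0\<close>, a Duhamel integral over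
\<open>(0, t)\<close> becomes one over all times.
\<close>

definition heat_mixture :: "real measure \<Rightarrow> real \<Rightarrow> real \<Rightarrow> real \<Rightarrow> real \<Rightarrow> real^'n \<Rightarrow> real" where
  "heat_mixture \<nu> m b c t x =
     (if t \<le> 0 \<or> x = 0 then 0 else t powr c * (\<integral>\<theta>. heat_kernel (m * (t powr b * \<theta>)) x \<partial>\<nu>))"

locale mixing_measure = finite_measure \<nu> for \<nu> :: "real measure" +
  assumes sets_nu [measurable_cong]: "sets \<nu> = sets borel"
    and pos_nu: "AE \<theta> in \<nu>. 0 < \<theta>"
begin

lemma heat_mixture_measurable [measurable]:
  assumes [measurable]: "f \<in> borel_measurable M" "g \<in> borel_measurable M"
  shows "(\<lambda>z. heat_mixture \<nu> m b c (f z) (g z :: real^'n)) \<in> borel_measurable M"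
proof -
  have [measurable]: "(\<lambda>z. \<integral>\<theta>. heat_kernel (m * (f z powr b * \<theta>)) (g z) \<partial>\<nu>) \<in> borel_measurable M"
    by (rule borel_measurable_lebesgue_integral) measurable
  show ?thesis unfolding heat_mixture_def by measurable
qed

lemma heat_mixture_nonneg [simp]: "0 \<le> heat_mixture \<nu> m b c t x"
  unfolding heat_mixture_def by (auto intro!: mult_nonneg_nonneg integral_nonneg_AE)

lemma heat_mixture_0 [simp]: "t \<le> 0 \<Longrightarrow> heat_mixture \<nu> m b c t x = 0"
  by (simp add: heat_mixture_def)

lemma integrable_heat_kernel_mixing:
  fixes x :: "real^'n"
  assumes "x \<noteq> 0" "0 < t" "0 < m"
  shows "integrable \<nu> (\<lambda>\<theta>. heat_kernel (m * (t powr b * \<theta>)) x)"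
proof -
  obtain C where "\<And>\<theta>. 0 < \<theta> \<Longrightarrow> heat_kernel \<theta> x \<le> C"
    using heat_kernel_le_at[OF assms(1)] by blast
  then have "AE \<theta> in \<nu>. norm (heat_kernel (m * (t powr b * \<theta>)) x) \<le> C"
    using pos_nu assms by (auto elim!: eventually_mono)
  then show ?thesis by (rule integrable_const_bound) measurable
qed

lemma heat_mixture_le:
  fixes x :: "real^'n"
  shows "heat_mixture \<nu> 1 b c t x \<le> 2 powr (real CARD('n) / 2) * heat_mixture \<nu> 2 b c t x"
proof (cases "t \<le> 0 \<or> x = 0")
  case False
  then have p: "0 < t" "x \<noteq> 0" by auto
  have "(\<integral>\<theta>. heat_kernel (1 * (t powr b * \<theta>)) x \<partial>\<nu>)
      \<le> (\<integral>\<theta>. 2 powr (real CARD('n) / 2) * heat_kernel (2 * (t powr b * \<theta>)) x \<partial>\<nu>)"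
  proof (rule integral_mono_AE)
    show "AE \<theta> in \<nu>. heat_kernel (1 * (t powr b * \<theta>)) x \<le> 2 powr (real CARD('n) / 2) * heat_kernel (2 * (t powr b * \<theta>)) x"
      using pos_nu by eventually_elim (use p in \<open>auto intro!: heat_kernel_le_double\<close>)
    show "integrable \<nu> (\<lambda>\<theta>. heat_kernel (1 * (t powr b * \<theta>)) x)"
      using p by (intro integrable_heat_kernel_mixing) auto
    show "integrable \<nu> (\<lambda>\<theta>. 2 powr (real CARD('n) / 2) * heat_kernel (2 * (t powr b * \<theta>)) x)"
      using p by (intro integrable_mult_right integrable_heat_kernel_mixing) auto
  qed
  then have "t powr c * (\<integral>\<theta>. heat_kernel (1 * (t powr b * \<theta>)) x \<partial>\<nu>) \<le>
      t powr c * (2 powr (real CARD('n) / 2) * (\<integral>\<theta>. heat_kernel (2 * (t powr b * \<theta>)) x \<partial>\<nu>))"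
    by (intro mult_left_mono) auto
  then show ?thesis using False by (simp add: heat_mixture_def mult.left_commute)
qed (auto simp: heat_mixture_def)

lemma heat_mixture_difference:
  fixes x :: "real^'n"
  assumes st: "0 < s" "s < t" and b: "0 \<le> b" and c: "c \<le> b * real CARD('n) / 2"
    and \<epsilon>: "0 \<le> \<epsilon>" "\<epsilon> \<le> 1"
  shows "\<bar>heat_mixture \<nu> 1 b c t x - heat_mixture \<nu> 1 b c s x\<bar>
    \<le> (1 + (b * real CARD('n) / 2 - c) + 2 * b) * ((t - s) / s) powr \<epsilon> *
      (2 powr (real CARD('n) / 2) * (heat_mixture \<nu> 2 b c s x + heat_mixture \<nu> 2 b c t x))"
proof (cases "x = 0")
  case False
  have t: "0 < t" using st by simp
  define k where "k = (1 + (b * real CARD('n) / 2 - c) + 2 * b) * ((t - s) / s) powr \<epsilon>"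
  define N2 where "N2 = 2 powr (real CARD('n) / 2)"
  let ?h = "\<lambda>m u \<theta>. u powr c * heat_kernel (m * (u powr b * \<theta>)) x"
  have int: "integrable \<nu> (?h m u)" if "0 < u" "0 < m" for m u
    using False that by (intro integrable_mult_right integrable_heat_kernel_mixing) auto
  have mix: "heat_mixture \<nu> m b c u x = (\<integral>\<theta>. ?h m u \<theta> \<partial>\<nu>)" if "0 < u" for m u
    using False that by (simp add: heat_mixture_def)
  have "\<bar>heat_mixture \<nu> 1 b c t x - heat_mixture \<nu> 1 b c s x\<bar> = \<bar>\<integral>\<theta>. ?h 1 t \<theta> - ?h 1 s \<theta> \<partial>\<nu>\<bar>"
    unfolding mix[OF t] mix[OF st(1)]
    by (subst Bochner_Integration.integral_diff[OF int[OF t zero_less_one] int[OF st(1) zero_less_one]]) (rule refl)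
  also have "\<dots> \<le> (\<integral>\<theta>. \<bar>?h 1 t \<theta> - ?h 1 s \<theta>\<bar> \<partial>\<nu>)"
    by (rule integral_abs_bound)
  also have "\<dots> \<le> (\<integral>\<theta>. k * (N2 * ?h 2 s \<theta> + N2 * ?h 2 t \<theta>) \<partial>\<nu>)"
  proof (rule integral_mono_AE)
    show "AE \<theta> in \<nu>. \<bar>?h 1 t \<theta> - ?h 1 s \<theta>\<bar> \<le> k * (N2 * ?h 2 s \<theta> + N2 * ?h 2 t \<theta>)"
      using pos_nu
    proof eventually_elim
      case (elim \<theta>)
      show ?case
        using heat_kernel_time_difference[OF st b c elim \<epsilon>, of x] by (simp add: k_def N2_def)
    qed
    show "integrable \<nu> (\<lambda>\<theta>. \<bar>?h 1 t \<theta> - ?h 1 s \<theta>\<bar>)"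
      using int[of t 1] int[of s 1] st by (intro integrable_abs Bochner_Integration.integrable_diff) auto
    show "integrable \<nu> (\<lambda>\<theta>. k * (N2 * ?h 2 s \<theta> + N2 * ?h 2 t \<theta>))"
      using int[of t 2] int[of s 2] st by (intro integrable_mult_right Bochner_Integration.integrable_add) auto
  qed
  also have "\<dots> = k * (N2 * (heat_mixture \<nu> 2 b c s x + heat_mixture \<nu> 2 b c t x))"
    unfolding mix[OF t] mix[OF st(1)] using int[of t 2] int[of s 2] st
    by (simp add: distrib_left)
  finally show ?thesis by (simp add: k_def N2_def)
qed (simp add: heat_mixture_def)

text \<open>
Minkowski's inequality over \<open>\<nu>\<close>, with the bound \<open>(t powr b * \<theta>) powr (- \<gamma>)\<close> for the \<open>L\<^sup>r\<close> norm of the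
heat kernel. The factor \<open>m \<ge> 1\<close> only improves the bound.
\<close>

lemma heat_mixture_Lr:
  fixes r b c \<gamma> G m :: real
  assumes r: "1 \<le> r" and \<gamma>: "\<gamma> = real CARD('n) / 2 * (1 - 1 / r)" and m: "1 \<le> m"
    and G: "(\<integral>\<^sup>+\<theta>. ennreal (\<theta> powr (- \<gamma>)) \<partial>\<nu>) \<le> ennreal G" "0 < G" and t: "0 < t"
  shows "(\<integral>\<^sup>+x. ennreal (heat_mixture \<nu> m b c t (x :: real^'n) powr r) \<partial>lborel) \<le> ennreal ((G * t powr (c - b * \<gamma>)) powr r)"
proof -
  have sf: "sigma_finite_measure \<nu>" by (rule sigma_finite_measure_axioms)
  have g0: "0 \<le> \<gamma>" using r unfolding \<gamma> by simp
  define k where "k \<theta> x = indicator {0<..} \<theta> * (t powr c * heat_kernel (m * (t powr b * \<theta>)) (x :: real^'n))" for \<theta> x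
  define \<kappa> where "\<kappa> \<theta> = indicator {0<..} \<theta> * (t powr (c - b * \<gamma>) * \<theta> powr (- \<gamma>))" for \<theta> :: real
  have "(\<integral>\<^sup>+x. epowr (\<integral>\<^sup>+\<theta>. ennreal (k \<theta> x) \<partial>\<nu>) r \<partial>(lborel :: (real^'n) measure)) \<le> ennreal ((G * t powr (c - b * \<gamma>)) powr r)"
  proof (rule minkowski_nn[where \<kappa> = \<kappa>])
    show "(\<lambda>(\<theta>, x). k \<theta> x) \<in> borel_measurable (\<nu> \<Otimes>\<^sub>M lborel)" unfolding k_def by measurable
    show "\<kappa> \<in> borel_measurable \<nu>" unfolding \<kappa>_def by measurable
    show "0 \<le> k \<theta> x" "0 \<le> \<kappa> \<theta>" "\<kappa> \<theta> = 0 \<Longrightarrow> k \<theta> x = 0" for \<theta> x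
      using t by (auto simp: k_def \<kappa>_def indicator_def split: if_splits)
    show "AE \<theta> in \<nu>. (\<integral>\<^sup>+x. ennreal (k \<theta> x powr r) \<partial>lborel) \<le> ennreal (\<kappa> \<theta> powr r)"
      using pos_nu
    proof eventually_elim
      case (elim \<theta>)
      define T where "T = m * (t powr b * \<theta>)"
      have T: "0 < T" using m t elim by (simp add: T_def)
      have "(\<integral>\<^sup>+x. ennreal (k \<theta> x powr r) \<partial>lborel) = (\<integral>\<^sup>+x. ennreal ((t powr c) powr r) * ennreal (heat_kernel T (x :: real^'n) powr r) \<partial>lborel)"
        using elim by (simp add: k_def T_def powr_mult ennreal_mult)
      also have "\<dots> = ennreal ((t powr c) powr r) * (\<integral>\<^sup>+x. ennreal (heat_kernel T (x :: real^'n) powr r) \<partial>lborel)"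
        by (rule nn_integral_cmult) measurable
      also have "\<dots> \<le> ennreal ((t powr c) powr r) * ennreal (T powr (- (real CARD('n) / 2 * (r - 1))))"
        by (intro mult_left_mono nn_integral_heat_kernel_powr T r) auto
      also have "\<dots> = ennreal ((t powr c * T powr (- \<gamma>)) powr r)"
      proof -
        have *: "- (real CARD('n) / 2 * (r - 1)) = - \<gamma> * r" unfolding \<gamma> using r by (simp add: field_simps)
        show ?thesis unfolding * by (simp add: powr_mult powr_powr flip: ennreal_mult)
      qed
      also have "\<dots> \<le> ennreal (\<kappa> \<theta> powr r)"
      proof (intro ennreal_leI powr_mono2)
        have "T powr (- \<gamma>) \<le> (t powr b * \<theta>) powr (- \<gamma>)"
          using m t elim g0 by (intro powr_mono2') (auto simp: T_def)
        also have "\<dots> = t powr (- (b * \<gamma>)) * \<theta> powr (- \<gamma>)" using t elim by (simp add: powr_mult powr_powr)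
        finally have "t powr c * T powr (- \<gamma>) \<le> t powr c * (t powr (- (b * \<gamma>)) * \<theta> powr (- \<gamma>))"
          by (intro mult_left_mono) auto
        also have "\<dots> = \<kappa> \<theta>" using elim by (simp add: \<kappa>_def powr_diff powr_minus field_simps)
        finally show "t powr c * T powr (- \<gamma>) \<le> \<kappa> \<theta>" .
      qed (use r in auto)
      finally show ?case .
    qed
    have "(\<integral>\<^sup>+\<theta>. ennreal (\<kappa> \<theta>) \<partial>\<nu>) \<le> (\<integral>\<^sup>+\<theta>. ennreal (t powr (c - b * \<gamma>)) * ennreal (\<theta> powr (- \<gamma>)) \<partial>\<nu>)"
      by (intro nn_integral_mono) (auto simp: \<kappa>_def indicator_def simp flip: ennreal_mult)
    also have "\<dots> = ennreal (t powr (c - b * \<gamma>)) * (\<integral>\<^sup>+\<theta>. ennreal (\<theta> powr (- \<gamma>)) \<partial>\<nu>)"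
      by (rule nn_integral_cmult) measurable
    also have "\<dots> \<le> ennreal (t powr (c - b * \<gamma>)) * ennreal G" by (intro mult_left_mono G) auto
    also have "\<dots> = ennreal (G * t powr (c - b * \<gamma>))" using G by (simp add: mult.commute flip: ennreal_mult)
    finally show "(\<integral>\<^sup>+\<theta>. ennreal (\<kappa> \<theta>) \<partial>\<nu>) \<le> ennreal (G * t powr (c - b * \<gamma>))" .
    show "0 < G * t powr (c - b * \<gamma>)" using G t by simp
  qed (use sf r lborel.sigma_finite_measure_axioms in auto)
  moreover have "ennreal (heat_mixture \<nu> m b c t x powr r) \<le> epowr (\<integral>\<^sup>+\<theta>. ennreal (k \<theta> x) \<partial>\<nu>) r" for x :: "real^'n"
  proof (cases "x = 0")
    case False
    have "(\<integral>\<^sup>+\<theta>. ennreal (k \<theta> x) \<partial>\<nu>) = (\<integral>\<^sup>+\<theta>. ennreal (t powr c * heat_kernel (m * (t powr b * \<theta>)) x) \<partial>\<nu>)"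
    proof (rule nn_integral_cong_AE)
      show "AE \<theta> in \<nu>. ennreal (k \<theta> x) = ennreal (t powr c * heat_kernel (m * (t powr b * \<theta>)) x)"
        using pos_nu by eventually_elim (simp add: k_def)
    qed
    also have "\<dots> = ennreal (\<integral>\<theta>. t powr c * heat_kernel (m * (t powr b * \<theta>)) x \<partial>\<nu>)"
      using False t m integrable_heat_kernel_mixing[of x t m b]
      by (intro nn_integral_eq_integral) auto
    also have "\<dots> = ennreal (heat_mixture \<nu> m b c t x)" using False t by (simp add: heat_mixture_def)
    finally show ?thesis by simp
  qed (simp add: heat_mixture_def)
  ultimately show ?thesis
    by (meson nn_integral_mono order_trans)
qed

lemma heat_mixture_fourier:
  assumes t: "0 < t"
  shows "integrable lborel (heat_mixture \<nu> 1 b c t :: real^'n \<Rightarrow> real)"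
    and "fourier (heat_mixture \<nu> 1 b c t) (\<xi> :: real^'n) =
      complex_of_real (t powr c * (\<integral>\<theta>. exp (- ((t powr b * (norm \<xi>)\<^sup>2) * \<theta>)) \<partial>\<nu>))"
proof -
  interpret P: pair_sigma_finite \<nu> "lborel :: (real^'n) measure" ..
  \<comment> \<open>the indicator makes the integral over space finite for every \<open>\<theta>\<close>, not only for almost every one\<close>
  define g where "g \<theta> x = t powr c * (indicator {0<..} \<theta> * heat_kernel (t powr b * \<theta>) x)" for \<theta> and x :: "real^'n"
  have gm[measurable]: "(\<lambda>(\<theta>, x). g \<theta> x) \<in> borel_measurable (\<nu> \<Otimes>\<^sub>M lborel)"
    unfolding g_def by measurable
  have g1: "(\<integral>x. g \<theta> x \<partial>lborel) = t powr c * indicator {0<..} \<theta>" for \<theta>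
    unfolding g_def using t integral_heat_kernel[of "t powr b * \<theta>", where ?'n = 'n]
    by (auto simp: indicator_def)
  have gi: "integrable lborel (g \<theta>)" for \<theta>
    unfolding g_def using t integrable_heat_kernel[of "t powr b * \<theta>", where ?'n = 'n]
    by (auto simp: indicator_def)
  have gint: "integrable (\<nu> \<Otimes>\<^sub>M lborel) (\<lambda>(\<theta>, x). g \<theta> x)"
  proof (rule P.Fubini_integrable)
    have "norm (g \<theta> x) = g \<theta> x" for \<theta> x by (simp add: g_def)
    then have "(\<lambda>\<theta>. \<integral>x. norm (case (\<theta>, x) of (\<theta>, x) \<Rightarrow> g \<theta> x) \<partial>lborel) = (\<lambda>\<theta>. t powr c * indicator {0<..} \<theta>)"
      by (simp add: g1)
    moreover have "integrable \<nu> (\<lambda>\<theta>. t powr c * indicator {0<..} \<theta> :: real)"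
      by (intro integrable_mult_right integrable_real_indicator) (auto simp: emeasure_eq_measure)
    ultimately show "integrable \<nu> (\<lambda>\<theta>. \<integral>x. norm (case (\<theta>, x) of (\<theta>, x) \<Rightarrow> g \<theta> x) \<partial>lborel)" by simp
  qed (auto simp: gi)
  have mix: "AE x in lborel. heat_mixture \<nu> 1 b c t x = (\<integral>\<theta>. g \<theta> (x :: real^'n) \<partial>\<nu>)"
    using AE_lborel_singleton[of 0]
  proof eventually_elim
    case (elim x)
    have "AE \<theta> in \<nu>. t powr c * heat_kernel (1 * (t powr b * \<theta>)) x = g \<theta> x"
      using pos_nu by eventually_elim (simp add: g_def)
    then have "(\<integral>\<theta>. t powr c * heat_kernel (1 * (t powr b * \<theta>)) x \<partial>\<nu>) = (\<integral>\<theta>. g \<theta> x \<partial>\<nu>)"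
      by (intro integral_cong_AE) (auto simp: g_def)
    then show ?case using elim t by (simp add: heat_mixture_def)
  qed
  have [measurable]: "(\<lambda>x. \<integral>\<theta>. g \<theta> x \<partial>\<nu>) \<in> borel_measurable lborel"
    by (rule borel_measurable_lebesgue_integral) (simp add: g_def)
  have "integrable lborel (\<lambda>x. \<integral>\<theta>. g \<theta> x \<partial>\<nu>)"
    using P.integrable_snd[OF gint] by simp
  with mix show "integrable lborel (heat_mixture \<nu> 1 b c t :: real^'n \<Rightarrow> real)"
    by (subst integrable_cong_AE[OF _ _ mix]) auto
  have cint: "integrable (\<nu> \<Otimes>\<^sub>M lborel) (\<lambda>(\<theta>, x). cis (- (\<xi> \<bullet> x)) * complex_of_real (g \<theta> x))"
  proof (rule Bochner_Integration.integrable_bound[OF gint])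
    show "(\<lambda>(\<theta>, x). cis (- (\<xi> \<bullet> x)) * complex_of_real (g \<theta> x)) \<in> borel_measurable (\<nu> \<Otimes>\<^sub>M lborel)"
      unfolding cis_conv_exp g_def by measurable
  qed (auto simp: norm_mult)
  have "fourier (heat_mixture \<nu> 1 b c t) \<xi> = (\<integral>x. cis (- (\<xi> \<bullet> x)) * complex_of_real (\<integral>\<theta>. g \<theta> x \<partial>\<nu>) \<partial>lborel)"
    unfolding fourier_def
  proof (rule integral_cong_AE)
    show "(\<lambda>x. cis (- (\<xi> \<bullet> x)) * complex_of_real (heat_mixture \<nu> 1 b c t x)) \<in> borel_measurable lborel"
      "(\<lambda>x. cis (- (\<xi> \<bullet> x)) * complex_of_real (\<integral>\<theta>. g \<theta> x \<partial>\<nu>)) \<in> borel_measurable lborel"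
      unfolding cis_conv_exp by measurable
    show "AE x in lborel. cis (- (\<xi> \<bullet> x)) * complex_of_real (heat_mixture \<nu> 1 b c t x) = cis (- (\<xi> \<bullet> x)) * complex_of_real (\<integral>\<theta>. g \<theta> x \<partial>\<nu>)"
      using mix by eventually_elim simp
  qed
  also have "\<dots> = (\<integral>x. \<integral>\<theta>. cis (- (\<xi> \<bullet> x)) * complex_of_real (g \<theta> x) \<partial>\<nu> \<partial>lborel)"
    by (simp flip: integral_complex_of_real)
  also have "\<dots> = (\<integral>\<theta>. \<integral>x. cis (- (\<xi> \<bullet> x)) * complex_of_real (g \<theta> x) \<partial>lborel \<partial>\<nu>)"
    by (rule P.Fubini_integral[OF cint])
  also have "\<dots> = (\<integral>\<theta>. complex_of_real (t powr c * exp (- ((t powr b * (norm \<xi>)\<^sup>2) * \<theta>))) \<partial>\<nu>)"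
  proof (rule integral_cong_AE)
    show "(\<lambda>\<theta>. \<integral>x. cis (- (\<xi> \<bullet> x)) * complex_of_real (g \<theta> x) \<partial>lborel) \<in> borel_measurable \<nu>"
      by (rule lborel.borel_measurable_lebesgue_integral) (simp add: cis_conv_exp g_def)
    show "AE \<theta> in \<nu>. (\<integral>x. cis (- (\<xi> \<bullet> x)) * complex_of_real (g \<theta> x) \<partial>lborel) =
        complex_of_real (t powr c * exp (- ((t powr b * (norm \<xi>)\<^sup>2) * \<theta>)))"
      using pos_nu
    proof eventually_elim
      case (elim \<theta>)
      have "(\<integral>x. cis (- (\<xi> \<bullet> x)) * complex_of_real (g \<theta> x) \<partial>lborel)
         = (\<integral>x. complex_of_real (t powr c) * (cis (- (\<xi> \<bullet> x)) * complex_of_real (heat_kernel (t powr b * \<theta>) x)) \<partial>lborel)"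
        using elim by (intro Bochner_Integration.integral_cong refl) (simp add: g_def mult_ac)
      also have "\<dots> = complex_of_real (t powr c) * fourier (heat_kernel (t powr b * \<theta>)) \<xi>"
        unfolding fourier_def by simp
      also have "\<dots> = complex_of_real (t powr c * exp (- ((t powr b * (norm \<xi>)\<^sup>2) * \<theta>)))"
        using elim t by (subst fourier_heat_kernel) (auto simp: mult_ac)
      finally show ?case .
    qed
  qed measurable
  also have "\<dots> = complex_of_real (t powr c * (\<integral>\<theta>. exp (- ((t powr b * (norm \<xi>)\<^sup>2) * \<theta>)) \<partial>\<nu>))"
    by (simp only: integral_complex_of_real integral_mult_right_zero)
  finally show "fourier (heat_mixture \<nu> 1 b c t) \<xi> =
      complex_of_real (t powr c * (\<integral>\<theta>. exp (- ((t powr b * (norm \<xi>)\<^sup>2) * \<theta>)) \<partial>\<nu>))" .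
qed

end

section \<open>Convolution with a smoothing kernel in space\<close>

text \<open>
The case of a parameter space with one point.
\<close>

lemma young_single_Lq_bound:
  fixes f k :: "real^'n \<Rightarrow> real"
  assumes [measurable]: "f \<in> borel_measurable borel" "k \<in> borel_measurable borel"
    and nn: "\<And>y. 0 \<le> f y" "\<And>y. 0 \<le> k y"
    and f: "Lq_bound a (\<lambda>y. ennreal (f y)) B"
    and k: "(\<integral>\<^sup>+y. ennreal (k y powr r) \<partial>lborel) \<le> ennreal (A powr r)"
    and A: "0 < A" and B: "0 < B" and ex: "young_exponents q a r"
  shows "Lq_bound q (\<lambda>x. \<integral>\<^sup>+y. ennreal (f y * k (x - y)) \<partial>lborel) (A * B)"
proof -
  let ?\<mu> = "count_space (UNIV :: unit set)"
  have sf: "sigma_finite_measure ?\<mu>" by (intro sigma_finite_measure_count_space_finite) simp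
  have [measurable]: "(\<lambda>z. f (snd z)) \<in> borel_measurable (?\<mu> \<Otimes>\<^sub>M lborel)"
    "(\<lambda>z. k (snd z)) \<in> borel_measurable (?\<mu> \<Otimes>\<^sub>M lborel)"
    "(\<lambda>z. k (x - snd z)) \<in> borel_measurable (?\<mu> \<Otimes>\<^sub>M lborel)" for x by measurable
  have "Lq_bound q (\<lambda>x. \<integral>\<^sup>+z. ennreal (f (snd z) * k (x - snd z)) \<partial>(?\<mu> \<Otimes>\<^sub>M lborel)) (A * B)"
    by (rule young_Lq_bound[where \<kappa> = "\<lambda>_. A" and a = a and r = r, OF sf])
       (use assms in \<open>auto simp: case_prod_unfold nn_integral_count_space_finite UNIV_unit\<close>)
  moreover have "(\<integral>\<^sup>+z. ennreal (f (snd z) * k (x - snd z)) \<partial>(?\<mu> \<Otimes>\<^sub>M lborel)) = (\<integral>\<^sup>+y. ennreal (f y * k (x - y)) \<partial>lborel)" for x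
    by (subst lborel.nn_integral_fst[symmetric]) (auto simp: nn_integral_count_space_finite UNIV_unit)
  ultimately show ?thesis by simp
qed

text \<open>
In the applications \<open>h\<close> is a sum or a difference of \<open>f\<close> and \<open>g\<close>, possibly only almost everywhere;
the case \<open>f = g\<close> transfers membership in \<open>L\<^sup>q\<close> to a function that agrees with \<open>f\<close> almost everywhere.
\<close>

lemma Lq_quasi_triangle:
  fixes f g h :: "real^'n \<Rightarrow> real"
  assumes q: "1 \<le> q" and f: "in_Lq q f" and g: "in_Lq q g" and [measurable]: "h \<in> borel_measurable borel"
    and le: "AE x in lborel. \<bar>h x\<bar> \<le> \<bar>f x\<bar> + \<bar>g x\<bar>"
  shows "in_Lq q h" "Lq_norm q h \<le> 2 * (Lq_norm q f + Lq_norm q g)"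
proof -
  note F = in_Lq_imp_bound[OF q f] and G = in_Lq_imp_bound[OF q g]
  have [measurable]: "f \<in> borel_measurable borel" "g \<in> borel_measurable borel" using F G by auto
  have s: "Lq_bound q (\<lambda>x. ennreal \<bar>f x\<bar> + ennreal \<bar>g x\<bar>) (2 * (Lq_norm q f + Lq_norm q g))"
    using F G by (intro Lq_bound_add q) auto
  have l: "AE x in lborel. ennreal \<bar>h x\<bar> \<le> ennreal \<bar>f x\<bar> + ennreal \<bar>g x\<bar>"
    using le by eventually_elim (simp flip: ennreal_plus)
  have n: "0 \<le> 2 * (Lq_norm q f + Lq_norm q g)" using F(2) G(2) by simp
  have b: "Lq_bound q (\<lambda>x. ennreal \<bar>h x\<bar>) (2 * (Lq_norm q f + Lq_norm q g))"
    by (rule Lq_bound_mono[OF q s order_refl n l])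
  show "in_Lq q h" "Lq_norm q h \<le> 2 * (Lq_norm q f + Lq_norm q g)"
    by (rule Lq_bound_imp_in_Lq[OF q assms(4) b n])+
qed

lemma ennreal_abs_integral_le:
  fixes f :: "'a \<Rightarrow> real"
  shows "ennreal \<bar>integral\<^sup>L M f\<bar> \<le> (\<integral>\<^sup>+x. ennreal \<bar>f x\<bar> \<partial>M)"
proof (cases "integrable M f")
  case True
  from integral_norm_bound_ennreal[OF this] show ?thesis by simp
qed (simp add: not_integrable_integral_eq)

lemma nn_integral_powr_backward:
  fixes s t k :: real
  assumes "s \<le> t" "k < 1"
  shows "(\<integral>\<^sup>+x. ennreal (indicator {s<..<t} x * (t - x) powr (- k)) \<partial>lborel) = ennreal ((t - s) powr (1 - k) / (1 - k))"
proof -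
  have "(\<integral>\<^sup>+x. ennreal (indicator {s<..<t} x * (t - x) powr (- k)) \<partial>lborel)
      = ennreal \<bar>- 1\<bar> * (\<integral>\<^sup>+x. ennreal (indicator {s<..<t} (t + (- 1) * x) * (t - (t + (- 1) * x)) powr (- k)) \<partial>lborel)"
    by (rule nn_integral_real_affine) auto
  also have "\<dots> = (\<integral>\<^sup>+x. ennreal (indicator {0<..<t - s} x * x powr ((1 - k) - 1)) \<partial>lborel)"
    by (auto intro!: nn_integral_cong simp: indicator_def)
  also have "\<dots> = ennreal ((t - s) powr (1 - k) / (1 - k))"
    using assms by (intro nn_integral_powr_from_0) auto
  finally show ?thesis .
qed

definition duhamel :: "(real \<Rightarrow> real^'n \<Rightarrow> real) \<Rightarrow> (real \<Rightarrow> real^'n \<Rightarrow> real) \<Rightarrow> real \<Rightarrow> real^'n \<Rightarrow> real" where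
  "duhamel f Y t x = (LINT s:{0<..<t}|lborel. LINT y|lborel. f s y * Y (t - s) (x - y))"

text \<open>
What the argument uses of a kernel \<open>Y\<close>: a jointly measurable version \<open>K\<close>, a majorant \<open>V\<close> whose \<open>L\<^sup>r\<close>
norm is at most a multiple of \<open>t powr (- d)\<close>, and Hoelder continuity of \<open>K\<close> in time relative to \<open>V\<close>. Both \<open>Z\<close>, with
\<open>r = 1\<close> and \<open>d = 0\<close>, and \<open>Y\<close> are instances.
\<close>

locale smoothing_kernel =
  fixes Y K V :: "real \<Rightarrow> real^'n \<Rightarrow> real" and r d G C \<epsilon> :: real
  assumes Y_joint: "set_borel_measurable (lborel \<Otimes>\<^sub>M lborel) ({0<..} \<times> UNIV) (\<lambda>(t, x). Y t x)"
    and Y_meas: "\<And>t. 0 < t \<Longrightarrow> Y t \<in> borel_measurable lborel"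
    and Y_eq: "\<And>t. 0 < t \<Longrightarrow> AE x in lborel. Y t x = K t x"
    and K_joint: "(\<lambda>z. K (fst z) (snd z)) \<in> borel_measurable borel"
    and V_joint: "(\<lambda>z. V (fst z) (snd z)) \<in> borel_measurable borel"
    and V_nonneg: "\<And>t x. 0 \<le> V t x"
    and K_le_V: "\<And>t x. \<bar>K t x\<bar> \<le> V t x"
    and V_0: "\<And>t x. t \<le> 0 \<Longrightarrow> V t x = 0"
    and r: "1 \<le> r" and G: "0 < G" and C: "0 < C" and \<epsilon>: "0 < \<epsilon>" and d: "0 \<le> d"
    and V_Lr: "\<And>t. 0 < t \<Longrightarrow> (\<integral>\<^sup>+x. ennreal (V t x powr r) \<partial>lborel) \<le> ennreal ((G * t powr (- d)) powr r)"
    and K_diff: "\<And>s t x. 0 < s \<Longrightarrow> s < t \<Longrightarrow>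
      \<bar>K t x - K s x\<bar> \<le> C * ((t - s) / s) powr \<epsilon> * (V s x + V t x)"
begin

lemma K_0: "t \<le> 0 \<Longrightarrow> K t x = 0"
  using K_le_V[of t x] V_0[of t x] by simp

lemma K_measurable [measurable]:
  assumes "f \<in> borel_measurable M" "g \<in> borel_measurable M"
  shows "(\<lambda>z. K (f z) (g z)) \<in> borel_measurable M"
proof -
  have "(\<lambda>z. (f z, g z)) \<in> M \<rightarrow>\<^sub>M borel" using assms by (rule borel_measurable_Pair)
  from measurable_compose[OF this K_joint] show ?thesis by simp
qed

lemma V_measurable [measurable]:
  assumes "f \<in> borel_measurable M" "g \<in> borel_measurable M"
  shows "(\<lambda>z. V (f z) (g z)) \<in> borel_measurable M"
proof -
  have "(\<lambda>z. (f z, g z)) \<in> M \<rightarrow>\<^sub>M borel" using assms by (rule borel_measurable_Pair)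
  from measurable_compose[OF this V_joint] show ?thesis by simp
qed

text \<open>
As \<open>t powr (- d) \<le> s powr (- d)\<close>, both majorants obey the bound at the earlier time \<open>s\<close>. The
factor \<open>4\<close> comes from the quasi-triangle inequality for the \<open>L\<^sup>r\<close> norm.
\<close>

lemma V_pair_Lr:
  assumes st: "0 < s" "s < t"
  shows "(\<integral>\<^sup>+x. ennreal ((C * ((t - s) / s) powr \<epsilon> * (V s x + V t x)) powr r) \<partial>lborel)
    \<le> ennreal ((4 * C * G * (t - s) powr \<epsilon> * s powr (- (d + \<epsilon>))) powr r)"
proof -
  define k where "k = C * ((t - s) / s) powr \<epsilon>"
  have k: "0 \<le> k" using C by (simp add: k_def)
  define g where "g = (G * s powr (- d)) powr r"
  have pt: "(k * (V s x + V t x)) powr r \<le> (2 * k) powr r * (V s x powr r + V t x powr r)" for x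
  proof -
    have "(k * (V s x + V t x)) powr r = k powr r * (V s x + V t x) powr r"
      using k V_nonneg by (simp add: powr_mult)
    also have "\<dots> \<le> k powr r * (2 powr r * (V s x powr r + V t x powr r))"
      using V_nonneg r by (intro mult_left_mono powr_add_le) auto
    finally show ?thesis using k by (simp add: powr_mult mult_ac)
  qed
  have "(\<integral>\<^sup>+x. ennreal ((k * (V s x + V t x)) powr r) \<partial>lborel)
      \<le> (\<integral>\<^sup>+x. ennreal ((2 * k) powr r) * (ennreal (V s x powr r) + ennreal (V t x powr r)) \<partial>lborel)"
    by (intro nn_integral_mono) (auto simp: ennreal_leI pt simp flip: ennreal_plus ennreal_mult)
  also have "\<dots> = ennreal ((2 * k) powr r) * ((\<integral>\<^sup>+x. ennreal (V s x powr r) \<partial>lborel) + (\<integral>\<^sup>+x. ennreal (V t x powr r) \<partial>lborel))"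
    by (simp add: nn_integral_cmult nn_integral_add)
  also have "\<dots> \<le> ennreal ((2 * k) powr r) * (ennreal g + ennreal g)"
  proof (intro mult_left_mono add_mono)
    show "(\<integral>\<^sup>+x. ennreal (V s x powr r) \<partial>lborel) \<le> ennreal g" unfolding g_def by (rule V_Lr) fact
    have "(G * t powr (- d)) powr r \<le> g"
      unfolding g_def using st G d r by (intro powr_mono2 mult_left_mono powr_mono2') auto
    then show "(\<integral>\<^sup>+x. ennreal (V t x powr r) \<partial>lborel) \<le> ennreal g"
      using V_Lr[of t] st by (meson ennreal_leI less_trans order_trans)
  qed auto
  also have "\<dots> = ennreal ((2 * k) powr r * (2 * g))"
    by (simp add: g_def flip: ennreal_plus ennreal_mult)
  also have "\<dots> \<le> ennreal ((2 * k) powr r * (2 powr r * g))"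
    using r powr_mono[of 1 r 2] by (intro ennreal_leI mult_left_mono mult_right_mono) (auto simp: g_def)
  also have "(2 * k) powr r * (2 powr r * g) = (2 * k * (2 * (G * s powr (- d)))) powr r"
  proof -
    have "(2 * (G * s powr (- d))) powr r = 2 powr r * g"
      unfolding g_def by (rule powr_mult)
    moreover have "(2 * k * (2 * (G * s powr (- d)))) powr r = (2 * k) powr r * (2 * (G * s powr (- d))) powr r"
      by (rule powr_mult)
    ultimately show ?thesis by (simp only:)
  qed
  also have "2 * k * (2 * (G * s powr (- d))) = 4 * C * G * (t - s) powr \<epsilon> * s powr (- (d + \<epsilon>))"
  proof -
    have "((t - s) / s) powr \<epsilon> = (t - s) powr \<epsilon> * s powr (- \<epsilon>)"
      using st by (simp add: powr_divide powr_minus_divide)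
    moreover have "s powr (- (d + \<epsilon>)) = s powr (- \<epsilon>) * s powr (- d)"
      unfolding powr_add[symmetric] by (rule arg_cong[where f = "\<lambda>k. s powr k"]) simp
    ultimately show ?thesis by (simp add: k_def)
  qed
  finally show ?thesis by (simp add: k_def)
qed

lemma convolution_Y_eq_K:
  assumes t: "0 < t" and [measurable]: "f \<in> borel_measurable borel"
  shows "AE y in lborel. f y * Y t (x - y) = f y * K t (x - y)"
    and "(\<lambda>y. f y * Y t (x - y)) \<in> borel_measurable lborel"
    and "(LINT y|lborel. f y * Y t (x - y)) = (LINT y|lborel. f y * K t (x - y))"
    and "integrable lborel (\<lambda>y. f y * Y t (x - y)) \<longleftrightarrow> integrable lborel (\<lambda>y. f y * K t (x - y))"
proof -
  have [measurable]: "Y t \<in> borel_measurable borel" using Y_meas[OF t] by simp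
  show a: "AE y in lborel. f y * Y t (x - y) = f y * K t (x - y)"
    using AE_reflect_translate[OF Y_eq[OF t], of x] by eventually_elim simp
  show m: "(\<lambda>y. f y * Y t (x - y)) \<in> borel_measurable lborel" by measurable
  show "(LINT y|lborel. f y * Y t (x - y)) = (LINT y|lborel. f y * K t (x - y))"
    by (rule integral_cong_AE[OF m _ a]) measurable
  show "integrable lborel (\<lambda>y. f y * Y t (x - y)) \<longleftrightarrow> integrable lborel (\<lambda>y. f y * K t (x - y))"
    by (rule integrable_cong_AE[OF m _ a]) measurable
qed

lemma convolution_Lq:
  fixes f :: "real^'n \<Rightarrow> real"
  assumes q: "1 \<le> q" and t: "0 < t" and [measurable]: "f \<in> borel_measurable borel"
    and f: "Lq_bound a (\<lambda>y. ennreal \<bar>f y\<bar>) B" and B: "0 < B" and ex: "young_exponents q a r"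
  shows "AE x in lborel. integrable lborel (\<lambda>y. f y * Y t (x - y))"
    and "(\<lambda>x. LINT y|lborel. f y * Y t (x - y)) \<in> borel_measurable borel"
    and "in_Lq q (\<lambda>x. LINT y|lborel. f y * Y t (x - y))"
proof -
  define H where "H x = (\<integral>\<^sup>+y. ennreal (\<bar>f y\<bar> * V t (x - y)) \<partial>lborel)" for x
  have H[measurable]: "H \<in> borel_measurable lborel" unfolding H_def by measurable
  have Hb: "Lq_bound q H (G * t powr (- d) * B)"
    unfolding H_def using t G V_nonneg V_Lr[OF t] by (intro young_single_Lq_bound[OF _ _ _ _ f _ _ B ex]) auto
  have le: "(\<integral>\<^sup>+y. ennreal \<bar>f y * K t (x - y)\<bar> \<partial>lborel) \<le> H x" for x
    unfolding H_def using K_le_V by (intro nn_integral_mono ennreal_leI) (auto simp: abs_mult intro!: mult_left_mono)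
  show "AE x in lborel. integrable lborel (\<lambda>y. f y * Y t (x - y))"
    using Lq_bound_imp_AE_finite[OF q H Hb]
  proof eventually_elim
    case (elim x)
    have "integrable lborel (\<lambda>y. f y * K t (x - y))"
      using le[of x] elim by (intro integrableI_bounded) auto
    then show ?case
      by (simp only: convolution_Y_eq_K(4)[OF t assms(3)])
  qed
  show m: "(\<lambda>x. LINT y|lborel. f y * Y t (x - y)) \<in> borel_measurable borel"
    unfolding convolution_Y_eq_K(3)[OF t assms(3)] by measurable
  have "ennreal \<bar>LINT y|lborel. f y * Y t (x - y)\<bar> \<le> H x" for x
    unfolding convolution_Y_eq_K(3)[OF t assms(3)] by (rule order_trans[OF ennreal_abs_integral_le le])
  then have "Lq_bound q (\<lambda>x. ennreal \<bar>LINT y|lborel. f y * Y t (x - y)\<bar>) (G * t powr (- d) * B)"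
    using G B by (intro Lq_bound_mono[OF q Hb]) auto
  then show "in_Lq q (\<lambda>x. LINT y|lborel. f y * Y t (x - y))"
    using G B by (intro Lq_bound_imp_in_Lq(1)[OF q m]) auto
qed

lemma convolution_Lq_difference:
  fixes f :: "real^'n \<Rightarrow> real"
  assumes q: "1 \<le> q" and st: "0 < s" "s < t" and [measurable]: "f \<in> borel_measurable borel"
    and f: "Lq_bound a (\<lambda>y. ennreal \<bar>f y\<bar>) B" and B: "0 < B" and ex: "young_exponents q a r"
  shows "in_Lq q (\<lambda>x. (LINT y|lborel. f y * Y t (x - y)) - (LINT y|lborel. f y * Y s (x - y)))"
    and "Lq_norm q (\<lambda>x. (LINT y|lborel. f y * Y t (x - y)) - (LINT y|lborel. f y * Y s (x - y)))
      \<le> 4 * C * G * (t - s) powr \<epsilon> * s powr (- (d + \<epsilon>)) * B"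
proof -
  have t: "0 < t" using st by simp
  define W where "W x = C * ((t - s) / s) powr \<epsilon> * (V s x + V t x)" for x
  have [measurable]: "W \<in> borel_measurable borel" unfolding W_def by measurable
  have W0: "0 \<le> W x" for x using V_nonneg C by (simp add: W_def)
  define A where "A = 4 * C * G * (t - s) powr \<epsilon> * s powr (- (d + \<epsilon>))"
  have A: "0 < A" using C G st by (simp add: A_def)
  define H where "H x = (\<integral>\<^sup>+y. ennreal (\<bar>f y\<bar> * W (x - y)) \<partial>lborel)" for x
  have Hb: "Lq_bound q H (A * B)"
    unfolding H_def using V_pair_Lr[OF st] A W0
    by (intro young_single_Lq_bound[OF _ _ _ _ f _ _ B ex]) (auto simp: A_def W_def)
  note m = convolution_Lq(2)[OF q t assms(4) f B ex] convolution_Lq(2)[OF q st(1) assms(4) f B ex]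
  have "AE x in lborel. ennreal \<bar>(LINT y|lborel. f y * Y t (x - y)) - (LINT y|lborel. f y * Y s (x - y))\<bar> \<le> H x"
    using convolution_Lq(1)[OF q t assms(4) f B ex] convolution_Lq(1)[OF q st(1) assms(4) f B ex]
  proof eventually_elim
    case (elim x)
    have i: "integrable lborel (\<lambda>y. f y * K t (x - y))" "integrable lborel (\<lambda>y. f y * K s (x - y))"
      using elim unfolding convolution_Y_eq_K(4)[OF t assms(4)] convolution_Y_eq_K(4)[OF st(1) assms(4)] by auto
    have "(LINT y|lborel. f y * Y t (x - y)) - (LINT y|lborel. f y * Y s (x - y))
        = (LINT y|lborel. f y * (K t (x - y) - K s (x - y)))"
      unfolding convolution_Y_eq_K(3)[OF t assms(4)] convolution_Y_eq_K(3)[OF st(1) assms(4)]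
      using Bochner_Integration.integral_diff[OF i] by (simp add: right_diff_distrib)
    then have "ennreal \<bar>(LINT y|lborel. f y * Y t (x - y)) - (LINT y|lborel. f y * Y s (x - y))\<bar>
        \<le> (\<integral>\<^sup>+y. ennreal \<bar>f y * (K t (x - y) - K s (x - y))\<bar> \<partial>lborel)"
      using ennreal_abs_integral_le by simp
    also have "\<dots> \<le> H x"
      unfolding H_def W_def using K_diff[OF st]
      by (intro nn_integral_mono ennreal_leI) (auto simp: abs_mult intro!: mult_left_mono)
    finally show ?case .
  qed
  then have b: "Lq_bound q (\<lambda>x. ennreal \<bar>(LINT y|lborel. f y * Y t (x - y)) - (LINT y|lborel. f y * Y s (x - y))\<bar>) (A * B)"
    using A B by (intro Lq_bound_mono[OF q Hb]) auto
  show "in_Lq q (\<lambda>x. (LINT y|lborel. f y * Y t (x - y)) - (LINT y|lborel. f y * Y s (x - y)))"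
    "Lq_norm q (\<lambda>x. (LINT y|lborel. f y * Y t (x - y)) - (LINT y|lborel. f y * Y s (x - y)))
      \<le> 4 * C * G * (t - s) powr \<epsilon> * s powr (- (d + \<epsilon>)) * B"
    using Lq_bound_imp_in_Lq[OF q _ b] m A B by (auto simp: A_def)
qed

end

section \<open>Convolution with a smoothing kernel in space and time\<close>

text \<open>
The source \<open>f\<close> is bounded in time with values in \<open>L\<^sup>a\<close>. The condition \<open>d + \<epsilon> < 1\<close> keeps the
singularities of \<open>V\<close> and of the Hoelder quotient integrable in time.
\<close>

locale duhamel_term = smoothing_kernel Y K V r d G C \<epsilon>
  for Y K V :: "real \<Rightarrow> real^'n \<Rightarrow> real" and r d G C \<epsilon> :: real +
  fixes f :: "real \<Rightarrow> real^'n \<Rightarrow> real" and T' B :: real and q a :: ereal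
  assumes f_joint: "(\<lambda>z. f (fst z) (snd z)) \<in> borel_measurable (lborel \<Otimes>\<^sub>M lborel)"
    and f_supp: "\<And>s y. s \<le> 0 \<or> T' \<le> s \<Longrightarrow> f s y = 0"
    and f_bound: "AE s in lborel. Lq_bound a (\<lambda>y. ennreal \<bar>f s y\<bar>) B" and B: "0 < B"
    and q: "1 \<le> q" and exponents: "young_exponents q a r" and d_eps: "d + \<epsilon> < 1"
begin

lemma f_measurable [measurable]:
  assumes f: "g \<in> borel_measurable M" and g: "h \<in> borel_measurable M"
  shows "(\<lambda>z. f (g z) (h z)) \<in> borel_measurable M"
proof -
  have p: "(\<lambda>z. (g z, h z)) \<in> M \<rightarrow>\<^sub>M lborel \<Otimes>\<^sub>M lborel" using f g by measurable
  from measurable_compose[OF p f_joint] show ?thesis by simp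
qed

text \<open>
The convolution in space and time of the absolute value of the source with the majorant. Where it is
finite, all integrals converge absolutely.
\<close>

definition H :: "real \<Rightarrow> real^'n \<Rightarrow> ennreal" where
  "H t x = (\<integral>\<^sup>+z. ennreal (\<bar>f (fst z) (snd z)\<bar> * V (t - fst z) (x - snd z)) \<partial>(lborel \<Otimes>\<^sub>M lborel))"

lemma H_measurable: "H t \<in> borel_measurable lborel"
  unfolding H_def by measurable

lemma H_bound:
  assumes t: "0 < t"
  shows "Lq_bound q (H t) (G * (t powr (1 - d) / (1 - d)) * B)"
proof -
  have d1: "d < 1" using d_eps \<epsilon> by simp
  let ?K = "\<lambda>s y. indicator {0<..<t} s * V (t - s) y"
  let ?\<kappa> = "\<lambda>s. indicator {0<..<t} s * (G * (t - s) powr (- d))"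
  have A: "(\<integral>\<^sup>+s. ennreal (?\<kappa> s) \<partial>lborel) \<le> ennreal (G * (t powr (1 - d) / (1 - d)))"
  proof -
    have "(\<integral>\<^sup>+s. ennreal (?\<kappa> s) \<partial>lborel) = (\<integral>\<^sup>+s. ennreal G * ennreal (indicator {0<..<t} s * (t - s) powr (- d)) \<partial>lborel)"
      using G by (intro nn_integral_cong) (auto simp: mult_ac simp flip: ennreal_mult)
    also have "\<dots> = ennreal G * ennreal (t powr (1 - d) / (1 - d))"
      using nn_integral_powr_backward[of 0 t d] t d1 by (subst nn_integral_cmult) auto
    finally show ?thesis using G d1 by (simp flip: ennreal_mult)
  qed
  have "Lq_bound q (\<lambda>x. \<integral>\<^sup>+z. ennreal (\<bar>f (fst z) (snd z)\<bar> * ?K (fst z) (x - snd z)) \<partial>(lborel \<Otimes>\<^sub>M lborel)) (G * (t powr (1 - d) / (1 - d)) * B)"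
  proof (rule young_Lq_bound[where \<kappa> = ?\<kappa> and a = a and r = r and F = "\<lambda>s y. \<bar>f s y\<bar>" and K = ?K])
    show "(\<integral>\<^sup>+y. ennreal (?K s y powr r) \<partial>lborel) \<le> ennreal (?\<kappa> s powr r)" for s
    proof (cases "s \<in> {0<..<t}")
      case True
      then show ?thesis using V_Lr[of "t - s"] by simp
    qed auto
    show "?\<kappa> s = 0 \<Longrightarrow> ?K s y = 0" for s y
      using G by (auto simp: indicator_def split: if_splits)
    show "0 \<le> ?K s y" "0 \<le> ?\<kappa> s" for s y using V_nonneg G by auto
    show "0 < G * (t powr (1 - d) / (1 - d))" using G t d1 by simp
  qed (use A B exponents f_bound lborel.sigma_finite_measure_axioms in auto)
  moreover have "\<bar>f (fst z) (snd z)\<bar> * ?K (fst z) (x - snd z) = \<bar>f (fst z) (snd z)\<bar> * V (t - fst z) (x - snd z)" for x z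
    using f_supp[of "fst z" "snd z"] V_0[of "t - fst z"] by (cases "0 < fst z"; cases "fst z < t") (auto simp: indicator_def)
  ultimately show ?thesis unfolding H_def[abs_def] by simp
qed

lemma AE_H_finite: "0 < t \<Longrightarrow> AE x in lborel. H t x < \<top>"
  by (rule Lq_bound_imp_AE_finite[OF q H_measurable H_bound])

lemma integrable_fK:
  assumes "H t x < \<top>"
  shows "integrable (lborel \<Otimes>\<^sub>M lborel) (\<lambda>z. f (fst z) (snd z) * K (t - fst z) (x - snd z))"
proof (rule integrableI_bounded)
  have "(\<integral>\<^sup>+z. ennreal (norm (f (fst z) (snd z) * K (t - fst z) (x - snd z))) \<partial>(lborel \<Otimes>\<^sub>M lborel)) \<le> H t x"
    unfolding H_def using K_le_V
    by (intro nn_integral_mono ennreal_leI) (auto simp: abs_mult intro!: mult_left_mono)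
  then show "(\<integral>\<^sup>+z. ennreal (norm (f (fst z) (snd z) * K (t - fst z) (x - snd z))) \<partial>(lborel \<Otimes>\<^sub>M lborel)) < \<infinity>"
    using assms by (auto simp: le_less_trans)
qed measurable

text \<open>
The kernels \<open>Y\<close> and \<open>K\<close> agree almost everywhere in space at each positive time. Joint
measurability of \<open>Y\<close> turns this into equality almost everywhere in space and time.
\<close>

lemma set_integrable_fY:
  assumes "H t x < \<top>"
  shows "set_integrable (lborel \<Otimes>\<^sub>M lborel) ({0<..<t} \<times> UNIV) (\<lambda>(s, y). f s y * Y (t - s) (x - y))"
proof -
  \<comment> \<open>the kernel cut off to positive times, where it is known to be measurable\<close>
  define Y1 where "Y1 z = indicator ({0<..} \<times> UNIV) z *\<^sub>R (case z of (t, x) \<Rightarrow> Y t x)" for z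
  have Y1: "Y1 \<in> borel_measurable (lborel \<Otimes>\<^sub>M lborel)"
    using Y_joint unfolding set_borel_measurable_def Y1_def[abs_def] .
  have p: "(\<lambda>z. (t - fst z, x - snd z)) \<in> lborel \<Otimes>\<^sub>M lborel \<rightarrow>\<^sub>M lborel \<Otimes>\<^sub>M lborel" by measurable
  note [measurable] = measurable_compose[OF p Y1]
  let ?g = "\<lambda>z. indicator {0<..} (fst z) * (f (fst z) (snd z) * Y1 (t - fst z, x - snd z))"
  let ?h = "\<lambda>z. f (fst z) (snd z) * K (t - fst z) (x - snd z)"
  have g: "indicator ({0<..<t} \<times> UNIV) z *\<^sub>R (case z of (s, y) \<Rightarrow> f s y * Y (t - s) (x - y)) = ?g z" for z
    by (auto simp: Y1_def indicator_def split: prod.splits)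
  have gm: "?g \<in> borel_measurable (lborel \<Otimes>\<^sub>M lborel)" by measurable
  have hm: "?h \<in> borel_measurable (lborel \<Otimes>\<^sub>M lborel)" by measurable
  have ae: "AE z in lborel \<Otimes>\<^sub>M lborel. ?g z = ?h z"
  proof (rule lborel_pair.AE_pair_measure)
    show "{z \<in> space (lborel \<Otimes>\<^sub>M lborel). ?g z = ?h z} \<in> sets (lborel \<Otimes>\<^sub>M lborel)"
      using gm hm by measurable
    show "AE s in lborel. AE y in lborel. ?g (s, y) = ?h (s, y)"
    proof (rule AE_I2)
      fix s :: real
      show "AE y in lborel. ?g (s, y) = ?h (s, y)"
      proof (cases "0 < s \<and> s < t")
        case True
        then have "AE y in lborel. f s y * Y (t - s) (x - y) = f s y * K (t - s) (x - y)"
          by (intro convolution_Y_eq_K(1)) auto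
        then show ?thesis by eventually_elim (use True in \<open>simp add: Y1_def\<close>)
      next
        case False
        then show ?thesis using f_supp[of s] K_0[of "t - s"] by (auto simp: Y1_def indicator_def)
      qed
    qed
  qed
  have "integrable (lborel \<Otimes>\<^sub>M lborel) ?g"
    using integrable_cong_AE[OF gm hm ae] integrable_fK[OF assms] by simp
  then show ?thesis unfolding set_integrable_def g .
qed

lemma duhamel_eq_K:
  "duhamel f Y t x = (LINT s|lborel. LINT y|lborel. f s y * K (t - s) (x - y))"
  unfolding duhamel_def set_lebesgue_integral_def
proof (rule Bochner_Integration.integral_cong[OF refl])
  fix s :: real
  show "indicator {0<..<t} s *\<^sub>R (LINT y|lborel. f s y * Y (t - s) (x - y)) = (LINT y|lborel. f s y * K (t - s) (x - y))"
  proof (cases "0 < s \<and> s < t")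
    case True
    have [measurable]: "f s \<in> borel_measurable borel" by measurable
    show ?thesis using True convolution_Y_eq_K(3)[of "t - s" "f s" x] by simp
  next
    case False
    then show ?thesis using f_supp[of s] K_0[of "t - s"] by (auto simp: indicator_def)
  qed
qed

lemma duhamel_eq:
  assumes "H t x < \<top>"
  shows "duhamel f Y t x = (LINT z|(lborel \<Otimes>\<^sub>M lborel). f (fst z) (snd z) * K (t - fst z) (x - snd z))"
  unfolding duhamel_eq_K using lborel_pair.integral_fst'[OF integrable_fK[OF assms]] by simp

lemma duhamel_measurable: "duhamel f Y t \<in> borel_measurable borel"
  unfolding duhamel_eq_K[abs_def] by measurable

lemma duhamel_in_Lq:
  assumes t: "0 < t"
  shows "in_Lq q (duhamel f Y t)"
proof (rule Lq_bound_imp_in_Lq(1)[OF q duhamel_measurable])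
  have d1: "d < 1" using d_eps \<epsilon> by simp
  show n: "0 \<le> G * (t powr (1 - d) / (1 - d)) * B" using G B d1 by simp
  have "AE x in lborel. ennreal \<bar>duhamel f Y t x\<bar> \<le> H t x"
    using AE_H_finite[OF t]
  proof eventually_elim
    case (elim x)
    have "ennreal \<bar>duhamel f Y t x\<bar> \<le> (\<integral>\<^sup>+z. ennreal \<bar>f (fst z) (snd z) * K (t - fst z) (x - snd z)\<bar> \<partial>(lborel \<Otimes>\<^sub>M lborel))"
      unfolding duhamel_eq[OF elim] by (rule ennreal_abs_integral_le)
    also have "\<dots> \<le> H t x"
      unfolding H_def using K_le_V
      by (intro nn_integral_mono ennreal_leI) (auto simp: abs_mult intro!: mult_left_mono)
    finally show ?case .
  qed
  from Lq_bound_mono[OF q H_bound[OF t] order_refl n this]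
  show "Lq_bound q (\<lambda>x. ennreal \<bar>duhamel f Y t x\<bar>) (G * (t powr (1 - d) / (1 - d)) * B)" .
qed

text \<open>
Let \<open>u\<close> be the time at which the source acts. For \<open>u < s\<close> both kernels are present and their
difference is controlled by the Hoelder estimate; for \<open>s \<le> u < t\<close> only the kernel at \<open>t - u\<close>
contributes. Both cases enter one application of Young's inequality with the kernel \<open>W\<close>.
\<close>

lemma duhamel_difference:
  assumes st: "0 < s" "s < t"
  shows "Lq_norm q (\<lambda>x. duhamel f Y t x - duhamel f Y s x)
    \<le> (4 * C * G * (t - s) powr \<epsilon> * (s powr (1 - (d + \<epsilon>)) / (1 - (d + \<epsilon>)))
      + G * ((t - s) powr (1 - d) / (1 - d))) * B"
proof -
  have t: "0 < t" using st by simp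
  have d1: "d < 1" using d_eps \<epsilon> by simp
  define A1 where "A1 = 4 * C * G * (t - s) powr \<epsilon> * (s powr (1 - (d + \<epsilon>)) / (1 - (d + \<epsilon>)))"
  define A2 where "A2 = G * ((t - s) powr (1 - d) / (1 - d))"
  have A12: "0 < A1" "0 < A2" using C G st d_eps d1 by (simp_all add: A1_def A2_def)
  define W where "W u y = indicator {0<..<s} u * (C * ((t - s) / (s - u)) powr \<epsilon> * (V (s - u) y + V (t - u) y))
      + indicator {s..<t} u * V (t - u) y" for u y
  define \<kappa> where "\<kappa> u = indicator {0<..<s} u * (4 * C * G * (t - s) powr \<epsilon> * (s - u) powr (- (d + \<epsilon>)))
      + indicator {s..<t} u * (G * (t - u) powr (- d))" for u
  have A: "(\<integral>\<^sup>+u. ennreal (\<kappa> u) \<partial>lborel) \<le> ennreal (A1 + A2)"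
  proof -
    have "(\<integral>\<^sup>+u. ennreal (\<kappa> u) \<partial>lborel) = (\<integral>\<^sup>+u. ennreal (4 * C * G * (t - s) powr \<epsilon>) * ennreal (indicator {0<..<s} u * (s - u) powr (- (d + \<epsilon>)))
        + ennreal G * ennreal (indicator {s<..<t} u * (t - u) powr (- d)) \<partial>lborel)"
    proof (rule nn_integral_cong_AE)
      show "AE u in lborel. ennreal (\<kappa> u) = ennreal (4 * C * G * (t - s) powr \<epsilon>) * ennreal (indicator {0<..<s} u * (s - u) powr (- (d + \<epsilon>)))
        + ennreal G * ennreal (indicator {s<..<t} u * (t - u) powr (- d))"
        using AE_lborel_singleton[of s]
        by eventually_elim (use C G in \<open>auto simp: \<kappa>_def indicator_def simp flip: ennreal_mult\<close>)
    qed
    also have "\<dots> = ennreal (4 * C * G * (t - s) powr \<epsilon>) * ennreal ((s - 0) powr (1 - (d + \<epsilon>)) / (1 - (d + \<epsilon>)))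
        + ennreal G * ennreal ((t - s) powr (1 - d) / (1 - d))"
      using st d_eps d1 nn_integral_powr_backward[of 0 s "d + \<epsilon>"] nn_integral_powr_backward[of s t d]
      by (simp add: nn_integral_add nn_integral_cmult)
    also have "\<dots> = ennreal (A1 + A2)"
      using C G d_eps d1 by (simp add: A1_def A2_def flip: ennreal_mult ennreal_plus)
    finally show ?thesis by simp
  qed
  define HW where "HW x = (\<integral>\<^sup>+z. ennreal (\<bar>f (fst z) (snd z)\<bar> * W (fst z) (x - snd z)) \<partial>(lborel \<Otimes>\<^sub>M lborel))" for x
  have HW: "Lq_bound q HW ((A1 + A2) * B)"
    unfolding HW_def[abs_def]
  proof (rule young_Lq_bound[where \<kappa> = \<kappa> and a = a and r = r and F = "\<lambda>s y. \<bar>f s y\<bar>" and K = W])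
    show "(\<integral>\<^sup>+y. ennreal (W u y powr r) \<partial>lborel) \<le> ennreal (\<kappa> u powr r)" for u
    proof -
      consider "0 < u" "u < s" | "s \<le> u" "u < t" | "u \<le> 0 \<or> t \<le> u" by linarith
      then show ?thesis
      proof cases
        case 1
        then show ?thesis using V_pair_Lr[of "s - u" "t - u"] st by (simp add: W_def \<kappa>_def)
      next
        case 2
        then show ?thesis using V_Lr[of "t - u"] by (simp add: W_def \<kappa>_def)
      next
        case 3
        then show ?thesis using st by (auto simp: W_def \<kappa>_def)
      qed
    qed
    show "\<kappa> u = 0 \<Longrightarrow> W u y = 0" for u y
      using G C st by (auto simp: W_def \<kappa>_def indicator_def split: if_splits)
    show "0 \<le> W u y" "0 \<le> \<kappa> u" for u y
      using V_nonneg G C by (auto simp: W_def \<kappa>_def)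
    show "(\<lambda>(i, y). W i y) \<in> borel_measurable (lborel \<Otimes>\<^sub>M lborel)" unfolding W_def by measurable
    show "\<kappa> \<in> borel_measurable lborel" unfolding \<kappa>_def by measurable
  qed (use A A12 B exponents f_bound lborel.sigma_finite_measure_axioms in auto)
  have KW: "\<bar>f u y\<bar> * \<bar>K (t - u) x - K (s - u) x\<bar> \<le> \<bar>f u y\<bar> * W u x" for u y x
  proof -
    consider "0 < u" "u < s" | "s \<le> u" "u < t" | "u \<le> 0" | "t \<le> u" by linarith
    then show ?thesis
    proof cases
      case 1
      then show ?thesis using K_diff[of "s - u" "t - u" x] st by (intro mult_left_mono) (auto simp: W_def)
    next
      case 2
      then show ?thesis using K_0[of "s - u"] K_le_V[of "t - u" x] st by (intro mult_left_mono) (auto simp: W_def)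
    next
      case 3
      then show ?thesis using f_supp by simp
    next
      case 4
      then show ?thesis using K_0[of "s - u"] K_0[of "t - u"] st by (simp add: W_def)
    qed
  qed
  have n: "0 \<le> (A1 + A2) * B" using A12 B by simp
  have "AE x in lborel. ennreal \<bar>duhamel f Y t x - duhamel f Y s x\<bar> \<le> HW x"
    using AE_H_finite[OF t] AE_H_finite[OF st(1)]
  proof eventually_elim
    case (elim x)
    have "duhamel f Y t x - duhamel f Y s x
        = (LINT z|(lborel \<Otimes>\<^sub>M lborel). f (fst z) (snd z) * (K (t - fst z) (x - snd z) - K (s - fst z) (x - snd z)))"
      unfolding duhamel_eq[OF elim(1)] duhamel_eq[OF elim(2)]
      using Bochner_Integration.integral_diff[OF integrable_fK[OF elim(1)] integrable_fK[OF elim(2)]]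
      by (simp add: right_diff_distrib)
    then have "ennreal \<bar>duhamel f Y t x - duhamel f Y s x\<bar> \<le>
        (\<integral>\<^sup>+z. ennreal \<bar>f (fst z) (snd z) * (K (t - fst z) (x - snd z) - K (s - fst z) (x - snd z))\<bar> \<partial>(lborel \<Otimes>\<^sub>M lborel))"
      using ennreal_abs_integral_le by simp
    also have "\<dots> \<le> HW x"
      unfolding HW_def using KW by (intro nn_integral_mono ennreal_leI) (simp add: abs_mult)
    finally show ?case .
  qed
  from Lq_bound_mono[OF q HW order_refl n this]
  have "Lq_bound q (\<lambda>x. ennreal \<bar>duhamel f Y t x - duhamel f Y s x\<bar>) ((A1 + A2) * B)" .
  from Lq_bound_imp_in_Lq(2)[OF q _ this n] show ?thesis
    using duhamel_measurable by (simp add: A1_def A2_def)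
qed

end

section \<open>Continuity of mild solutions\<close>

text \<open>
Both sides are integrable and have the same Fourier transform.
\<close>

lemma (in mixing_measure) kernel_eq_heat_mixture:
  fixes \<phi> :: "real \<Rightarrow> real" and k :: "real^'n \<Rightarrow> real"
  assumes ab: "0 < \<alpha>" "0 < \<beta>" and t: "0 < t"
    and lap: "\<And>y. 0 \<le> y \<Longrightarrow> (\<integral>\<theta>. exp (- (y * \<theta>)) \<partial>\<nu>) = \<phi> (y powr \<beta>)"
    and k: "integrable lborel k"
    and F: "\<And>\<xi>. fourier k \<xi> = complex_of_real (t powr c * \<phi> (norm \<xi> powr (2 * \<beta>) * t powr \<alpha>))"
  shows "AE x in lborel. k x = heat_mixture \<nu> 1 (\<alpha> / \<beta>) c t x"
proof (rule fourier_unique[OF k heat_mixture_fourier(1)[OF t]])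
  fix \<xi> :: "real^'n"
  have "(t powr (\<alpha> / \<beta>) * (norm \<xi>)\<^sup>2) powr \<beta> = norm \<xi> powr (2 * \<beta>) * t powr \<alpha>"
  proof (cases "\<xi> = 0")
    case False
    then have "(norm \<xi>)\<^sup>2 powr \<beta> = (norm \<xi> powr 2) powr \<beta>" by simp
    also have "\<dots> = norm \<xi> powr (2 * \<beta>)" by (rule powr_powr)
    finally show ?thesis using t ab by (simp add: powr_mult powr_powr mult.commute)
  qed (use ab in simp)
  then show "fourier k \<xi> = fourier (heat_mixture \<nu> 1 (\<alpha> / \<beta>) c t) \<xi>"
    unfolding F heat_mixture_fourier(2)[OF t] by (subst lap) auto
qed

lemma (in mixing_measure) smoothing_kernel_heat_mixture:
  fixes \<phi> :: "real \<Rightarrow> real" and k :: "real \<Rightarrow> real^'n \<Rightarrow> real"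
  assumes ab: "0 < \<alpha>" "0 < \<beta>"
    and lap: "\<And>y. 0 \<le> y \<Longrightarrow> (\<integral>\<theta>. exp (- (y * \<theta>)) \<partial>\<nu>) = \<phi> (y powr \<beta>)"
    and joint: "set_borel_measurable (lborel \<Otimes>\<^sub>M lborel) ({0<..} \<times> UNIV) (\<lambda>(t, x). k t x)"
    and k: "\<And>t. 0 < t \<Longrightarrow> integrable lborel (k t)"
    and F: "\<And>t \<xi>. 0 < t \<Longrightarrow> fourier (k t) \<xi> = complex_of_real (t powr c * \<phi> (norm \<xi> powr (2 * \<beta>) * t powr \<alpha>))"
    and c: "c \<le> 0" and r: "1 \<le> r" and \<gamma>: "\<gamma> = real CARD('n) / 2 * (1 - 1 / r)"
    and G: "(\<integral>\<^sup>+\<theta>. ennreal (\<theta> powr (- \<gamma>)) \<partial>\<nu>) \<le> ennreal G" "0 < G" and \<epsilon>: "0 < \<epsilon>" "\<epsilon> \<le> 1"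
  shows "smoothing_kernel k (heat_mixture \<nu> 1 (\<alpha> / \<beta>) c)
    (\<lambda>t x. 2 powr (real CARD('n) / 2) * heat_mixture \<nu> 2 (\<alpha> / \<beta>) c t x) r (\<alpha> / \<beta> * \<gamma> - c)
    (2 powr (real CARD('n) / 2) * G) (1 + (\<alpha> / \<beta> * real CARD('n) / 2 - c) + 2 * (\<alpha> / \<beta>)) \<epsilon>"
proof
  let ?b = "\<alpha> / \<beta>" and ?N2 = "2 powr (real CARD('n) / 2)"
  have b: "0 < ?b" using ab by simp
  have g0: "0 \<le> \<gamma>" using r unfolding \<gamma> by simp
  show "set_borel_measurable (lborel \<Otimes>\<^sub>M lborel) ({0<..} \<times> UNIV) (\<lambda>(t, x). k t x)" by (rule joint)
  show "k t \<in> borel_measurable lborel" if "0 < t" for t using k[OF that] by auto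
  show "AE x in lborel. k t x = heat_mixture \<nu> 1 ?b c t x" if "0 < t" for t
    by (rule kernel_eq_heat_mixture[OF ab that lap k[OF that] F[OF that]])
  show "(\<lambda>z. heat_mixture \<nu> 1 ?b c (fst z) (snd z :: real^'n)) \<in> borel_measurable borel"
    "(\<lambda>z. ?N2 * heat_mixture \<nu> 2 ?b c (fst z) (snd z :: real^'n)) \<in> borel_measurable borel"
    unfolding borel_prod[symmetric] by measurable
  show "\<bar>heat_mixture \<nu> 1 ?b c t x\<bar> \<le> ?N2 * heat_mixture \<nu> 2 ?b c t x" for t and x :: "real^'n"
    using heat_mixture_le[of ?b c t x] by simp
  show "(\<integral>\<^sup>+x. ennreal ((?N2 * heat_mixture \<nu> 2 ?b c t (x :: real^'n)) powr r) \<partial>lborel)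
      \<le> ennreal ((?N2 * G * t powr (- (?b * \<gamma> - c))) powr r)" if t: "0 < t" for t
  proof -
    have "(\<integral>\<^sup>+x. ennreal ((?N2 * heat_mixture \<nu> 2 ?b c t (x :: real^'n)) powr r) \<partial>lborel)
        = (\<integral>\<^sup>+x. ennreal (?N2 powr r) * ennreal (heat_mixture \<nu> 2 ?b c t (x :: real^'n) powr r) \<partial>lborel)"
      by (intro nn_integral_cong) (subst powr_mult, simp add: ennreal_mult)
    also have "\<dots> = ennreal (?N2 powr r) * (\<integral>\<^sup>+x. ennreal (heat_mixture \<nu> 2 ?b c t (x :: real^'n) powr r) \<partial>lborel)"
      by (rule nn_integral_cmult) measurable
    also have "\<dots> \<le> ennreal (?N2 powr r) * ennreal ((G * t powr (c - ?b * \<gamma>)) powr r)"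
      by (intro mult_left_mono heat_mixture_Lr[OF r \<gamma> _ G t]) auto
    also have "\<dots> = ennreal (?N2 powr r * (G * t powr (c - ?b * \<gamma>)) powr r)"
      by (simp flip: ennreal_mult)
    also have "?N2 powr r * (G * t powr (c - ?b * \<gamma>)) powr r = (?N2 * (G * t powr (c - ?b * \<gamma>))) powr r"
      by (rule powr_mult[symmetric])
    finally show ?thesis by (simp add: mult.assoc)
  qed
  show "\<bar>heat_mixture \<nu> 1 ?b c t x - heat_mixture \<nu> 1 ?b c s x\<bar>
      \<le> (1 + (?b * real CARD('n) / 2 - c) + 2 * ?b) * ((t - s) / s) powr \<epsilon> *
        (?N2 * heat_mixture \<nu> 2 ?b c s x + ?N2 * heat_mixture \<nu> 2 ?b c t x)" if "0 < s" "s < t" for s t and x :: "real^'n"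
  proof -
    have "0 \<le> ?b * real CARD('n) / 2" using ab by simp
    then have "c \<le> ?b * real CARD('n) / 2" using c by linarith
    from heat_mixture_difference[OF that _ this, of \<epsilon> x] b \<epsilon> show ?thesis
      by (simp only: distrib_left)
  qed
  have "0 \<le> ?b * real CARD('n) / 2" using ab by simp
  then show "0 < 1 + (?b * real CARD('n) / 2 - c) + 2 * ?b" using c b by linarith
  have "0 \<le> ?b * \<gamma>" using ab g0 by simp
  then show "0 \<le> ?b * \<gamma> - c" using c by linarith
qed (use r G \<epsilon> in auto)

lemma abs_nonlinearity:
  assumes "1 \<le> p"
  shows "\<bar>nonlinearity p w\<bar> = \<bar>w\<bar> powr p"
proof (cases "w = 0")
  case False
  then have "\<bar>w\<bar> powr (p - 1) * \<bar>w\<bar> = \<bar>w\<bar> powr (p - 1) * \<bar>w\<bar> powr 1" by simp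
  also have "\<dots> = \<bar>w\<bar> powr p" by (simp only: powr_add[symmetric]) simp
  finally show ?thesis by (simp add: nonlinearity_def abs_mult)
qed (simp add: nonlinearity_def)

text \<open>
The exponent \<open>q / p\<close> of the space that contains the nonlinearity of an \<open>L\<^sup>q\<close> function.
\<close>

definition source_exponent :: "ereal \<Rightarrow> real \<Rightarrow> ereal" where
  "source_exponent q p = (if q = \<infinity> then \<infinity> else ereal (real_of_ereal q / p))"

text \<open>
The solution \<open>r\<close> of \<open>1 / r = 1 - (p - 1) / q\<close>, which is the exponent for the kernel in Young's inequality.
\<close>

definition kernel_exponent :: "ereal \<Rightarrow> real \<Rightarrow> real" where
  "kernel_exponent q p = (if q = \<infinity> then 1 else real_of_ereal q / (real_of_ereal q - p + 1))"

lemma kernel_exponent: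
  assumes p: "1 \<le> p" and q: "ereal p \<le> q"
  shows "1 \<le> kernel_exponent q p" "young_exponents q (source_exponent q p) (kernel_exponent q p)"
    and "1 - 1 / kernel_exponent q p = (if q = \<infinity> then 0 else (p - 1) / real_of_ereal q)"
proof -
  have "1 \<le> kernel_exponent q p \<and> young_exponents q (source_exponent q p) (kernel_exponent q p) \<and>
    1 - 1 / kernel_exponent q p = (if q = \<infinity> then 0 else (p - 1) / real_of_ereal q)"
  proof (cases q)
    case (real q')
    have q': "p \<le> q'" "0 < q'" "0 < q' - p + 1" using q p real by auto
    have k: "1 / (q' / (q' - p + 1)) = 1 - (p - 1) / q'" using q' by (simp add: field_simps)
    have "1 \<le> q' / (q' - p + 1)" using q' p by (simp add: field_simps)
    moreover have "1 \<le> q' / p" using q' p by (simp add: field_simps)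
    moreover have "1 / (q' / p) + 1 / (q' / (q' - p + 1)) = 1 + 1 / q'"
      unfolding k using q' p by (simp add: field_simps)
    ultimately show ?thesis
      using real q' k by (auto simp: kernel_exponent_def source_exponent_def young_exponents_def)
  qed (use q in \<open>auto simp: kernel_exponent_def source_exponent_def young_exponents_def\<close>)
  then show "1 \<le> kernel_exponent q p" "young_exponents q (source_exponent q p) (kernel_exponent q p)"
    and "1 - 1 / kernel_exponent q p = (if q = \<infinity> then 0 else (p - 1) / real_of_ereal q)" by auto
qed

lemma Lq_bound_nonlinearity:
  fixes g :: "real^'n \<Rightarrow> real"
  assumes p: "1 \<le> p" and q: "ereal p \<le> q" and g: "in_Lq q g" "Lq_norm q g \<le> M" and M: "1 \<le> M"
  shows "Lq_bound (source_exponent q p) (\<lambda>x. ennreal \<bar>nonlinearity p (g x)\<bar>) (M powr p)"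
proof -
  have q1: "1 \<le> q" using p q by (metis ereal_less_eq(3) one_ereal_def order_trans)
  have b: "Lq_bound q (\<lambda>x. ennreal \<bar>g x\<bar>) M"
    using in_Lq_imp_bound[OF q1 g(1)] g(2) by (intro Lq_bound_mono[OF q1 _ g(2)]) auto
  show ?thesis
  proof (cases "q = \<infinity>")
    case True
    with b have "AE x in lborel. ennreal \<bar>g x\<bar> \<le> ennreal M" by (simp add: Lq_bound_def)
    then have "AE x in lborel. ennreal \<bar>nonlinearity p (g x)\<bar> \<le> ennreal (M powr p)"
    proof eventually_elim
      case (elim x)
      then have "\<bar>g x\<bar> \<le> M" using M by simp
      then show ?case unfolding abs_nonlinearity[OF p] using p by (intro ennreal_leI powr_mono2) auto
    qed
    with True show ?thesis by (simp add: Lq_bound_def source_exponent_def)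
  next
    case False
    then obtain q' where q': "q = ereal q'" "1 \<le> q'" using q1 by (cases q) auto
    have "(\<integral>\<^sup>+x. ennreal (\<bar>g x\<bar> powr q') \<partial>lborel) \<le> ennreal (M powr q')"
      using b q' by (simp add: Lq_bound_def)
    then show ?thesis
      using q' p by (simp add: Lq_bound_def source_exponent_def abs_nonlinearity powr_powr)
  qed
qed

lemma Lq_norm_diff_commute: "Lq_norm q (\<lambda>x. f x - g x) = Lq_norm q (\<lambda>x. g x - f x)"
  by (simp add: Lq_norm_def abs_minus_commute)

lemma Lq_norm_nonneg:
  fixes f :: "real^'n \<Rightarrow> real"
  shows "0 \<le> Lq_norm q f"
proof (cases "q = \<infinity>")
  case True
  have "esssup (lborel :: (real^'n) measure) (\<lambda>x. 0 :: ereal) \<le> esssup lborel (\<lambda>x. ereal \<bar>f x\<bar>)"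
    by (rule esssup_mono) auto
  then have "0 \<le> esssup lborel (\<lambda>x. ereal \<bar>f x\<bar>)" by (subst (asm) esssup_const) auto
  then show ?thesis using True by (simp add: Lq_norm_def real_of_ereal_pos)
qed (simp add: Lq_norm_def)

lemma AE_lborel_ex_in_interval:
  fixes a b :: real
  assumes "AE t in lborel. P t" "a < b"
  shows "\<exists>t. a < t \<and> t < b \<and> P t"
proof (rule ccontr)
  assume "\<not> ?thesis"
  then have "AE t in lborel. t \<notin> {a<..<b}" using assms(1) by (auto elim!: eventually_mono)
  then have "{a<..<b} \<in> null_sets lborel"
    by (subst (asm) AE_iff_null_sets[symmetric]) auto
  then show False using assms(2) by (auto simp: null_sets_def)
qed

text \<open>
On a time interval \<open>(0, T')\<close> with \<open>T' < T\<close> the solution is bounded in \<open>L\<^sup>q\<close>, hence the source is bounded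
in \<open>L\<close> with exponent \<open>q / p\<close>. The free part is the convolution of \<open>u0\<close> with \<open>Z\<close> and the rest is a Duhamel
term with kernel \<open>Y\<close>; the two estimates add up.
\<close>

lemma mild_solution_continuous_interior:
  fixes \<alpha> \<beta> p l :: real and q T :: ereal
    and Z Y :: "real \<Rightarrow> real^'n \<Rightarrow> real"
    and u0 :: "real^'n \<Rightarrow> real"
    and u :: "real \<Rightarrow> real^'n \<Rightarrow> real"
  assumes a: "0 < \<alpha>" "\<alpha> < 1" and b: "0 < \<beta>" "\<beta> \<le> 1"
    and Z: "is_kernel_Z \<alpha> \<beta> Z" and Y: "is_kernel_Y \<alpha> \<beta> Y"
    and p: "1 \<le> p" and l: "l = real CARD('n) / (2 * \<beta>) * (p - 1)"
    and lq: "ereal l < q" and pq: "ereal p \<le> q" and u0: "in_Lq q u0"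
    and sol: "Lq_solution Z Y p q T u0 u"
    and T': "0 < T'" "ereal T' < T"
  shows "\<And>t. 0 < t \<Longrightarrow> t < T' \<Longrightarrow> mild_rhs_converges Z Y p u0 u t"
    and "\<And>t. 0 < t \<Longrightarrow> t < T' \<Longrightarrow> in_Lq q (mild_rhs Z Y p u0 u t)"
    and "\<And>t0. 0 < t0 \<Longrightarrow> t0 < T' \<Longrightarrow>
      ((\<lambda>t. Lq_norm q (\<lambda>x. mild_rhs Z Y p u0 u t x - mild_rhs Z Y p u0 u t0 x)) \<longlongrightarrow> 0) (at t0)"
proof -
  have q1: "1 \<le> q" using p pq by (metis ereal_less_eq(3) one_ereal_def order_trans)
  define r where "r = kernel_exponent q p"
  define \<gamma> where "\<gamma> = real CARD('n) / 2 * (1 - 1 / r)"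
  note ke = kernel_exponent[OF p pq, folded r_def]
  have \<gamma>: "0 \<le> \<gamma>" "\<gamma> < \<beta>"
  proof -
    show "0 \<le> \<gamma>" using ke(1) by (simp add: \<gamma>_def)
    show "\<gamma> < \<beta>"
    proof (cases "q = \<infinity>")
      case True
      then show ?thesis using ke(3) b by (simp add: \<gamma>_def)
    next
      case False
      then obtain q' where q': "q = ereal q'" "1 \<le> q'" using q1 by (cases q) auto
      have "real CARD('n) / (2 * \<beta>) * (p - 1) < q'" using lq q' l by simp
      then have "real CARD('n) * (p - 1) < 2 * \<beta> * q'" using b by (simp add: field_simps)
      then have "real CARD('n) * (p - 1) / (2 * q') < \<beta>" using q' by (simp add: pos_divide_less_eq mult_ac)
      moreover have "\<gamma> = real CARD('n) * (p - 1) / (2 * q')" using ke(3) q' by (simp add: \<gamma>_def)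
      ultimately show ?thesis by simp
    qed
  qed
  define d where "d = \<alpha> / \<beta> * \<gamma> - (\<alpha> - 1)"
  have d1: "d < 1" "0 \<le> d"
  proof -
    have "\<alpha> * \<gamma> < \<alpha> * \<beta>" "0 \<le> \<alpha> * \<gamma> / \<beta>" using a b \<gamma> by simp_all
    then show "d < 1" "0 \<le> d" using a b by (simp_all add: d_def pos_divide_less_eq)
  qed
  \<comment> \<open>any positive value with \<open>d + \<epsilon> < 1\<close> would do\<close>
  define \<epsilon> where "\<epsilon> = (1 - d) / 2"
  have \<epsilon>: "0 < \<epsilon>" "\<epsilon> \<le> 1" "d + \<epsilon> < 1" using d1 by (simp_all add: \<epsilon>_def field_simps)
  have gb: "\<exists>G. X \<le> ennreal G \<and> 0 < G" if X: "X < \<infinity>" for X :: ennreal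
  proof -
    have "X = ennreal (enn2real X)" using X by simp
    also have "\<dots> \<le> ennreal (enn2real X + 1)" by (intro ennreal_leI) simp
    finally show ?thesis by (intro exI[of _ "enn2real X + 1"]) (simp add: add_nonneg_pos)
  qed
  obtain \<nu>Y where \<nu>Y: "finite_measure \<nu>Y" "sets \<nu>Y = sets borel" "AE \<theta> in \<nu>Y. 0 < \<theta>"
      "\<And>y. 0 \<le> y \<Longrightarrow> (\<integral>\<theta>. exp (- (y * \<theta>)) \<partial>\<nu>Y) = mittag_leffler \<alpha> \<alpha> (- (y powr \<beta>))"
      "(\<integral>\<^sup>+\<theta>. ennreal (\<theta> powr (- \<gamma>)) \<partial>\<nu>Y) < \<infinity>"
    using mixing_measure_Y[OF a b \<gamma>] by (elim exE conjE) (rule that; simp)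
  obtain GY where GY: "(\<integral>\<^sup>+\<theta>. ennreal (\<theta> powr (- \<gamma>)) \<partial>\<nu>Y) \<le> ennreal GY" "0 < GY"
    using gb[OF \<nu>Y(5)] by (elim exE conjE) (rule that)
  obtain \<nu>Z where \<nu>Z: "finite_measure \<nu>Z" "sets \<nu>Z = sets borel" "AE \<theta> in \<nu>Z. 0 < \<theta>"
      "\<And>y. 0 \<le> y \<Longrightarrow> (\<integral>\<theta>. exp (- (y * \<theta>)) \<partial>\<nu>Z) = mittag_leffler \<alpha> 1 (- (y powr \<beta>))"
      "(\<integral>\<^sup>+\<theta>. ennreal (\<theta> powr (- 0)) \<partial>\<nu>Z) < \<infinity>"
    using mixing_measure_Z[OF a b] by (elim exE conjE) (rule that; simp)
  obtain GZ where GZ: "(\<integral>\<^sup>+\<theta>. ennreal (\<theta> powr (- 0)) \<partial>\<nu>Z) \<le> ennreal GZ" "0 < GZ"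
    using gb[OF \<nu>Z(5)] by (elim exE conjE) (rule that)
  interpret Ym: mixing_measure \<nu>Y using \<nu>Y by (simp add: mixing_measure_def mixing_measure_axioms_def)
  interpret Zm: mixing_measure \<nu>Z using \<nu>Z by (simp add: mixing_measure_def mixing_measure_axioms_def)
  define KY where "KY = (heat_mixture \<nu>Y 1 (\<alpha> / \<beta>) (\<alpha> - 1) :: real \<Rightarrow> real^'n \<Rightarrow> real)"
  define VY where "VY = (\<lambda>t (x :: real^'n). 2 powr (real CARD('n) / 2) * heat_mixture \<nu>Y 2 (\<alpha> / \<beta>) (\<alpha> - 1) t x)"
  define G2 where "G2 = 2 powr (real CARD('n) / 2) * GY"
  define C2 where "C2 = 1 + (\<alpha> / \<beta> * real CARD('n) / 2 - (\<alpha> - 1)) + 2 * (\<alpha> / \<beta>)"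
  define KZ where "KZ = (heat_mixture \<nu>Z 1 (\<alpha> / \<beta>) 0 :: real \<Rightarrow> real^'n \<Rightarrow> real)"
  define VZ where "VZ = (\<lambda>t (x :: real^'n). 2 powr (real CARD('n) / 2) * heat_mixture \<nu>Z 2 (\<alpha> / \<beta>) 0 t x)"
  define G1 where "G1 = 2 powr (real CARD('n) / 2) * GZ"
  define C1 where "C1 = 1 + (\<alpha> / \<beta> * real CARD('n) / 2 - 0) + 2 * (\<alpha> / \<beta>)"
  have skY: "smoothing_kernel Y KY VY r d G2 C2 \<epsilon>"
    unfolding KY_def VY_def G2_def C2_def d_def
  proof (rule Ym.smoothing_kernel_heat_mixture[where \<phi> = "\<lambda>x. mittag_leffler \<alpha> \<alpha> (- x)"])
    show "1 \<le> r" by (rule ke)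
    show "\<gamma> = real CARD('n) / 2 * (1 - 1 / r)" by (rule \<gamma>_def)
  qed (use a b Y \<nu>Y(4) GY \<epsilon> in \<open>auto simp: is_kernel_Y_def has_spatial_fourier_def\<close>)
  have skZ: "smoothing_kernel Z KZ VZ 1 (\<alpha> / \<beta> * 0 - 0) G1 C1 1"
    unfolding KZ_def VZ_def G1_def C1_def
    by (rule Zm.smoothing_kernel_heat_mixture[where \<phi> = "\<lambda>x. mittag_leffler \<alpha> 1 (- x)"])
       (use a b Z \<nu>Z(4) GZ in \<open>auto simp: is_kernel_Z_def has_spatial_fourier_def\<close>)
  then have skZ: "smoothing_kernel Z KZ VZ 1 0 G1 C1 1" by simp
  interpret Zk: smoothing_kernel Z KZ VZ 1 0 G1 C1 1 by (rule skZ)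
  \<comment> \<open>one is added because Young's inequality is stated for positive bounds\<close>
  define B0 where "B0 = Lq_norm q u0 + 1"
  note u0b = in_Lq_imp_bound[OF q1 u0]
  have B0: "0 < B0" "Lq_bound q (\<lambda>y. ennreal \<bar>u0 y\<bar>) B0"
    using u0b Lq_bound_mono[OF q1 u0b(3), of B0] by (auto simp: B0_def)
  have exZ: "young_exponents q q 1"
    using q1 by (cases q) (auto simp: young_exponents_def)
  obtain M0 where M0: "AE t in lborel. 0 < t \<and> t < T' \<longrightarrow> in_Lq q (u t) \<and> Lq_norm q (u t) \<le> M0"
    using sol T' unfolding Lq_solution_def by blast
  define M where "M = max 1 M0"
  define B where "B = M powr p"
  have M: "1 \<le> M" "M0 \<le> M" by (auto simp: M_def)
  have B: "0 < B" using M by (simp add: B_def)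
  define f where "f s y = indicator {0<..<T'} s * nonlinearity p (u s y)" for s y
  have "duhamel_term Y KY VY r d G2 C2 \<epsilon> f T' B q (source_exponent q p)"
  proof (rule duhamel_term.intro[OF skY], unfold_locales)
    have U: "(\<lambda>z. indicator ({t. 0 < t \<and> ereal t < T} \<times> UNIV) z *\<^sub>R (case z of (t, x) \<Rightarrow> u t x)) \<in> borel_measurable (lborel \<Otimes>\<^sub>M lborel)"
      using sol unfolding Lq_solution_def set_borel_measurable_def by blast
    have "(\<lambda>z :: real \<times> (real^'n). f (fst z) (snd z)) = (\<lambda>z. indicator {0<..<T'} (fst z) *
        nonlinearity p (indicator ({t. 0 < t \<and> ereal t < T} \<times> UNIV) z *\<^sub>R (case z of (t, x) \<Rightarrow> u t x)))"
    proof
      fix z :: "real \<times> (real^'n)"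
      have "ereal (fst z) < T" if "fst z < T'" using that by (intro less_trans[OF _ T'(2)]) simp
      then show "f (fst z) (snd z) = indicator {0<..<T'} (fst z) *
        nonlinearity p (indicator ({t. 0 < t \<and> ereal t < T} \<times> UNIV) z *\<^sub>R (case z of (t, x) \<Rightarrow> u t x))"
        by (cases z) (auto simp: f_def indicator_def)
    qed
    also have "\<dots> \<in> borel_measurable (lborel \<Otimes>\<^sub>M lborel)"
      unfolding nonlinearity_def using U by measurable
    finally show "(\<lambda>z. f (fst z) (snd z)) \<in> borel_measurable (lborel \<Otimes>\<^sub>M lborel)" .
    show "f s y = 0" if "s \<le> 0 \<or> T' \<le> s" for s y using that by (auto simp: f_def)
    show "AE s in lborel. Lq_bound (source_exponent q p) (\<lambda>y. ennreal \<bar>f s y\<bar>) B"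
      using M0
    proof eventually_elim
      case (elim s)
      show ?case
      proof (cases "0 < s \<and> s < T'")
        case True
        then have "Lq_bound (source_exponent q p) (\<lambda>y. ennreal \<bar>nonlinearity p (u s y)\<bar>) (M powr p)"
          using elim M by (intro Lq_bound_nonlinearity[OF p pq _ _ M(1)]) auto
        then show ?thesis using True by (simp add: f_def B_def)
      next
        case False
        then have "f s = (\<lambda>_. 0)" by (auto simp: f_def)
        then show ?thesis by (simp add: Lq_bound_def)
      qed
    qed
    show "0 < B" "1 \<le> q" "young_exponents q (source_exponent q p) r" "d + \<epsilon> < 1" by (fact B q1 ke(2) \<epsilon>(3))+
  qed
  then interpret D: duhamel_term Y KY VY r d G2 C2 \<epsilon> f T' B q "source_exponent q p" .
  define cv where "cv t x = (LINT y|lborel. u0 y * Z t (x - y))" for t x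
  have rhs: "mild_rhs Z Y p u0 u t x = cv t x + duhamel f Y t x" if "0 < t" "t < T'" for t x
  proof -
    have "duhamel (\<lambda>s y. nonlinearity p (u s y)) Y t x = duhamel f Y t x"
      unfolding duhamel_def using that
      by (intro set_lebesgue_integral_cong) (auto simp: f_def)
    then show ?thesis by (simp add: mild_rhs_def cv_def duhamel_def)
  qed
  note cvL = Zk.convolution_Lq[OF q1 _ u0b(1) B0(2) B0(1) exZ, folded cv_def]
  note cvD = Zk.convolution_Lq_difference[OF q1 _ _ u0b(1) B0(2) B0(1) exZ, folded cv_def]
  show conv: "mild_rhs_converges Z Y p u0 u t" if t: "0 < t" "t < T'" for t
    unfolding mild_rhs_converges_def
    using Zk.convolution_Lq(1)[OF q1 t(1) u0b(1) B0(2) B0(1) exZ] D.AE_H_finite[OF t(1)]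
  proof eventually_elim
    case (elim x)
    have "set_integrable (lborel \<Otimes>\<^sub>M lborel) ({0<..<t} \<times> UNIV) (\<lambda>(s, y). nonlinearity p (u s y) * Y (t - s) (x - y))
      \<longleftrightarrow> set_integrable (lborel \<Otimes>\<^sub>M lborel) ({0<..<t} \<times> UNIV) (\<lambda>(s, y). f s y * Y (t - s) (x - y))"
      using t by (intro set_integrable_cong refl) (auto simp: f_def)
    then show ?case using elim(1) D.set_integrable_fY[OF elim(2)] by simp
  qed
  show Lq: "in_Lq q (mild_rhs Z Y p u0 u t)" if t: "0 < t" "t < T'" for t
  proof (rule Lq_quasi_triangle(1)[OF q1 cvL(3)[OF t(1)] D.duhamel_in_Lq[OF t(1)]])
    show "mild_rhs Z Y p u0 u t \<in> borel_measurable borel"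
      using cvL(2)[OF t(1)] D.duhamel_measurable[of t] by (subst rhs[OF t, abs_def]) measurable
    show "AE x in lborel. \<bar>mild_rhs Z Y p u0 u t x\<bar> \<le> \<bar>cv t x\<bar> + \<bar>duhamel f Y t x\<bar>"
      using rhs[OF t] by (auto intro!: AE_I2)
  qed
  \<comment> \<open>the increment of the solution over a time step \<open>h\<close> after time \<open>m\<close>; the exponents \<open>1\<close> and
  \<open>- (0 + 1)\<close> are \<open>\<epsilon>\<close> and \<open>- (d + \<epsilon>)\<close> for the kernel \<open>Z\<close>, where \<open>d = 0\<close> and \<open>\<epsilon> = 1\<close>\<close>
  define R where "R m h = 2 * (4 * C1 * G1 * h powr 1 * m powr (- (0 + 1)) * B0 +
      (4 * C2 * G2 * h powr \<epsilon> * (T' powr (1 - (d + \<epsilon>)) / (1 - (d + \<epsilon>))) + G2 * (h powr (1 - d) / (1 - d))) * B)" for m h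
  have step: "Lq_norm q (\<lambda>x. mild_rhs Z Y p u0 u t x - mild_rhs Z Y p u0 u s x) \<le> R m (t - s)"
    if st: "0 < m" "m \<le> s" "s < t" "t < T'" for m s t
  proof -
    have s0: "0 < s" "0 < t" "s < T'" using st by auto
    have "Lq_norm q (\<lambda>x. mild_rhs Z Y p u0 u t x - mild_rhs Z Y p u0 u s x)
       \<le> 2 * (Lq_norm q (\<lambda>x. cv t x - cv s x) + Lq_norm q (\<lambda>x. duhamel f Y t x - duhamel f Y s x))"
    proof (rule Lq_quasi_triangle(2)[OF q1])
      show "in_Lq q (\<lambda>x. cv t x - cv s x)" by (rule cvD(1)[OF s0(1) st(3)])
      have dm: "(\<lambda>x. duhamel f Y t x - duhamel f Y s x) \<in> borel_measurable borel"
        using D.duhamel_measurable[of t] D.duhamel_measurable[of s] by measurable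
      show "in_Lq q (\<lambda>x. duhamel f Y t x - duhamel f Y s x)"
        by (rule Lq_quasi_triangle(1)[OF q1 D.duhamel_in_Lq[OF s0(2)] D.duhamel_in_Lq[OF s0(1)] dm]) (auto intro!: AE_I2)
      show "(\<lambda>x. mild_rhs Z Y p u0 u t x - mild_rhs Z Y p u0 u s x) \<in> borel_measurable borel"
        using cvL(2)[OF s0(1)] cvL(2)[OF s0(2)] D.duhamel_measurable[of t] D.duhamel_measurable[of s]
        unfolding rhs[OF s0(1,3)] rhs[OF s0(2) st(4)] by measurable
      show "AE x in lborel. \<bar>mild_rhs Z Y p u0 u t x - mild_rhs Z Y p u0 u s x\<bar>
          \<le> \<bar>cv t x - cv s x\<bar> + \<bar>duhamel f Y t x - duhamel f Y s x\<bar>"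
        unfolding rhs[OF s0(1,3)] rhs[OF s0(2) st(4)] by (auto intro!: AE_I2)
    qed
    also have "\<dots> \<le> R m (t - s)"
      unfolding R_def
    proof (intro mult_left_mono add_mono)
      have "Lq_norm q (\<lambda>x. cv t x - cv s x) \<le> 4 * C1 * G1 * (t - s) powr 1 * s powr (- (0 + 1)) * B0"
        by (rule cvD(2)[OF s0(1) st(3)])
      also have "\<dots> \<le> 4 * C1 * G1 * (t - s) powr 1 * m powr (- (0 + 1)) * B0"
        using st Zk.C Zk.G B0(1) by (intro mult_right_mono mult_left_mono powr_mono2') auto
      finally show "Lq_norm q (\<lambda>x. cv t x - cv s x) \<le> 4 * C1 * G1 * (t - s) powr 1 * m powr (- (0 + 1)) * B0" .
      have "Lq_norm q (\<lambda>x. duhamel f Y t x - duhamel f Y s x) \<le>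
         (4 * C2 * G2 * (t - s) powr \<epsilon> * (s powr (1 - (d + \<epsilon>)) / (1 - (d + \<epsilon>))) + G2 * ((t - s) powr (1 - d) / (1 - d))) * B"
        by (rule D.duhamel_difference[OF s0(1) st(3)])
      also have "\<dots> \<le> (4 * C2 * G2 * (t - s) powr \<epsilon> * (T' powr (1 - (d + \<epsilon>)) / (1 - (d + \<epsilon>))) + G2 * ((t - s) powr (1 - d) / (1 - d))) * B"
        using s0 \<epsilon> B D.C D.G
        by (intro mult_right_mono add_right_mono mult_left_mono divide_right_mono powr_mono2) auto
      finally show "Lq_norm q (\<lambda>x. duhamel f Y t x - duhamel f Y s x) \<le>
         (4 * C2 * G2 * (t - s) powr \<epsilon> * (T' powr (1 - (d + \<epsilon>)) / (1 - (d + \<epsilon>))) + G2 * ((t - s) powr (1 - d) / (1 - d))) * B" .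
    qed simp
    finally show ?thesis .
  qed
  show "((\<lambda>t. Lq_norm q (\<lambda>x. mild_rhs Z Y p u0 u t x - mild_rhs Z Y p u0 u t0 x)) \<longlongrightarrow> 0) (at t0)"
    if t0: "0 < t0" "t0 < T'" for t0
  proof (rule tendsto_sandwich[where f = "\<lambda>_. 0" and h = "\<lambda>t. R (t0 / 2) \<bar>t - t0\<bar>"])
    have abs0: "((\<lambda>t. \<bar>t - t0\<bar>) \<longlongrightarrow> 0) (at t0)"
      by (intro tendsto_rabs_zero LIM_zero tendsto_ident_at)
    have pw: "((\<lambda>t. \<bar>t - t0\<bar> powr k) \<longlongrightarrow> 0) (at t0)" if "0 < k" for k
      using that by (intro tendsto_zero_powrI[OF abs0 tendsto_const]) auto
    have "((\<lambda>t. R (t0 / 2) \<bar>t - t0\<bar>) \<longlongrightarrow> 2 * (4 * C1 * G1 * 0 * (t0 / 2) powr (- (0 + 1)) * B0 +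
      (4 * C2 * G2 * 0 * (T' powr (1 - (d + \<epsilon>)) / (1 - (d + \<epsilon>))) + G2 * (0 / (1 - d))) * B)) (at t0)"
      unfolding R_def using \<epsilon> d1 by (intro tendsto_intros pw) auto
    then show "((\<lambda>t. R (t0 / 2) \<bar>t - t0\<bar>) \<longlongrightarrow> 0) (at t0)" by simp
    have "eventually (\<lambda>t. t \<in> {t0 / 2<..<T'}) (at t0)"
      using t0 by (intro eventually_at_in_open') auto
    moreover have "eventually (\<lambda>t. t \<noteq> t0) (at t0)" by (simp add: eventually_at_filter)
    ultimately show "eventually (\<lambda>t. Lq_norm q (\<lambda>x. mild_rhs Z Y p u0 u t x - mild_rhs Z Y p u0 u t0 x) \<le> R (t0 / 2) \<bar>t - t0\<bar>) (at t0)"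
    proof eventually_elim
      case (elim t)
      show ?case
      proof (cases "t < t0")
        case True
        have "Lq_norm q (\<lambda>x. mild_rhs Z Y p u0 u t0 x - mild_rhs Z Y p u0 u t x) \<le> R (t0 / 2) (t0 - t)"
          using elim t0 True by (intro step) auto
        then show ?thesis using True by (subst Lq_norm_diff_commute) simp
      next
        case False
        then show ?thesis using step[of "t0 / 2" t0 t] elim t0 by simp
      qed
    qed
  qed (auto simp: Lq_norm_nonneg)
qed

theorem proposition3p1:
  fixes \<alpha> \<beta> p l :: real and q T :: ereal
    and Z Y :: "real \<Rightarrow> real^'n \<Rightarrow> real"
    and u0 :: "real^'n \<Rightarrow> real"
    and u :: "real \<Rightarrow> real^'n \<Rightarrow> real"
  assumes "0 < \<alpha>" "\<alpha> < 1"
    and "0 < \<beta>" "\<beta> \<le> 1"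
    and "real CARD('n) > 4 * \<beta>"
    and "is_kernel_Z \<alpha> \<beta> Z"
    and "is_kernel_Y \<alpha> \<beta> Y"
    and "1 \<le> p"
    and "l = real CARD('n) / (2 * \<beta>) * (p - 1)"
    and "ereal l < q"
    and "ereal p \<le> q"
    and "in_Lq q u0"
    and "0 < T"
    and "Lq_solution Z Y p q T u0 u"
  shows "(\<forall>t. 0 < t \<and> ereal t < T \<longrightarrow> mild_rhs_converges Z Y p u0 u t) \<and>
    continuous_Lq q T (mild_representative Z Y p u0 u)"
proof -
  let ?v = "mild_representative Z Y p u0 u"
  note interior = mild_solution_continuous_interior[OF assms(1-4,6-12,14)]
  have q1: "1 \<le> q" using assms(8,11) by (metis ereal_less_eq(3) one_ereal_def order_trans)
  have between: "\<exists>T'. t < T' \<and> 0 < T' \<and> ereal T' < T" if t: "0 \<le> t" "ereal t < T" for t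
  proof -
    obtain T' where "ereal t < ereal T'" "ereal T' < T" using ereal_dense2[OF t(2)] by blast
    with t show ?thesis by (intro exI[of _ T']) auto
  qed
  have conv: "mild_rhs_converges Z Y p u0 u t" if "0 < t" "ereal t < T" for t
    using between[of t] that interior(1) by fastforce
  have v: "?v t = mild_rhs Z Y p u0 u t" if "0 < t" for t
    using that by (auto simp: mild_representative_def)
  have Lq: "in_Lq q (?v t)" if "0 \<le> t" "ereal t < T" for t
  proof (cases "t = 0")
    case True
    then show ?thesis using assms(12) by (simp add: mild_representative_def)
  next
    case False
    with that have t: "0 < t" by simp
    then show ?thesis using between[of t] that interior(2) v[OF t] by fastforce
  qed
  have cont: "((\<lambda>t. Lq_norm q (\<lambda>x. ?v t x - ?v t0 x)) \<longlongrightarrow> 0) (at t0)" if t0: "0 < t0" "ereal t0 < T" for t0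
  proof -
    obtain T' where T': "t0 < T'" "0 < T'" "ereal T' < T" using between[of t0] t0 by auto
    have "eventually (\<lambda>t. 0 < t) (at t0)" using t0 by (intro order_tendstoD(1)[OF tendsto_ident_at])
    then have "eventually (\<lambda>t. Lq_norm q (\<lambda>x. mild_rhs Z Y p u0 u t x - mild_rhs Z Y p u0 u t0 x)
        = Lq_norm q (\<lambda>x. ?v t x - ?v t0 x)) (at t0)"
      by eventually_elim (simp add: v t0)
    then show ?thesis
      using interior(3)[OF T'(2,3) t0(1) T'(1)] by (rule Lim_transform_eventually[rotated])
  qed
  have zero: "((\<lambda>t. Lq_norm q (\<lambda>x. ?v t x - ?v 0 x)) \<longlongrightarrow> 0) (at 0 within {t. 0 \<le> t \<and> ereal t < T})"
  proof (rule tendstoI)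
    fix e :: real assume e: "0 < e"
    obtain \<delta> where \<delta>: "0 < \<delta>" "AE t in lborel. 0 < t \<and> t < \<delta> \<and> ereal t < T \<longrightarrow> Lq_norm q (\<lambda>x. u t x - u0 x) < e / 8"
    proof -
      have "\<forall>\<epsilon>>0. \<exists>\<delta>>0. AE t in lborel. 0 < t \<and> t < \<delta> \<and> ereal t < T \<longrightarrow> Lq_norm q (\<lambda>x. u t x - u0 x) < \<epsilon>"
        using assms(14) unfolding Lq_solution_def by blast
      from this[rule_format, of "e / 8"] e that show ?thesis by auto
    qed
    have eq: "AE t in lborel. 0 < t \<and> ereal t < T \<longrightarrow> (AE x in lborel. u t x = mild_rhs Z Y p u0 u t x)"
    proof -
      have "AE t in lborel. 0 < t \<and> ereal t < T \<longrightarrow>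
          mild_rhs_converges Z Y p u0 u t \<and> (AE x in lborel. u t x = mild_rhs Z Y p u0 u t x)"
        using assms(14) unfolding Lq_solution_def by blast
      then show ?thesis by eventually_elim blast
    qed
    have main: "Lq_norm q (\<lambda>x. ?v t x - ?v 0 x) < e" if t: "0 < t" "t < \<delta>" "ereal t < T" for t
    proof -
      obtain T' where T': "t < T'" "ereal T' < T" using between[of t] t by auto
      have "eventually (\<lambda>s. Lq_norm q (\<lambda>x. ?v s x - ?v t x) < e / 8) (at t)"
        using order_tendstoD(2)[OF cont[OF t(1,3)], of "e / 8"] e by simp
      then obtain w where w: "0 < w" "\<And>s. s \<noteq> t \<Longrightarrow> \<bar>s - t\<bar> < w \<Longrightarrow> Lq_norm q (\<lambda>x. ?v s x - ?v t x) < e / 8"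
        unfolding eventually_at by (auto simp: dist_real_def)
      \<comment> \<open>the almost everywhere statements hold at some time \<open>s\<close> in \<open>(t, hi)\<close>, and there
      the representative is close to its value at \<open>t\<close>\<close>
      define hi where "hi = Min {t + w, \<delta>, T'}"
      have hi: "t < hi" "hi \<le> t + w" "hi \<le> \<delta>" "hi \<le> T'" using w t T' by (auto simp: hi_def)
      obtain s where s: "t < s" "s < hi"
        and sd: "0 < s \<and> s < \<delta> \<and> ereal s < T \<longrightarrow> Lq_norm q (\<lambda>x. u s x - u0 x) < e / 8"
        and se: "0 < s \<and> ereal s < T \<longrightarrow> (AE x in lborel. u s x = mild_rhs Z Y p u0 u s x)"
        and sL: "0 < s \<and> ereal s < T \<longrightarrow> u s \<in> borel_measurable borel"
      proof -
        have U: "(\<lambda>z. indicator ({t. 0 < t \<and> ereal t < T} \<times> UNIV) z *\<^sub>R (case z of (t, x) \<Rightarrow> u t x)) \<in> borel_measurable (lborel \<Otimes>\<^sub>M lborel)"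
          using assms(14) unfolding Lq_solution_def set_borel_measurable_def by blast
        have um: "u s \<in> borel_measurable borel" if "0 < s \<and> ereal s < T" for s
          using measurable_compose[OF measurable_Pair1'[of s lborel lborel] U] that by simp
        have "AE s in lborel. (0 < s \<and> s < \<delta> \<and> ereal s < T \<longrightarrow> Lq_norm q (\<lambda>x. u s x - u0 x) < e / 8) \<and>
          (0 < s \<and> ereal s < T \<longrightarrow> (AE x in lborel. u s x = mild_rhs Z Y p u0 u s x))"
          using \<delta>(2) eq by eventually_elim blast
        from AE_lborel_ex_in_interval[OF this hi(1)] um that show ?thesis by blast
      qed
      have "ereal s < ereal T'" using s hi by simp
      then have "ereal s < T" using T'(2) by (rule less_trans)
      then have s0: "0 < s" "s < \<delta>" "ereal s < T" using s hi t by auto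
      have [measurable]: "?v t \<in> borel_measurable borel" "?v s \<in> borel_measurable borel" "u0 \<in> borel_measurable borel"
          "u s \<in> borel_measurable borel"
        using Lq[of t] Lq[of s] t s0 assms(12) sL by (auto simp: in_Lq_def)
      have ae: "AE x in lborel. u s x = ?v s x" using se s0 v by simp
      have us: "in_Lq q (u s)"
        by (rule Lq_quasi_triangle(1)[OF q1 Lq[of s] Lq[of s]])
           (use ae s0 in \<open>auto elim!: eventually_mono\<close>)
      have in1: "in_Lq q (\<lambda>x. u s x - u0 x)"
        by (rule Lq_quasi_triangle(1)[OF q1 us assms(12)]) (auto intro!: AE_I2)
      have in2: "in_Lq q (\<lambda>x. ?v s x - ?v t x)"
        by (rule Lq_quasi_triangle(1)[OF q1 Lq[of s] Lq[of t]]) (use s0 t in \<open>auto intro!: AE_I2\<close>)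
      have "Lq_norm q (\<lambda>x. ?v t x - u0 x) \<le> 2 * (Lq_norm q (\<lambda>x. ?v s x - ?v t x) + Lq_norm q (\<lambda>x. u s x - u0 x))"
        by (rule Lq_quasi_triangle(2)[OF q1 in2 in1]) (use ae in \<open>auto elim!: eventually_mono\<close>)
      also have "\<dots> \<le> 2 * (e / 8 + e / 8)"
        using w(2)[of s] sd s0 s hi by (intro mult_left_mono add_mono) auto
      also have "\<dots> < e" using e by simp
      finally show ?thesis by (simp add: mild_representative_def)
    qed
    have "eventually (\<lambda>t. t < \<delta>) (at 0 within {t. 0 \<le> t \<and> ereal t < T})"
      using \<delta> by (intro order_tendstoD(2)[OF tendsto_ident_at])
    moreover have "eventually (\<lambda>t. t \<noteq> 0 \<and> t \<in> {t. 0 \<le> t \<and> ereal t < T}) (at 0 within {t. 0 \<le> t \<and> ereal t < T})"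
      by (simp add: eventually_at_filter)
    ultimately show "eventually (\<lambda>t. dist (Lq_norm q (\<lambda>x. ?v t x - ?v 0 x)) 0 < e) (at 0 within {t. 0 \<le> t \<and> ereal t < T})"
    proof eventually_elim
      case (elim t)
      then show ?case using main[of t] Lq_norm_nonneg[of q "\<lambda>x. ?v t x - ?v 0 x"] by simp
    qed
  qed
  have "continuous_Lq q T ?v"
    unfolding continuous_Lq_def
  proof (intro conjI allI impI)
    show "in_Lq q (?v t)" if "0 \<le> t \<and> ereal t < T" for t using Lq that by blast
    fix t0 assume t0: "0 \<le> t0 \<and> ereal t0 < T"
    show "((\<lambda>t. Lq_norm q (\<lambda>x. ?v t x - ?v t0 x)) \<longlongrightarrow> 0) (at t0 within {t. 0 \<le> t \<and> ereal t < T})"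
    proof (cases "t0 = 0")
      case True
      then show ?thesis using zero by simp
    next
      case False
      with t0 have "0 < t0" "ereal t0 < T" by auto
      from tendsto_within_subset[OF cont[OF this] subset_UNIV] show ?thesis .
    qed
  qed
  with conv show ?thesis by blast
qed

end
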